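(* (Fundamental theorem of mixed type surfaces.) Let $g$ be an admissible mixed type metric on a smooth 2-manifold $\Sigma$ and $p\in S(g)$ a semidefinite point. Take a simply connected L-coordinate neighborhood $(U;u,v)$ centered at $p$ and set $g=E\,du^2+G\,dv^2$. Let $h=X\,du^2+2Y\,du\,dv+Z\,dv^2$ be a symmetric $(0,2)$-tensor defined on $U$. If $g$ and $h$ satisfy the Codazzi equations $$X_v-Y_u=\frac1{2E}(E_vX-E_uY)+Y^2-XZ,\qquad Y_v-Z_u=-\frac1{2E}(G_uX+E_vY)$$ and the Gauss equation $$E_{vv}+G_{uu}-\frac{E_uG_u+E_v^2}{2E}=2G(XZ-Y^2)-G_vX+2G_uY+E_vZ,$$ then there exist a mixed type surface $f:U\to\mathbf{L}^3$ and an L-Gauss map $\psi:U\to\Lambda^2$ such that (i) the first fundamental form of $f$ coincides with $g$, and (ii) the second fundamental form associated with $\psi$ coincides with $h$. Moreover, such $f$ and $\psi$ are unique up to isometries of $\mathbf{L}^3$.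
   Context: $\mathbf{L}^3$ is $\mathbb R^3$ with $\langle x,y\rangle=x_1y_1+x_2y_2-x_3y_3$; $\Lambda^2=\{x\in\mathbf{L}^3: \langle x,x\rangle=0,\ x\ne0\}$ is the lightcone. The vector product is $v\times w:=S(v\times_E w)$, $S=\mathrm{diag}(1,1,-1)$, $\times_E$ the Euclidean cross product. Isometries of $\mathbf{L}^3$ are maps $x\mapsto Ax+b$ with $A^TSA=S$; an isometry acts on $(f,\psi)$ by $(Af+b,A\psi)$. A metric on a smooth 2-manifold $\Sigma$ is a smooth symmetric $(0,2)$-tensor $g$ (possibly degenerate). A point is definite, indefinite or semidefinite if $g$ there is definite, indefinite non-degenerate, or degenerate; $S(g)$ is the set of semidefinite points. On a connected $\Sigma$, $g$ is a mixed type metric if definite, indefinite and semidefinite points all exist. A semidefinite point $p$ is admissible if $d\lambda(p)\neq0$, where $\lambda=EG-F^2$ for $g=E\,du^2+2F\,du\,dv+G\,dv^2$. A mixed type metric $g$ is admissible if $g$ is not negative definite on $\Sigma$ and all semidefinite points of $g$ are admissible. An L-coordinate neighborhood centered at $p\in S(g)$ is a coordinate neighborhood with $p=(0,0)$ such that $g(\partial_u,\partial_v)=0$ on $U$ and $\partial_v$ is a null vector (i.e. $g(\partial_v,\cdot)=0$) at every point of $S(g)\cap U$; then $g=E\,du^2+G\,dv^2$ with $E>0$ and $G=0$ on $S(g)$. A surface in $\mathbf{L}^3$ is an embedding $f$ of a connected 2-manifold into $\mathbf{L}^3$, with first fundamental form $f^*\langle\cdot,\cdot\rangle$. A mixed type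 surface is a surface having spacelike, timelike and lightlike points, i.e. points at which the first fundamental form is positive definite, indefinite (non-degenerate), degenerate, respectively. For a mixed type surface $f:U\to\mathbf{L}^3$ with first fundamental form $E\,du^2+G\,dv^2$ in L-coordinates, an L-Gauss map is a smooth map $\psi:U\to\Lambda^2$ with $f_u\times f_v=\epsilon\sqrt E(f_v-G\psi)$, where the sign $\epsilon\in\{1,-1\}$ is the one for which $f_u\times f_v=\epsilon\,\sqrt E\,f_v$ at the lightlike points near $p$; it satisfies $\langle\psi,\psi\rangle=\langle\psi,f_u\rangle=0$ and $\langle\psi,f_v\rangle=1$. The second fundamental form associated with $\psi$ is $\langle f_{uu},\psi\rangle du^2+2\langle f_{uv},\psi\rangle du\,dv+\langle f_{vv},\psi\rangle dv^2$.
   Formalization: The surface f on all of U is only required to be an immersion, and an embedding on some simply connected neighborhood of p: an embedding of all of U need not exist (the realized surface may overlap itself). Uniqueness is proved for all immersed solutions on U. *)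

theory Defs
  imports "HOL-Analysis.Analysis"
begin

section \<open>Smooth maps\<close>

text \<open>Used only for open \<open>S\<close> and finite-dimensional \<open>'a\<close>, where
  \<open>C_k_on k S f\<close> says that \<open>f\<close> is of class \<open>C\<^sup>k\<close> on \<open>S\<close>:
  the iterated directional derivatives up to order \<open>k\<close> exist and are continuous.\<close>

primrec C_k_on ::
  "nat \<Rightarrow> 'a::real_normed_vector set \<Rightarrow> ('a \<Rightarrow> 'b::real_normed_vector) \<Rightarrow> bool" where
  "C_k_on 0 S f \<longleftrightarrow> continuous_on S f"
| "C_k_on (Suc k) S f \<longleftrightarrow>
     f differentiable_on S \<and> (\<forall>h. C_k_on k S (\<lambda>x. frechet_derivative f (at x) h))"

definition smooth_on ::
  "'a::real_normed_vector set \<Rightarrow> ('a \<Rightarrow> 'b::real_normed_vector) \<Rightarrow> bool" where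
  "smooth_on S f \<longleftrightarrow> (\<forall>k. C_k_on k S f)"

abbreviation e_u :: "real \<times> real" where "e_u \<equiv> (1, 0)"
abbreviation e_v :: "real \<times> real" where "e_v \<equiv> (0, 1)"

definition pd_u :: "(real \<times> real \<Rightarrow> 'b::real_normed_vector) \<Rightarrow> real \<times> real \<Rightarrow> 'b" where
  "pd_u f x = frechet_derivative f (at x) e_u"

definition pd_v :: "(real \<times> real \<Rightarrow> 'b::real_normed_vector) \<Rightarrow> real \<times> real \<Rightarrow> 'b" where
  "pd_v f x = frechet_derivative f (at x) e_v"


section \<open>Bilinear forms on the coordinate plane\<close>

type_synonym form = "real \<times> real \<Rightarrow> real \<times> real \<Rightarrow> real"

text \<open>The form \<open>a du\<^sup>2 + 2 b du dv + c dv\<^sup>2\<close>:\<close>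

definition coeff_form :: "real \<Rightarrow> real \<Rightarrow> real \<Rightarrow> form" where
  "coeff_form a b c s t =
     a * fst s * fst t + b * (fst s * snd t + snd s * fst t) + c * snd s * snd t"

definition pos_def :: "form \<Rightarrow> bool" where
  "pos_def B \<longleftrightarrow> (\<forall>s. s \<noteq> 0 \<longrightarrow> B s s > 0)"

definition neg_def :: "form \<Rightarrow> bool" where
  "neg_def B \<longleftrightarrow> (\<forall>s. s \<noteq> 0 \<longrightarrow> B s s < 0)"

definition degenerate :: "form \<Rightarrow> bool" where
  "degenerate B \<longleftrightarrow> (\<exists>s. s \<noteq> 0 \<and> (\<forall>t. B s t = 0))"

definition indefinite :: "form \<Rightarrow> bool" where
  "indefinite B \<longleftrightarrow> \<not> degenerate B \<and> (\<exists>s. B s s > 0) \<and> (\<exists>s. B s s < 0)"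

definition form_disc :: "form \<Rightarrow> real" where
  "form_disc B = B e_u e_u * B e_v e_v - (B e_u e_v)\<^sup>2"


section \<open>Smooth 2-manifolds\<close>

text \<open>A chart is a coordinate domain in the manifold together with its coordinate map;
  the values of the map outside the domain are irrelevant.\<close>

type_synonym 'a chart = "'a set \<times> ('a \<Rightarrow> real \<times> real)"

definition chart_image :: "'a chart \<Rightarrow> (real \<times> real) set" where
  "chart_image c = snd c ` fst c"

definition is_chart :: "'a topology \<Rightarrow> 'a chart \<Rightarrow> bool" where
  "is_chart M c \<longleftrightarrow> openin M (fst c) \<and> open (chart_image c) \<and>
     homeomorphic_map (subtopology M (fst c)) (top_of_set (chart_image c)) (snd c)"

definition transition :: "'a chart \<Rightarrow> 'a chart \<Rightarrow> real \<times> real \<Rightarrow> real \<times> real" where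
  "transition c c' x = snd c' (inv_into (fst c) (snd c) x)"

definition transition_dom :: "'a chart \<Rightarrow> 'a chart \<Rightarrow> (real \<times> real) set" where
  "transition_dom c c' = snd c ` (fst c \<inter> fst c')"

definition compatible :: "'a chart \<Rightarrow> 'a chart \<Rightarrow> bool" where
  "compatible c c' \<longleftrightarrow> smooth_on (transition_dom c c') (transition c c') \<and>
     smooth_on (transition_dom c' c) (transition c' c)"

definition smooth_2_manifold :: "'a topology \<Rightarrow> 'a chart set \<Rightarrow> bool" where
  "smooth_2_manifold M A \<longleftrightarrow> Hausdorff_space M \<and> second_countable M \<and>
     (\<forall>c\<in>A. is_chart M c) \<and> (\<Union>c\<in>A. fst c) = topspace M \<and>
     (\<forall>c\<in>A. \<forall>c'\<in>A. compatible c c')"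

text \<open>The members of the maximal atlas generated by \<open>A\<close>:\<close>

definition coord_nbhd :: "'a topology \<Rightarrow> 'a chart set \<Rightarrow> 'a chart \<Rightarrow> bool" where
  "coord_nbhd M A c \<longleftrightarrow> is_chart M c \<and> (\<forall>c'\<in>A. compatible c c')"


section \<open>Mixed type metrics\<close>

text \<open>A tensor field is given by its coordinate expressions: \<open>g c x\<close> is the bilinear form
  expressing it in the chart \<open>c\<close> at the point with coordinates \<open>x\<close>, subject to the
  transformation law of \<open>(0,2)\<close>-tensors under changes of charts.\<close>

definition metric_tensor ::
  "'a topology \<Rightarrow> 'a chart set \<Rightarrow> ('a chart \<Rightarrow> real \<times> real \<Rightarrow> form) \<Rightarrow> bool" where
  "metric_tensor M A g \<longleftrightarrow>
     (\<forall>c. coord_nbhd M A c \<longrightarrow>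
        (\<forall>x\<in>chart_image c. bilinear (g c x) \<and> (\<forall>s t. g c x s t = g c x t s)) \<and>
        (\<forall>s t. smooth_on (chart_image c) (\<lambda>x. g c x s t))) \<and>
     (\<forall>c c'. coord_nbhd M A c \<and> coord_nbhd M A c' \<longrightarrow>
        (\<forall>x\<in>transition_dom c c'. \<forall>s t.
           g c x s t = g c' (transition c c' x)
             (frechet_derivative (transition c c') (at x) s)
             (frechet_derivative (transition c c') (at x) t)))"

text \<open>By the transformation law the following pointwise conditions do not depend on the
  chart (for admissibility: at semidefinite points).\<close>

definition at_point ::
  "'a topology \<Rightarrow> 'a chart set \<Rightarrow> ('a chart \<Rightarrow> real \<times> real \<Rightarrow> form) \<Rightarrow> (form \<Rightarrow> bool) \<Rightarrow> 'a \<Rightarrow> bool"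
  where
  "at_point M A g P q \<longleftrightarrow> (\<exists>c. coord_nbhd M A c \<and> q \<in> fst c \<and> P (g c (snd c q)))"

definition definite_point where
  "definite_point M A g \<equiv> at_point M A g (\<lambda>B. pos_def B \<or> neg_def B)"

definition indefinite_point where
  "indefinite_point M A g \<equiv> at_point M A g indefinite"

definition semidefinite_point where
  "semidefinite_point M A g \<equiv> at_point M A g degenerate"

definition admissible_point ::
  "'a topology \<Rightarrow> 'a chart set \<Rightarrow> ('a chart \<Rightarrow> real \<times> real \<Rightarrow> form) \<Rightarrow> 'a \<Rightarrow> bool" where
  "admissible_point M A g q \<longleftrightarrow> semidefinite_point M A g q \<and>
     (\<exists>c. coord_nbhd M A c \<and> q \<in> fst c \<and>
        frechet_derivative (\<lambda>x. form_disc (g c x)) (at (snd c q)) \<noteq> (\<lambda>s. 0))"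

definition mixed_type_metric ::
  "'a topology \<Rightarrow> 'a chart set \<Rightarrow> ('a chart \<Rightarrow> real \<times> real \<Rightarrow> form) \<Rightarrow> bool" where
  "mixed_type_metric M A g \<longleftrightarrow> connected_space M \<and> metric_tensor M A g \<and>
     (\<exists>q. definite_point M A g q) \<and> (\<exists>q. indefinite_point M A g q) \<and>
     (\<exists>q. semidefinite_point M A g q)"

text \<open>``Not negative definite'' means: at no point negative definite. (A mixed type metric
  is trivially not negative definite at all points simultaneously.)\<close>

definition admissible_metric ::
  "'a topology \<Rightarrow> 'a chart set \<Rightarrow> ('a chart \<Rightarrow> real \<times> real \<Rightarrow> form) \<Rightarrow> bool" where
  "admissible_metric M A g \<longleftrightarrow> mixed_type_metric M A g \<and>
     (\<forall>q. \<not> at_point M A g neg_def q) \<and>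
     (\<forall>q. semidefinite_point M A g q \<longrightarrow> admissible_point M A g q)"

definition L_coord_nbhd ::
  "'a topology \<Rightarrow> 'a chart set \<Rightarrow> ('a chart \<Rightarrow> real \<times> real \<Rightarrow> form) \<Rightarrow> 'a \<Rightarrow> 'a chart \<Rightarrow> bool" where
  "L_coord_nbhd M A g p c \<longleftrightarrow> coord_nbhd M A c \<and> p \<in> fst c \<and> snd c p = (0, 0) \<and>
     (\<forall>x\<in>chart_image c. g c x e_u e_v = 0) \<and>
     (\<forall>q\<in>fst c. semidefinite_point M A g q \<longrightarrow> (\<forall>t. g c (snd c q) e_v t = 0))"


section \<open>Lorentz-Minkowski space\<close>

definition lor :: "real^3 \<Rightarrow> real^3 \<Rightarrow> real" where
  "lor x y = x $ 1 * y $ 1 + x $ 2 * y $ 2 - x $ 3 * y $ 3"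

definition S_mat :: "real^3^3" where
  "S_mat = (\<chi> i j. if i = j then (if i = 3 then -1 else 1) else 0)"

definition lor_cross :: "real^3 \<Rightarrow> real^3 \<Rightarrow> real^3" where
  "lor_cross v w = S_mat *v (cross3 v w)"

definition lightcone :: "(real^3) set" where
  "lightcone = {x. lor x x = 0 \<and> x \<noteq> 0}"

definition lor_orthogonal :: "real^3^3 \<Rightarrow> bool" where
  "lor_orthogonal A \<longleftrightarrow> transpose A ** S_mat ** A = S_mat"


section \<open>Surfaces over a coordinate domain\<close>

text \<open>A coordinate neighborhood is identified with its image in the \<open>(u,v)\<close>-plane, so that
  maps on it become maps on an open subset \<open>D\<close> of the plane.\<close>

definition immersed_surface :: "(real \<times> real) set \<Rightarrow> (real \<times> real \<Rightarrow> real^3) \<Rightarrow> bool" where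
  "immersed_surface D f \<longleftrightarrow> open D \<and> connected D \<and> smooth_on D f \<and>
     (\<forall>x\<in>D. inj (frechet_derivative f (at x)))"

definition embedded_surface :: "(real \<times> real) set \<Rightarrow> (real \<times> real \<Rightarrow> real^3) \<Rightarrow> bool" where
  "embedded_surface D f \<longleftrightarrow> immersed_surface D f \<and> embedding_map (top_of_set D) euclidean f"

definition first_ff :: "(real \<times> real \<Rightarrow> real^3) \<Rightarrow> real \<times> real \<Rightarrow> form" where
  "first_ff f x s t = lor (frechet_derivative f (at x) s) (frechet_derivative f (at x) t)"

definition mixed_type :: "(real \<times> real) set \<Rightarrow> (real \<times> real \<Rightarrow> real^3) \<Rightarrow> bool" where
  "mixed_type D f \<longleftrightarrow> (\<exists>x\<in>D. pos_def (first_ff f x)) \<and> (\<exists>x\<in>D. indefinite (first_ff f x)) \<and>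
     (\<exists>x\<in>D. degenerate (first_ff f x))"

text \<open>With \<open>E\<close>, \<open>G\<close> the coefficients of the first fundamental form of \<open>f\<close>, the equation is
  \<open>f\<^sub>u \<times> f\<^sub>v = \<epsilon> \<surd>E (f\<^sub>v - G \<psi>)\<close>. At lightlike points \<open>G = 0\<close> and it reads
  \<open>f\<^sub>u \<times> f\<^sub>v = \<epsilon> \<surd>E f\<^sub>v\<close>; as \<open>f\<^sub>v \<noteq> 0\<close>, this determines the sign \<open>\<epsilon>\<close>.\<close>

definition L_Gauss_map ::
  "(real \<times> real) set \<Rightarrow> (real \<times> real \<Rightarrow> real^3) \<Rightarrow> (real \<times> real \<Rightarrow> real^3) \<Rightarrow> bool" where
  "L_Gauss_map D f \<psi> \<longleftrightarrow> smooth_on D \<psi> \<and> (\<forall>x\<in>D. \<psi> x \<in> lightcone) \<and>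
     (\<exists>\<epsilon>\<in>{1, -1::real}. \<forall>x\<in>D.
        lor_cross (pd_u f x) (pd_v f x) =
          (\<epsilon> * sqrt (first_ff f x e_u e_u)) *\<^sub>R (pd_v f x - first_ff f x e_v e_v *\<^sub>R \<psi> x))"

definition second_ff ::
  "(real \<times> real \<Rightarrow> real^3) \<Rightarrow> (real \<times> real \<Rightarrow> real^3) \<Rightarrow> real \<times> real \<Rightarrow> form" where
  "second_ff f \<psi> x = coeff_form (lor (pd_u (pd_u f) x) (\<psi> x))
     (lor (pd_v (pd_u f) x) (\<psi> x)) (lor (pd_v (pd_v f) x) (\<psi> x))"

text \<open>Surfaces over all of \<open>D\<close> are required to be immersions, i.e. embeddings only
  near each point: a solution over a simply connected domain need not be injective. For
  example, the surface of revolution \<open>(r cos u, r sin u, v)\<close>, \<open>r = 1 + v + v\<^sup>2/2\<close>, over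
  \<open>-4 < u < 4\<close>, \<open>-1/2 < v < 1/2\<close>, with L-Gauss map \<open>(cos u, sin u, -1)/(2 + v)\<close>, overlaps
  itself, and by uniqueness no embedding has the same fundamental forms.\<close>

definition realizes ::
  "(real \<times> real) set \<Rightarrow> (real \<times> real \<Rightarrow> form) \<Rightarrow> (real \<times> real \<Rightarrow> form) \<Rightarrow>
    (real \<times> real \<Rightarrow> real^3) \<Rightarrow> (real \<times> real \<Rightarrow> real^3) \<Rightarrow> bool" where
  "realizes D g h f \<psi> \<longleftrightarrow> immersed_surface D f \<and> mixed_type D f \<and> L_Gauss_map D f \<psi> \<and>
     (\<forall>x\<in>D. first_ff f x = g x) \<and> (\<forall>x\<in>D. second_ff f \<psi> x = h x)"

definition congruent_pairs ::
  "(real \<times> real) set \<Rightarrow> (real \<times> real \<Rightarrow> real^3) \<Rightarrow> (real \<times> real \<Rightarrow> real^3) \<Rightarrow>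
    (real \<times> real \<Rightarrow> real^3) \<Rightarrow> (real \<times> real \<Rightarrow> real^3) \<Rightarrow> bool" where
  "congruent_pairs D f \<psi> f' \<psi>' \<longleftrightarrow>
     (\<exists>A b. lor_orthogonal A \<and> (\<forall>x\<in>D. f' x = A *v f x + b \<and> \<psi>' x = A *v \<psi> x))"

end

theory Submission
  imports Defs "HOL-Complex_Analysis.Riemann_Mapping"
begin

text \<open>At a lightlike point \<open>f\<^sub>u\<close> and \<open>f\<^sub>v\<close> span a degenerate plane, and the usual moving
frame breaks down. The frame \<open>F\<close> with rows \<open>f\<^sub>u\<close>, \<open>f\<^sub>v\<close>, \<open>\<psi>\<close> does not: the matrix of
its Lorentzian products is \<open>\<Gamma> = ((E, 0, 0), (0, G, 1), (0, 1, 0))\<close>, whose determinant \<open>- E\<close> is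
nonzero also where \<open>G\<close> vanishes. Hence the derivatives of the frame are determined by their products
with the frame: \<open>F\<^sub>u = P F\<close> and \<open>F\<^sub>v = Q F\<close> with \<open>P = N\<^sub>u \<Gamma>\<inverse>\<close>, \<open>Q = N\<^sub>v \<Gamma>\<inverse>\<close>, where the
matrices \<open>N\<^sub>u\<close>, \<open>N\<^sub>v\<close> of these products are expressed through the coefficients of the two fundamental
forms and satisfy \<open>N\<^sub>u + N\<^sub>u\<^sup>T = \<Gamma>\<^sub>u\<close>, \<open>N\<^sub>v + N\<^sub>v\<^sup>T = \<Gamma>\<^sub>v\<close>. The coefficients are smooth on
the whole domain.

The integrability condition of this linear system reduces to an equation between antisymmetric
matrices, whose three entries are the Gauss equation and the two Codazzi equations
(\<open>integrability\<close>, \<open>frame_system_flat\<close>). So over a simply connected domain the system has a solution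
with any given initial value. The initial frame is chosen with the products \<open>\<Gamma>\<close>; since the difference
of \<open>\<Gamma>\<close> and the products of \<open>F\<close> solves a homogeneous linear system, they agree everywhere
(\<open>gram_of_solution\<close>). The first two rows form a closed vector-valued one-form, whose primitive is \<open>f\<close>,
and the third row is \<open>\<psi>\<close>. The equation \<open>f\<^sub>u \<times> f\<^sub>v = det F (f\<^sub>v - G \<psi>)\<close> with \<open>(det F)\<^sup>2 = E\<close>
shows that \<open>\<psi>\<close> is an L-Gauss map (\<open>surface_of_frame\<close>).

Conversely, the frame of every realization solves the system (\<open>frame_of_surface\<close>). Here
\<open>\<langle>\<psi>, f\<^sub>u\<rangle> = 0\<close> and \<open>\<langle>\<psi>, f\<^sub>v\<rangle> = 1\<close> are read off from the defining equation of \<open>\<psi>\<close> where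
\<open>G \<noteq> 0\<close> and extend to the lightlike points by continuity. Two solutions of the linear system differ by a
constant matrix on the right, which is Lorentz orthogonal because both frames have the products \<open>\<Gamma>\<close>.

Admissibility enters through one fact: at a point with \<open>G = 0\<close> the discriminant \<open>E G\<close> has no local
extremum, because its differential in a suitable chart does not vanish there
(\<open>disc_changes_sign\<close>). This gives \<open>E > 0\<close>, the density of \<open>{G \<noteq> 0}\<close>, and spacelike and
timelike points arbitrarily close to the origin.

The existence theorem for linear systems is \<open>flat_section_exists\<close>. On a star-shaped domain
(\<open>flat_section_on_star\<close>) one solves an ordinary differential equation along each ray, and flatness makes the
result differentiable with the prescribed derivative. The Riemann mapping theorem turns a
simply connected plane domain into a convex one.\<close>

section \<open>Linear ordinary differential equations\<close>

text \<open>The square of the norm is differentiable also at the zeros of \<open>w\<close>, and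
\<open>2 \<delta> \<bar>w\<bar> \<le> \<bar>w\<bar>\<^sup>2 + \<delta>\<^sup>2\<close> makes the differential inequality for it linear; this costs the
summand \<open>1\<close> in the exponent.\<close>

lemma gronwall_affine:
  fixes w :: "real \<Rightarrow> 'b::euclidean_space"
  assumes w0: "w 0 = 0"
    and der: "\<And>t. t \<in> {0..1} \<Longrightarrow> (w has_vector_derivative w' t) (at t within {0..1})"
    and bound: "\<And>t. t \<in> {0..1} \<Longrightarrow> norm (w' t) \<le> M * norm (w t) + \<delta>"
    and "M \<ge> 0" "\<delta> \<ge> 0"
  shows "norm (w 1) \<le> \<delta> * exp (M + 1)"
proof -
  (* q is non-increasing: the exponential absorbs the homogeneous part of the inequality
     (|w|^2)' <= m |w|^2 + delta^2, and the linear term the inhomogeneous one *)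
  define m where "m = 2 * M + 1"
  define q where "q t = (w t \<bullet> w t) * exp (- m * t) - \<delta>\<^sup>2 * t" for t
  define q' where "q' t = (2 * (w t \<bullet> w' t) - m * (w t \<bullet> w t)) * exp (- m * t) - \<delta>\<^sup>2" for t
  have q_der: "(q has_real_derivative q' t) (at t within {0..1})" if "t \<in> {0..1}" for t
  proof -
    have "((\<lambda>t. w t \<bullet> w t) has_real_derivative 2 * (w t \<bullet> w' t)) (at t within {0..1})"
      using has_derivative_inner[OF der[OF that, unfolded has_vector_derivative_def]
          der[OF that, unfolded has_vector_derivative_def]]
      unfolding has_field_derivative_def
      by (rule has_derivative_eq_rhs) (auto simp: fun_eq_iff inner_commute)
    then show ?thesis
      unfolding q_def q'_def
      by (auto intro!: derivative_eq_intros simp: algebra_simps)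
  qed
  have neg: "q' t \<le> 0" if t: "t \<in> {0..1}" for t
  proof -
    have "w t \<bullet> w' t \<le> norm (w t) * (M * norm (w t) + \<delta>)"
      using norm_cauchy_schwarz[of "w t" "w' t"] mult_left_mono[OF bound[OF t] norm_ge_zero[of "w t"]]
      by linarith
    moreover have "2 * (norm (w t) * \<delta>) \<le> (norm (w t))\<^sup>2 + \<delta>\<^sup>2"
      using sum_squares_bound[of "norm (w t)" \<delta>] by simp
    ultimately have "2 * (w t \<bullet> w' t) - m * (w t \<bullet> w t) \<le> \<delta>\<^sup>2"
      by (simp add: m_def power2_norm_eq_inner[symmetric] power2_eq_square algebra_simps)
    then have "(2 * (w t \<bullet> w' t) - m * (w t \<bullet> w t)) * exp (- m * t) \<le> \<delta>\<^sup>2 * exp (- m * t)"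
      by (rule mult_right_mono) simp
    also have "\<dots> \<le> \<delta>\<^sup>2 * 1"
      using t \<open>M \<ge> 0\<close> by (intro mult_left_mono) (auto simp: m_def mult_nonpos_nonneg)
    finally show ?thesis by (simp add: q'_def)
  qed
  obtain t where t: "t \<in> {0<..<1}" "q 1 - q 0 = q' t * (1 - 0)"
    using mvt_simple[of 0 1 q "\<lambda>t h. q' t * h"] q_der
    by (auto simp: has_field_derivative_def)
  then have "q 1 \<le> q 0"
    using neg[of t] by simp
  then have "(norm (w 1))\<^sup>2 * exp (- m) \<le> \<delta>\<^sup>2"
    by (simp add: q_def w0 power2_norm_eq_inner)
  then have "(norm (w 1))\<^sup>2 \<le> \<delta>\<^sup>2 * exp m"
    by (simp add: exp_minus field_simps)
  also have "\<dots> \<le> \<delta>\<^sup>2 * exp (2 * (M + 1))"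
    by (intro mult_left_mono) (auto simp: m_def)
  also have "\<dots> = (\<delta> * exp (M + 1))\<^sup>2"
    using exp_double[of "M + 1"] by (simp add: power_mult_distrib)
  finally show ?thesis
    using \<open>\<delta> \<ge> 0\<close> by (simp add: power2_le_iff_abs_le)
qed

lemma continuous_on_compact_bounded:
  fixes f :: "'a::topological_space \<Rightarrow> 'b::real_normed_vector"
  assumes "continuous_on K f" "compact K"
  obtains M where "M \<ge> 0" "\<And>x. x \<in> K \<Longrightarrow> norm (f x) \<le> M"
proof -
  obtain b where "b > 0" "\<And>y. y \<in> f ` K \<Longrightarrow> norm y \<le> b"
    using compact_imp_bounded[OF compact_continuous_image[OF assms]] by (auto simp: bounded_pos)
  then show ?thesis using that[of b] by auto
qed

text \<open>The solution is the sum of the Picard series, whose terms are the iterated integrals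
\<open>\<integral>A \<integral>A \<dots> \<integral>A y0\<close>. The \<open>n\<close>-th one is at most \<open>\<bar>y0\<bar> (M t)\<^sup>n / n!\<close>, so the series converges
uniformly and may be integrated termwise.\<close>

lemma linear_ode_exists:
  fixes A :: "real \<Rightarrow> 'b::euclidean_space \<Rightarrow>\<^sub>L 'b"
  assumes contA: "continuous_on {0..1} A"
  shows "\<exists>z. z 0 = y0 \<and>
    (\<forall>t\<in>{0..1}. (z has_vector_derivative A t (z t)) (at t within {0..1}))"
proof -
  obtain M where M: "M \<ge> 0" "\<And>t. t \<in> {0..1} \<Longrightarrow> norm (A t) \<le> M"
    using continuous_on_compact_bounded[OF contA compact_Icc] by metis
  define T where "T = rec_nat (\<lambda>t. y0) (\<lambda>n u t. integral {0..t} (\<lambda>s. A s (u s)))"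
  have T0: "T 0 t = y0" and TS: "T (Suc n) t = integral {0..t} (\<lambda>s. A s (T n s))" for n t
    by (simp_all add: T_def)
  have contT: "continuous_on {0..1} (T n)" for n
  proof (induction n)
    case (Suc n)
    have "continuous_on {0..1} (\<lambda>s. A s (T n s))"
      by (intro continuous_intros contA Suc)
    from indefinite_integral_continuous_1[OF integrable_continuous_real[OF this]]
    show ?case by (simp add: TS[abs_def])
  qed (simp add: T0[abs_def])
  have contAT: "continuous_on {0..1} (\<lambda>s. A s (T n s))" for n
    by (intro continuous_intros contA contT)
  have der: "(T (Suc n) has_vector_derivative A t (T n t)) (at t within {0..1})"
    if "t \<in> {0..1}" for n t
    using integral_has_vector_derivative[OF contAT that] by (simp add: TS[abs_def])
  have bound: "norm (T n t) \<le> norm y0 * (M * t) ^ n / fact n" if "t \<in> {0..1}" for n t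
    using that
  proof (induction n arbitrary: t)
    case (Suc n)
    show ?case
    proof (cases "t = 0")
      case True
      then show ?thesis by (simp add: TS)
    next
      case False
      with Suc have t: "0 < t" "t \<le> 1" by auto
      define \<phi> where "\<phi> s = norm y0 * (M * s) ^ Suc n / fact (Suc n)" for s
      have "norm (T (Suc n) t - T (Suc n) 0) \<le> \<phi> t - \<phi> 0"
      proof (rule differentiable_bound_general[OF \<open>0 < t\<close>])
        show "continuous_on {0..t} (T (Suc n))"
          by (rule continuous_on_subset[OF contT]) (use t in auto)
        show "continuous_on {0..t} \<phi>"
          unfolding \<phi>_def by (intro continuous_intros) auto
        fix s assume s: "0 < s" "s < t"
        have "at s within {0..1} = at s"
          by (rule at_within_interior) (use s t in auto)
        then show "(T (Suc n) has_vector_derivative A s (T n s)) (at s)"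
          using der[of s n] s t by simp
        have "(\<phi> has_real_derivative norm y0 * (real (Suc n) * (M * s) ^ n * M) / fact (Suc n)) (at s)"
          unfolding \<phi>_def by (intro DERIV_cdivide DERIV_cmult)
          (rule DERIV_cong, (rule derivative_eq_intros refl)+, simp)
        also have "norm y0 * (real (Suc n) * (M * s) ^ n * M) / fact (Suc n) = M * (norm y0 * (M * s) ^ n / fact n)"
          by (simp add: fact_Suc del: of_nat_Suc)
        finally show "(\<phi> has_vector_derivative M * (norm y0 * (M * s) ^ n / fact n)) (at s)"
          unfolding has_real_derivative_iff_has_vector_derivative .
        have "norm (A s (T n s)) \<le> norm (A s) * norm (T n s)"
          by (rule norm_blinfun)
        also have "\<dots> \<le> M * (norm y0 * (M * s) ^ n / fact n)"
          using s t M by (intro mult_mono M(2) Suc.IH) auto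
        finally show "norm (A s (T n s)) \<le> M * (norm y0 * (M * s) ^ n / fact n)" .
      qed
      then show ?thesis by (simp add: TS \<phi>_def)
    qed
  qed (simp add: T0)
  have summ: "summable (\<lambda>n. norm y0 * (M ^ n / fact n))"
    using summable_exp[of M] by (intro summable_mult) (simp add: field_simps)
  have bound': "norm (T n t) \<le> norm y0 * (M ^ n / fact n)" if "t \<in> {0..1}" for n t
  proof -
    have "(M * t) ^ n \<le> M ^ n"
      using that M by (intro power_mono) (auto simp: mult_left_le)
    then have "norm y0 * (M * t) ^ n / fact n \<le> norm y0 * M ^ n / fact n"
      by (intro divide_right_mono mult_left_mono) auto
    with bound[OF that, of n] show ?thesis by simp
  qed
  define z where "z t = (\<Sum>n. T n t)" for t
  have lim: "uniform_limit {0..1} (\<lambda>n t. \<Sum>i<n. T i t) z sequentially"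
    unfolding z_def by (rule Weierstrass_m_test[OF bound' summ])
  have contz: "continuous_on {0..1} z"
    by (rule uniform_limit_theorem[OF _ lim]) (auto intro!: always_eventually continuous_intros contT)
  have contAz: "continuous_on {0..1} (\<lambda>s. A s (z s))"
    by (intro continuous_intros contA contz)
  have z_eq: "z t = y0 + integral {0..t} (\<lambda>s. A s (z s))" if t: "t \<in> {0..1}" for t
  proof -
    have sub: "{0..t} \<subseteq> {0..1}" using t by auto
    have "uniform_limit {0..1} (\<lambda>n s. A s (\<Sum>i<n. T i s)) (\<lambda>s. A s (z s)) sequentially"
    proof (rule uniform_limitI)
      fix e :: real assume "e > 0"
      with M have "e / (M + 1) > 0" by simp
      from uniform_limitD[OF lim this]
      show "\<forall>\<^sub>F n in sequentially. \<forall>s\<in>{0..1}. dist (A s (\<Sum>i<n. T i s)) (A s (z s)) < e"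
      proof eventually_elim
        case (elim n)
        show ?case
        proof
          fix s :: real assume s: "s \<in> {0..1}"
          have "dist (A s (\<Sum>i<n. T i s)) (A s (z s)) \<le> norm (A s) * norm ((\<Sum>i<n. T i s) - z s)"
            by (simp add: dist_norm blinfun.diff_right[symmetric] norm_blinfun)
          also have "\<dots> \<le> M * (e / (M + 1))"
            using elim s M by (intro mult_mono) (auto simp: dist_norm less_imp_le)
          also have "\<dots> < e"
            using M \<open>e > 0\<close> by (simp add: field_simps)
          finally show "dist (A s (\<Sum>i<n. T i s)) (A s (z s)) < e" .
        qed
      qed
    qed
    then have ul: "uniform_limit {0..t} (\<lambda>n s. A s (\<Sum>i<n. T i s)) (\<lambda>s. A s (z s)) sequentially"
      by (rule uniform_limit_on_subset[OF _ sub])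
    have cts: "continuous_on {0..t} (\<lambda>s. A s (\<Sum>i<n. T i s))" for n
      using sub by (intro continuous_intros continuous_on_subset[OF contA] continuous_on_subset[OF contT])
    obtain I J where IJ: "\<And>n. ((\<lambda>s. A s (\<Sum>i<n. T i s)) has_integral I n) {0..t}"
        "((\<lambda>s. A s (z s)) has_integral J) {0..t}" "I \<longlonglongrightarrow> J"
      by (rule uniform_limit_integral[OF ul cts]) auto
    have "I n = (\<Sum>i<n. T (Suc i) t)" for n
    proof -
      have "I n = integral {0..t} (\<lambda>s. \<Sum>i<n. A s (T i s))"
        using integral_unique[OF IJ(1)] by (simp add: blinfun.sum_right)
      also have "\<dots> = (\<Sum>i<n. T (Suc i) t)"
        by (subst integral_sum)
          (auto simp: TS intro!: integrable_continuous_real continuous_on_subset[OF contAT sub])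
      finally show ?thesis .
    qed
    then have "I = (\<lambda>n. \<Sum>i<n. T (Suc i) t)" by (rule ext)
    with IJ(3) integral_unique[OF IJ(2)]
    have "(\<lambda>n. \<Sum>i<n. T (Suc i) t) \<longlonglongrightarrow> integral {0..t} (\<lambda>s. A s (z s))"
      by simp
    then have "(\<lambda>i. T (Suc i) t) sums integral {0..t} (\<lambda>s. A s (z s))"
      by (simp add: sums_def)
    then have "(\<lambda>i. T i t) sums (integral {0..t} (\<lambda>s. A s (z s)) + T 0 t)"
      by (rule sums_Suc)
    then show ?thesis
      by (simp add: z_def sums_iff T0 add.commute)
  qed
  have "(z has_vector_derivative A t (z t)) (at t within {0..1})" if t: "t \<in> {0..1}" for t
  proof (rule has_vector_derivative_transform[OF t, rotated])
    show "((\<lambda>t. y0 + integral {0..t} (\<lambda>s. A s (z s))) has_vector_derivative A t (z t))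
      (at t within {0..1})"
      using integral_has_vector_derivative[OF contAz t] by (auto intro!: derivative_eq_intros)
  qed (simp add: z_eq)
  moreover have "z 0 = y0" using z_eq[of 0] by simp
  ultimately show ?thesis by blast
qed

section \<open>Flat connections\<close>

text \<open>The form \<open>B\<close> is a connection on the trivial bundle with fibre \<open>'b\<close>. The hypothesis \<open>flat\<close> says that
the second derivative \<open>DB k h y + B h (B k y)\<close> which it prescribes for a solution is symmetric.

The value \<open>y x\<close> is the value at time \<open>1\<close> of the solution \<open>z x\<close> of the equation along the ray from \<open>a\<close>
to \<open>x\<close>. For the derivative of \<open>y\<close> at \<open>x\<close> one compares \<open>z (x + h)\<close> with the expected first order
approximation \<open>z x + t B(h) z x\<close>, not only at time \<open>1\<close> but along the whole ray. By flatness the terms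
of first order in \<open>h\<close> cancel in the equation for the difference, and Gronwall's inequality gives the
estimate \<open>o(\<bar>h\<bar>)\<close>.\<close>

lemma flat_section_on_star:
  fixes B :: "'a::euclidean_space \<Rightarrow> 'a \<Rightarrow>\<^sub>L 'b::euclidean_space \<Rightarrow>\<^sub>L 'b"
    and DB :: "'a \<Rightarrow> 'a \<Rightarrow>\<^sub>L 'a \<Rightarrow>\<^sub>L 'b \<Rightarrow>\<^sub>L 'b"
  assumes "open S" "a \<in> S"
    and star: "\<And>x t. x \<in> S \<Longrightarrow> t \<in> {0..1} \<Longrightarrow> a + t *\<^sub>R (x - a) \<in> S"
    and der: "\<And>x. x \<in> S \<Longrightarrow> (B has_derivative DB x) (at x)"
    and cont: "continuous_on S DB"
    and flat: "\<And>x h k y. x \<in> S \<Longrightarrow>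
      DB x k h y + B x h (B x k y) = DB x h k y + B x k (B x h y)"
  shows "\<exists>y. y a = y0 \<and> (\<forall>x\<in>S. (y has_derivative (\<lambda>h. B x h (y x))) (at x))"
proof -
  have contB: "continuous_on S B"
    using der by (meson continuous_at_imp_continuous_on has_derivative_continuous)
  have "\<exists>z. z 0 = y0 \<and> (\<forall>t\<in>{0..1}.
      (z has_vector_derivative B (a + t *\<^sub>R (x - a)) (x - a) (z t)) (at t within {0..1}))"
    if "x \<in> S" for x
  proof (rule linear_ode_exists)
    show "continuous_on {0..1} (\<lambda>t. B (a + t *\<^sub>R (x - a)) (x - a))"
      using star[OF that]
      by (intro continuous_intros continuous_on_compose2[OF contB]) auto
  qed
  then obtain z where z0: "\<And>x. x \<in> S \<Longrightarrow> z x 0 = y0"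
    and z': "\<And>x t. x \<in> S \<Longrightarrow> t \<in> {0..1} \<Longrightarrow>
      (z x has_vector_derivative B (a + t *\<^sub>R (x - a)) (x - a) (z x t)) (at t within {0..1})"
    by metis
  have "norm (z a 1 - y0) \<le> 0 * exp (0 + 1)"
    by (rule gronwall_affine[where w = "\<lambda>t. z a t - y0" and w' = "\<lambda>t. 0"])
      (use z0[OF \<open>a \<in> S\<close>] z'[OF \<open>a \<in> S\<close>] in \<open>auto intro!: derivative_eq_intros\<close>)
  then have "z a 1 = y0" by simp
  moreover have "((\<lambda>x. z x 1) has_derivative (\<lambda>h. B x h (z x 1))) (at x)" if "x \<in> S" for x
  proof -
    define \<xi> where "\<xi> = x - a"
    define p where "p t = a + t *\<^sub>R \<xi>" for t
    define K where "K = p ` {0..1}"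
    have contp: "continuous_on {0..1} p"
      unfolding p_def by (intro continuous_intros)
    have compK: "compact K"
      unfolding K_def by (intro compact_continuous_image contp) simp
    have "K \<subseteq> S"
      using star[OF that] by (auto simp: K_def p_def \<xi>_def)
    then obtain \<epsilon> where \<epsilon>: "\<epsilon> > 0" "(\<Union>c\<in>K. ball c \<epsilon>) \<subseteq> S"
      using compact_subset_open_imp_ball_epsilon_subset[OF compK \<open>open S\<close>] by metis
    (* a compact neighbourhood of the ray, on which B and DB are bounded and DB is
       uniformly continuous *)
    define N where "N = {c + e |c e. c \<in> K \<and> e \<in> cball 0 (\<epsilon> / 2)}"
    have compN: "compact N"
      unfolding N_def by (rule compact_sums[OF compK]) simp
    have NS: "N \<subseteq> S"
    proof
      fix q assume "q \<in> N"
      then obtain c e where "q = c + e" "c \<in> K" "norm e \<le> \<epsilon> / 2" by (auto simp: N_def)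
      then have "q \<in> ball c \<epsilon>" using \<epsilon> by (auto simp: dist_norm)
      with \<epsilon> \<open>c \<in> K\<close> show "q \<in> S" by blast
    qed
    have inN: "p t + k \<in> N" if "t \<in> {0..1}" "norm k \<le> \<epsilon> / 2" for t k
      using that unfolding N_def K_def by force
    obtain M1 where M1: "M1 \<ge> 0" "\<And>q. q \<in> N \<Longrightarrow> norm (B q) \<le> M1"
      using continuous_on_compact_bounded[OF continuous_on_subset[OF contB NS] compN] by metis
    obtain M2 where M2: "M2 \<ge> 0" "\<And>q. q \<in> N \<Longrightarrow> norm (DB q) \<le> M2"
      using continuous_on_compact_bounded[OF continuous_on_subset[OF cont NS] compN] by metis
    have "continuous_on {0..1} (z x)"
      using z'[OF that] by (meson continuous_on_eq_continuous_within has_vector_derivative_continuous)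
    then obtain Z where Z: "Z \<ge> 0" "\<And>t. t \<in> {0..1} \<Longrightarrow> norm (z x t) \<le> Z"
      using continuous_on_compact_bounded[OF _ compact_Icc] by metis
    define L where "L = norm \<xi> + 1"
    define C1 where "C1 = Z * (M2 + M1 * M1 + M2 * L * M1)"
    define C2 where "C2 = L * Z * (1 + M1)"
    define Q where "Q = exp (M1 * L + 1)"
    have pos: "L \<ge> 0" "C1 \<ge> 0" "C2 \<ge> 0" "Q > 0"
      using M1 M2 Z by (auto simp: L_def C1_def C2_def Q_def)
    have key: "\<exists>d>0. \<forall>h. norm h < d \<longrightarrow>
        norm (z (x + h) 1 - z x 1 - B x h (z x 1)) \<le> e * norm h" if "e > 0" for e
    proof -
      define \<eta> where "\<eta> = e / (2 * Q * (C2 + 1))"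
      have "\<eta> > 0" using pos \<open>e > 0\<close> by (simp add: \<eta>_def)
      have "uniformly_continuous_on N DB"
        by (rule compact_uniformly_continuous[OF continuous_on_subset[OF cont NS] compN])
      then obtain \<delta> where \<delta>: "\<delta> > 0"
          "\<And>q q'. q \<in> N \<Longrightarrow> q' \<in> N \<Longrightarrow> dist q' q < \<delta> \<Longrightarrow> dist (DB q') (DB q) < \<eta>"
        unfolding uniformly_continuous_on_def using \<open>\<eta> > 0\<close> by metis
      have taylor: "norm (B (p t + k) - B (p t) - DB (p t) k) \<le> norm k * \<eta>"
        if t: "t \<in> {0..1}" and k: "norm k < \<delta>" "norm k \<le> \<epsilon> / 2" for t k
      proof -
        define V where "V = ball (p t) \<delta> \<inter> cball (p t) (\<epsilon> / 2)"
        have VN: "V \<subseteq> N"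
          using inN[OF t, of "q - p t" for q] by (auto simp: V_def dist_norm norm_minus_commute)
        have "norm (B (p t + k) - B (p t) - DB (p t) (p t + k - p t)) \<le> norm (p t + k - p t) * \<eta>"
        proof (rule differentiable_bound_linearization[where S = V and f' = "\<lambda>q. DB q"])
          have "convex V" unfolding V_def by (intro convex_Int) auto
          moreover have "p t \<in> V" "p t + k \<in> V"
            using k \<delta> \<epsilon> by (auto simp: V_def dist_norm)
          ultimately have "closed_segment (p t) (p t + k) \<subseteq> V" by (simp add: closed_segment_subset)
          then show "p t + s *\<^sub>R (p t + k - p t) \<in> V" if "s \<in> {0..1}" for s
            using that by (force simp: closed_segment_def algebra_simps)
          show "p t \<in> V" by fact
          show "(B has_derivative DB q) (at q within V)" if "q \<in> V" for q
            using der VN NS that by (blast intro: has_derivative_at_withinI)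
          show "onorm (blinfun_apply (DB q) - blinfun_apply (DB (p t))) \<le> \<eta>" if "q \<in> V" for q
          proof -
            have "blinfun_apply (DB q) - blinfun_apply (DB (p t)) = blinfun_apply (DB q - DB (p t))"
              by (auto simp: fun_eq_iff blinfun.diff_left)
            moreover have "norm (DB q - DB (p t)) < \<eta>"
              using \<delta>(2)[of "p t" q] subsetD[OF VN that] subsetD[OF VN \<open>p t \<in> V\<close>] that
              by (auto simp: dist_norm V_def norm_minus_commute)
            ultimately show ?thesis by (simp add: norm_blinfun.rep_eq)
          qed
        qed
        then show ?thesis by simp
      qed
      define d where "d = Min {\<delta>, \<epsilon> / 2, 1, e / (2 * Q * (C1 + 1))}"
      have "d > 0" using \<delta> \<epsilon> pos \<open>e > 0\<close> by (simp add: d_def)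
      moreover have "norm (z (x + h) 1 - z x 1 - B x h (z x 1)) \<le> e * norm h"
        if "norm h < d" for h
      proof -
        define n where "n = norm h"
        have n: "n < \<delta>" "n \<le> \<epsilon> / 2" "n \<le> 1" "n \<le> e / (2 * Q * (C1 + 1))" "n \<ge> 0"
          using that by (auto simp: n_def d_def)
        have xh: "x + h \<in> S"
          using inN[of 1 h] NS n by (auto simp: p_def \<xi>_def n_def)
        (* the error of the first order approximation along the ray; at time 1 it is the
           remainder in the definition of the derivative *)
        define w where "w t = z (x + h) t - z x t - t *\<^sub>R B (p t) h (z x t)" for t
        define b where "b t = B (p t + t *\<^sub>R h) (\<xi> + h)" for t
        define w' where "w' t = b t (z (x + h) t) - B (p t) \<xi> (z x t) -
          (t *\<^sub>R (B (p t) h (B (p t) \<xi> (z x t)) + DB (p t) \<xi> h (z x t)) + B (p t) h (z x t))" for t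
        have "norm (w 1) \<le> (n * (n * C1 + \<eta> * C2)) * exp (M1 * L + 1)"
        proof (rule gronwall_affine)
          show "w 0 = 0" using z0 xh \<open>x \<in> S\<close> by (simp add: w_def)
          show "M1 * L \<ge> 0" "n * (n * C1 + \<eta> * C2) \<ge> 0" using M1 pos n \<open>\<eta> > 0\<close> by auto
          fix t :: real assume t: "t \<in> {0..1}"
          have ptS: "p t \<in> S" using inN[OF t, of 0] \<epsilon> NS by auto
          have zxh: "(z (x + h) has_vector_derivative b t (z (x + h) t)) (at t within {0..1})"
            using z'[OF xh t] by (simp add: b_def p_def \<xi>_def algebra_simps)
          have zx: "(z x has_vector_derivative B (p t) \<xi> (z x t)) (at t within {0..1})"
            using z'[OF \<open>x \<in> S\<close> t] by (simp add: p_def \<xi>_def)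
          have "(p has_derivative (\<lambda>s. s *\<^sub>R \<xi>)) (at t within {0..1})"
            unfolding p_def by (auto intro!: derivative_eq_intros)
          from has_derivative_compose[OF this der[OF ptS]]
          have "((\<lambda>t. B (p t)) has_vector_derivative DB (p t) \<xi>) (at t within {0..1})"
            by (simp add: has_vector_derivative_def blinfun.scaleR_right)
          then have Bh: "((\<lambda>t. B (p t) h) has_vector_derivative DB (p t) \<xi> h) (at t within {0..1})"
            by (rule bounded_linear.has_vector_derivative[OF blinfun.bounded_linear_left])
          have Bhz: "((\<lambda>t. B (p t) h (z x t)) has_vector_derivative
              B (p t) h (B (p t) \<xi> (z x t)) + DB (p t) \<xi> h (z x t)) (at t within {0..1})"
            by (rule bounded_bilinear.has_vector_derivative[OF bounded_bilinear_blinfun_apply Bh zx])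
          have "((\<lambda>t. t *\<^sub>R B (p t) h (z x t)) has_vector_derivative
              t *\<^sub>R (B (p t) h (B (p t) \<xi> (z x t)) + DB (p t) \<xi> h (z x t)) + 1 *\<^sub>R B (p t) h (z x t))
              (at t within {0..1})"
            by (rule bounded_bilinear.has_vector_derivative[OF bounded_bilinear_scaleR _ Bhz]) simp
          then show "(w has_vector_derivative w' t) (at t within {0..1})"
            unfolding w_def[abs_def] w'_def
            by (intro has_vector_derivative_diff zxh zx) simp
          (* R is o(|h|), so T2 and T5 are o(|h|), while T1, T3 and T4 are quadratic in h *)
          define R where "R = B (p t + t *\<^sub>R h) - B (p t) - DB (p t) (t *\<^sub>R h)"
          have th: "norm (t *\<^sub>R h) \<le> n" using t by (auto simp: n_def mult_left_le_one_le)
          have R: "norm R \<le> n * \<eta>"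
          proof -
            have "norm R \<le> norm (t *\<^sub>R h) * \<eta>"
              unfolding R_def using th n by (intro taylor[OF t]) auto
            also have "\<dots> \<le> n * \<eta>" using th \<open>\<eta> > 0\<close> by (intro mult_right_mono) auto
            finally show ?thesis .
          qed
          have nB: "norm (B (p t)) \<le> M1" and nDB: "norm (DB (p t)) \<le> M2"
            using inN[OF t, of 0] \<epsilon> M1(2) M2(2) by auto
          have nz: "norm (z x t) \<le> Z" using Z t by simp
          have n\<xi>: "norm (\<xi> + h) \<le> L"
            using norm_triangle_ineq[of \<xi> h] n by (simp add: L_def n_def)
          define v where "v = z x t"
          define T1 where "T1 = t *\<^sub>R DB (p t) h h v"
          define T2 where "T2 = R (\<xi> + h) v"
          define T3 where "T3 = t *\<^sub>R B (p t) h (B (p t) h v)"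
          define T4 where "T4 = (t * t) *\<^sub>R DB (p t) h (\<xi> + h) (B (p t) h v)"
          define T5 where "T5 = t *\<^sub>R R (\<xi> + h) (B (p t) h v)"
          have bt: "b t = B (p t) (\<xi> + h) + t *\<^sub>R DB (p t) h (\<xi> + h) + R (\<xi> + h)"
            by (simp add: b_def R_def blinfun.bilinear_simps algebra_simps)
          have zw: "z (x + h) t = w t + v + t *\<^sub>R B (p t) h v"
            by (simp add: w_def v_def)
          have fl: "DB (p t) h \<xi> v + B (p t) \<xi> (B (p t) h v) = DB (p t) \<xi> h v + B (p t) h (B (p t) \<xi> v)"
            by (rule flat[OF ptS])
          (* the terms that are only linear in h are collected in the last summand,
             which vanishes by flatness *)
          have "w' t = b t (w t) + (T1 + T2 + T3 + T4 + T5) +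
              t *\<^sub>R ((DB (p t) h \<xi> v + B (p t) \<xi> (B (p t) h v)) - (DB (p t) \<xi> h v + B (p t) h (B (p t) \<xi> v)))"
            unfolding w'_def zw v_def[symmetric]
            by (simp add: bt T1_def T2_def T3_def T4_def T5_def blinfun.bilinear_simps algebra_simps)
          then have w'_eq: "w' t = b t (w t) + (T1 + T2 + T3 + T4 + T5)" by (simp add: fl)
          have nBh: "norm (B (p t) h u) \<le> M1 * n * norm u" for u
          proof -
            have "norm (B (p t) h u) \<le> norm (B (p t)) * norm h * norm u"
              by (meson mult_right_mono norm_blinfun norm_ge_zero order_trans)
            also have "\<dots> \<le> M1 * n * norm u"
              using nB M1 by (intro mult_mono) (auto simp: n_def)
            finally show ?thesis .
          qed
          have nDBh: "norm (DB (p t) h k u) \<le> M2 * n * norm k * norm u" for k u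
          proof -
            have "norm (DB (p t) h k u) \<le> norm (DB (p t)) * norm h * norm k * norm u"
              by (meson mult_right_mono norm_blinfun norm_ge_zero order_trans)
            also have "\<dots> \<le> M2 * n * norm k * norm u"
              using nDB M2 by (intro mult_mono) (auto simp: n_def)
            finally show ?thesis .
          qed
          have nR: "norm (R (\<xi> + h) u) \<le> n * \<eta> * L * norm u" for u
          proof -
            have "norm (R (\<xi> + h) u) \<le> norm R * norm (\<xi> + h) * norm u"
              by (meson mult_right_mono norm_blinfun norm_ge_zero order_trans)
            also have "\<dots> \<le> n * \<eta> * L * norm u"
              using R n\<xi> pos n \<open>\<eta> > 0\<close> by (intro mult_mono) auto
            finally show ?thesis .
          qed
          have nBv: "norm (B (p t) h v) \<le> M1 * n * Z"
            by (rule order_trans[OF nBh]) (use nz M1 n in \<open>auto simp: v_def intro!: mult_left_mono\<close>)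
          have nT1: "norm T1 \<le> M2 * n * n * Z"
          proof -
            have "norm T1 \<le> norm (DB (p t) h h v)"
              using t by (simp add: T1_def mult_left_le_one_le)
            also have "\<dots> \<le> M2 * n * n * norm v" using nDBh[of h v] by (simp add: n_def)
            also have "\<dots> \<le> M2 * n * n * Z"
              using nz M2 n by (intro mult_left_mono) (auto simp: v_def)
            finally show ?thesis .
          qed
          have nT2: "norm T2 \<le> n * \<eta> * L * Z"
            unfolding T2_def using nz n pos \<open>\<eta> > 0\<close>
            by (intro order_trans[OF nR] mult_left_mono) (auto simp: v_def)
          have nT3: "norm T3 \<le> M1 * n * (M1 * n * Z)"
          proof -
            have "norm T3 \<le> norm (B (p t) h (B (p t) h v))"
              using t by (simp add: T3_def mult_left_le_one_le)
            also have "\<dots> \<le> M1 * n * (M1 * n * Z)"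
              by (rule order_trans[OF nBh], rule mult_left_mono[OF nBv]) (use M1 n in auto)
            finally show ?thesis .
          qed
          have nT4: "norm T4 \<le> M2 * n * L * (M1 * n * Z)"
          proof -
            have "norm T4 \<le> norm (DB (p t) h (\<xi> + h) (B (p t) h v))"
              using t mult_le_one[of t t] by (simp add: T4_def abs_mult mult_left_le_one_le)
            also have "\<dots> \<le> M2 * n * norm (\<xi> + h) * norm (B (p t) h v)" by (rule nDBh)
            also have "\<dots> \<le> M2 * n * L * (M1 * n * Z)"
              using nBv n\<xi> M2 n pos by (intro mult_mono mult_left_mono) auto
            finally show ?thesis .
          qed
          have nT5: "norm T5 \<le> n * \<eta> * L * (M1 * 1 * Z)"
          proof -
            have "norm T5 \<le> norm (R (\<xi> + h) (B (p t) h v))"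
              using t by (simp add: T5_def mult_left_le_one_le)
            also have "\<dots> \<le> n * \<eta> * L * norm (B (p t) h v)" by (rule nR)
            also have "\<dots> \<le> n * \<eta> * L * (M1 * n * Z)"
              using nBv n pos \<open>\<eta> > 0\<close> by (intro mult_left_mono) auto
            also have "\<dots> \<le> n * \<eta> * L * (M1 * 1 * Z)"
              using n pos \<open>\<eta> > 0\<close> M1 Z by (intro mult_left_mono mult_right_mono) auto
            finally show ?thesis .
          qed
          have nbt: "norm (b t (w t)) \<le> M1 * L * norm (w t)"
          proof -
            have "norm (b t (w t)) \<le> norm (B (p t + t *\<^sub>R h)) * norm (\<xi> + h) * norm (w t)"
              unfolding b_def by (meson mult_right_mono norm_blinfun norm_ge_zero order_trans)
            also have "\<dots> \<le> M1 * L * norm (w t)"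
              using n\<xi> M1(1) M1(2)[OF inN[OF t]] th n pos by (intro mult_mono) auto
            finally show ?thesis .
          qed
          have "norm (w' t) \<le> norm (b t (w t)) + (norm T1 + norm T2 + norm T3 + norm T4 + norm T5)"
            unfolding w'_eq by (intro norm_triangle_le add_mono order_refl)
          also have "\<dots> \<le> M1 * L * norm (w t) + n * (n * C1 + \<eta> * C2)"
            using nbt nT1 nT2 nT3 nT4 nT5 by (simp add: C1_def C2_def algebra_simps)
          finally show "norm (w' t) \<le> M1 * L * norm (w t) + n * (n * C1 + \<eta> * C2)" .
        qed
        also have "\<dots> = n * (n * C1 * Q + \<eta> * C2 * Q)"
          by (simp add: Q_def algebra_simps)
        also have "\<dots> \<le> n * (e / 2 + e / 2)"
        proof (intro mult_left_mono add_mono)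
          have nz1: "C1 + 1 \<noteq> 0" "C2 + 1 \<noteq> 0" using pos by auto
          have "n * C1 * Q \<le> n * ((C1 + 1) * Q)"
            using n pos by (simp add: algebra_simps)
          also have "\<dots> \<le> e / (2 * Q * (C1 + 1)) * ((C1 + 1) * Q)"
            using n pos by (intro mult_right_mono) auto
          also have "\<dots> = e / 2" using pos nz1 by simp
          finally show "n * C1 * Q \<le> e / 2" .
          have "\<eta> * C2 * Q \<le> \<eta> * ((C2 + 1) * Q)"
            using \<open>\<eta> > 0\<close> pos by (simp add: algebra_simps)
          also have "\<dots> = e / 2" using pos nz1 by (simp add: \<eta>_def)
          finally show "\<eta> * C2 * Q \<le> e / 2" .
        qed (use n in auto)
        finally show ?thesis by (simp add: w_def n_def p_def \<xi>_def mult.commute)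
      qed
      ultimately show ?thesis by blast
    qed
    show ?thesis
      unfolding has_derivative_at_alt
    proof (intro conjI allI impI)
      show "bounded_linear (\<lambda>h. B x h (z x 1))"
        by (intro bounded_linear_compose[OF blinfun.bounded_linear_left] blinfun.bounded_linear_right)
      fix e :: real assume "e > 0"
      from key[OF this] obtain d where d: "d > 0"
        "\<And>h. norm h < d \<Longrightarrow> norm (z (x + h) 1 - z x 1 - B x h (z x 1)) \<le> e * norm h" by blast
      show "\<exists>d>0. \<forall>y. norm (y - x) < d \<longrightarrow>
          norm (z y 1 - z x 1 - B x (y - x) (z x 1)) \<le> e * norm (y - x)"
        using d(1) d(2)[of "y - x" for y] by (intro exI[of _ d]) auto
    qed
  qed
  ultimately show ?thesis by (intro exI[of _ "\<lambda>x. z x 1"]) auto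
qed

text \<open>The Riemann mapping theorem; \<open>T\<close> is the unit disc, or the plane if \<open>D\<close> is the plane.\<close>

lemma simply_connected_plane_uniformization:
  assumes "open D" "simply_connected D" "D \<noteq> {}"
  obtains T :: "complex set" and \<phi> \<psi> where "open T" "convex T" "\<phi> holomorphic_on T" "\<psi> holomorphic_on D"
    "\<phi> ` T \<subseteq> D" "\<psi> ` D \<subseteq> T" "\<forall>w\<in>D. \<phi> (\<psi> w) = w"
proof (cases "D = UNIV")
  case True
  then show ?thesis
    by (intro that[of UNIV id id]) (auto simp: id_def)
next
  case False
  with assms simply_connected_eq_biholomorphic_to_disc[OF \<open>open D\<close>]
  obtain f g where "f holomorphic_on D" "g holomorphic_on ball 0 1"
    "\<forall>z \<in> D. f z \<in> ball 0 1 \<and> g (f z) = z" "\<forall>z \<in> ball 0 1. g z \<in> D \<and> f (g z) = z"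
    by auto
  then show ?thesis
    by (intro that[of "ball 0 1" g f]) auto
qed

text \<open>The connection is pulled back along a conformal map \<open>\<phi>\<close> from a convex set, where rays are available.
Differentiating the pullback produces an additional term with the second derivative of \<open>\<phi>\<close>; it is
symmetric, so the pullback is flat again.\<close>

lemma flat_section_exists:
  fixes B :: "real \<times> real \<Rightarrow> (real \<times> real) \<Rightarrow>\<^sub>L 'b::euclidean_space \<Rightarrow>\<^sub>L 'b"
    and DB :: "real \<times> real \<Rightarrow> (real \<times> real) \<Rightarrow>\<^sub>L (real \<times> real) \<Rightarrow>\<^sub>L 'b \<Rightarrow>\<^sub>L 'b"
  assumes "open D" "simply_connected D" "x0 \<in> D"
    and der: "\<And>x. x \<in> D \<Longrightarrow> (B has_derivative DB x) (at x)"
    and cont: "continuous_on D DB"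
    and flat: "\<And>x h k y. x \<in> D \<Longrightarrow>
      DB x k h y + B x h (B x k y) = DB x h k y + B x k (B x h y)"
  shows "\<exists>y. y x0 = y0 \<and> (\<forall>x\<in>D. (y has_derivative (\<lambda>h. B x h (y x))) (at x))"
proof -
  define \<kappa> where "\<kappa> z = (Re z, Im z)" for z
  define \<kappa>i where "\<kappa>i x = Complex (fst x) (snd x)" for x
  have [simp]: "\<kappa> (\<kappa>i x) = x" "\<kappa>i (\<kappa> z) = z" for x z
    by (auto simp: \<kappa>_def \<kappa>i_def)
  have lin: "bounded_linear \<kappa>" "bounded_linear \<kappa>i"
    unfolding linear_conv_bounded_linear[symmetric]
    by (auto intro!: linearI simp: \<kappa>_def \<kappa>i_def complex_eq_iff)
  have "homeomorphism D (\<kappa>i ` D) \<kappa>i \<kappa>"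
    by (rule homeomorphismI)
      (auto intro!: linear_continuous_on lin)
  then have sc: "simply_connected (\<kappa>i ` D)"
    using homeomorphic_simply_connected[OF _ \<open>simply_connected D\<close>] homeomorphic_def by blast
  have D': "\<kappa>i ` D = \<kappa> -` D"
  proof (intro equalityI subsetI)
    show "z \<in> \<kappa>i ` D" if "z \<in> \<kappa> -` D" for z
      using that image_eqI[of z \<kappa>i "\<kappa> z" D] by simp
  qed auto
  have op: "open (\<kappa>i ` D)"
    unfolding D' by (intro open_vimage \<open>open D\<close> linear_continuous_on lin)
  have ne: "\<kappa>i ` D \<noteq> {}" using \<open>x0 \<in> D\<close> by auto
  obtain T \<phi> \<psi> where T: "open T" "convex T"
    and hol: "\<phi> holomorphic_on T" "\<psi> holomorphic_on \<kappa>i ` D"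
    and "\<phi> ` T \<subseteq> \<kappa>i ` D" "\<psi> ` \<kappa>i ` D \<subseteq> T" "\<forall>w\<in>\<kappa>i ` D. \<phi> (\<psi> w) = w"
    using simply_connected_plane_uniformization[OF op sc ne] by blast
  then have maps: "\<And>z. z \<in> T \<Longrightarrow> \<phi> z \<in> \<kappa>i ` D" "\<And>w. w \<in> \<kappa>i ` D \<Longrightarrow> \<psi> w \<in> T"
      "\<And>w. w \<in> \<kappa>i ` D \<Longrightarrow> \<phi> (\<psi> w) = w"
    by blast+
  define \<phi>' where "\<phi>' = deriv \<phi>"
  define \<phi>'' where "\<phi>'' = deriv \<phi>'"
  have hol': "\<phi>' holomorphic_on T" "\<phi>'' holomorphic_on T"
    unfolding \<phi>'_def \<phi>''_def using T hol by (auto intro!: holomorphic_deriv)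
  have d\<phi>: "(\<phi> has_field_derivative \<phi>' z) (at z)" and d\<phi>': "(\<phi>' has_field_derivative \<phi>'' z) (at z)"
    if "z \<in> T" for z
    using that T hol hol' by (auto simp: \<phi>'_def \<phi>''_def intro!: holomorphic_derivI)
  have mapsD: "\<kappa> (\<phi> z) \<in> D" if "z \<in> T" for z
    using maps(1)[OF that] by auto
  define J :: "complex \<Rightarrow> complex \<Rightarrow>\<^sub>L (real \<times> real)" where "J c = Blinfun \<kappa> o\<^sub>L blinfun_mult_right c" for c
  have J_apply: "J c w = \<kappa> (c * w)" for c w
    by (simp add: J_def bounded_linear_Blinfun_apply[OF lin(1)] blinfun_mult_right.rep_eq)
  have linJ: "bounded_linear J"
    unfolding J_def by (intro bounded_linear_intros)
  (* the connection pulled back along kappa o phi, where J c is the real linear map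
     w |-> kappa (c w), and its derivative *)
  define B' where "B' z = B (\<kappa> (\<phi> z)) o\<^sub>L J (\<phi>' z)" for z
  define dB' where "dB' z k = (B (\<kappa> (\<phi> z)) o\<^sub>L J (\<phi>'' z * k)) + (DB (\<kappa> (\<phi> z)) (\<kappa> (\<phi>' z * k)) o\<^sub>L J (\<phi>' z))" for z k
  have lin_dB': "bounded_linear (dB' z)" for z
    unfolding dB'_def
    by (intro bounded_linear_intros bounded_linear_compose[OF linJ] bounded_linear_compose[OF lin(1)])
  have DB'_apply: "blinfun_apply (Blinfun (dB' z)) = dB' z" for z
    by (rule bounded_linear_Blinfun_apply[OF lin_dB'])
  have "\<exists>y. y (\<psi> (\<kappa>i x0)) = y0 \<and> (\<forall>z\<in>T. (y has_derivative (\<lambda>h. B' z h (y z))) (at z))"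
  proof (rule flat_section_on_star[where DB = "\<lambda>z. Blinfun (dB' z)"])
    show "open T" "\<psi> (\<kappa>i x0) \<in> T" using T maps \<open>x0 \<in> D\<close> by auto
    then show "\<psi> (\<kappa>i x0) + t *\<^sub>R (x - \<psi> (\<kappa>i x0)) \<in> T" if "x \<in> T" "t \<in> {0..1}" for x t
      using convexD_alt[OF T(2), of "\<psi> (\<kappa>i x0)" x t] that by (simp add: algebra_simps)
    show "(B' has_derivative Blinfun (dB' z)) (at z)" if z: "z \<in> T" for z
    proof -
      have 1: "((\<lambda>z. \<kappa> (\<phi> z)) has_derivative (\<lambda>k. \<kappa> (\<phi>' z * k))) (at z)"
        using bounded_linear.has_derivative[OF lin(1)] d\<phi>[OF z] by (simp add: has_field_derivative_def)
      have 2: "((\<lambda>z. B (\<kappa> (\<phi> z))) has_derivative (\<lambda>k. DB (\<kappa> (\<phi> z)) (\<kappa> (\<phi>' z * k)))) (at z)"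
        by (rule has_derivative_compose[OF 1 der[OF mapsD[OF z]]])
      have 3: "((\<lambda>z. J (\<phi>' z)) has_derivative (\<lambda>k. J (\<phi>'' z * k))) (at z)"
        using bounded_linear.has_derivative[OF linJ] d\<phi>'[OF z] by (simp add: has_field_derivative_def)
      show ?thesis
        unfolding DB'_apply dB'_def B'_def
        by (rule bounded_bilinear.FDERIV[OF bounded_bilinear_blinfun_compose 2 3])
    qed
    have c\<phi>: "continuous_on T \<phi>" "continuous_on T \<phi>'" "continuous_on T \<phi>''"
      using hol hol' by (auto intro: holomorphic_on_imp_continuous_on)
    have c\<kappa>\<phi>: "continuous_on T (\<lambda>z. \<kappa> (\<phi> z))"
      by (rule bounded_linear.continuous_on[OF lin(1) c\<phi>(1)])
    have contB: "continuous_on D B"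
      using der by (meson continuous_at_imp_continuous_on has_derivative_continuous)
    show "continuous_on T (\<lambda>z. Blinfun (dB' z))"
    proof (rule continuous_on_blinfun_componentwise)
      show "continuous_on T (\<lambda>z. Blinfun (dB' z) i)" for i
        unfolding DB'_apply dB'_def
        by (intro continuous_intros bounded_linear.continuous_on[OF linJ]
            bounded_linear.continuous_on[OF lin(1)] c\<phi>
            continuous_on_compose2[OF contB c\<kappa>\<phi>] continuous_on_compose2[OF cont c\<kappa>\<phi>])
          (use mapsD in auto)
    qed
    show "Blinfun (dB' z) k h y + B' z h (B' z k y) = Blinfun (dB' z) h k y + B' z k (B' z h y)"
      if "z \<in> T" for z h k y
      using flat[OF mapsD[OF that], of "\<kappa> (\<phi>' z * k)" "\<kappa> (\<phi>' z * h)" y]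
      by (simp add: DB'_apply dB'_def B'_def J_apply blinfun.bilinear_simps mult_ac)
  qed
  then obtain y where y0: "y (\<psi> (\<kappa>i x0)) = y0"
    and y: "\<And>z. z \<in> T \<Longrightarrow> (y has_derivative (\<lambda>h. B' z h (y z))) (at z)" by blast
  have "((\<lambda>x. y (\<psi> (\<kappa>i x))) has_derivative (\<lambda>h. B x h (y (\<psi> (\<kappa>i x))))) (at x)" if "x \<in> D" for x
  proof -
    define w where "w = \<kappa>i x"
    have w: "w \<in> \<kappa>i ` D" "\<psi> w \<in> T" using that maps by (auto simp: w_def)
    have d\<psi>: "(\<psi> has_field_derivative deriv \<psi> w) (at w)"
      using hol(2) op w(1) by (rule holomorphic_derivI)
    have "((\<lambda>w. \<phi> (\<psi> w)) has_field_derivative \<phi>' (\<psi> w) * deriv \<psi> w) (at w)"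
      by (rule DERIV_chain2[OF d\<phi>[OF w(2)] d\<psi>])
    moreover have "((\<lambda>w. \<phi> (\<psi> w)) has_field_derivative 1) (at w)"
      by (rule has_field_derivative_transform_within_open[OF DERIV_ident op w(1)])
        (simp add: maps)
    ultimately have inv: "\<phi>' (\<psi> w) * deriv \<psi> w = 1" by (rule DERIV_unique)
    have "((\<lambda>x. \<psi> (\<kappa>i x)) has_derivative (\<lambda>h. deriv \<psi> w * \<kappa>i h)) (at x)"
      using has_derivative_compose[OF bounded_linear_imp_has_derivative[OF lin(2)]
          d\<psi>[unfolded w_def has_field_derivative_def]] by (simp add: w_def)
    from has_derivative_compose[OF this] y[OF w(2)]
    have "((\<lambda>x. y (\<psi> (\<kappa>i x))) has_derivative (\<lambda>h. B' (\<psi> w) (deriv \<psi> w * \<kappa>i h) (y (\<psi> w)))) (at x)"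
      by (simp add: w_def)
    moreover have "B' (\<psi> w) (deriv \<psi> w * \<kappa>i h) = B x h" for h
      using inv maps(3)[OF w(1)]
      by (simp add: B'_def J_apply mult.assoc[symmetric]) (simp add: w_def)
    ultimately show ?thesis by (simp add: w_def)
  qed
  with y0 show ?thesis by (intro exI[of _ "\<lambda>x. y (\<psi> (\<kappa>i x))"]) auto
qed

section \<open>Calculus of smooth maps\<close>

lemma frechet_derivative_cong_open:
  assumes "open S" "x \<in> S" "\<And>x. x \<in> S \<Longrightarrow> f x = g x"
  shows "frechet_derivative f (at x) = frechet_derivative g (at x)"
proof -
  have "(f has_derivative f') (at x) \<longleftrightarrow> (g has_derivative f') (at x)" for f'
    using has_derivative_transform_within_open[of f f' x UNIV S g]
      has_derivative_transform_within_open[of g f' x UNIV S f] assms by auto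
  then show ?thesis by (simp add: frechet_derivative_def)
qed

lemma C_k_on_cong:
  assumes "open S" "\<And>x. x \<in> S \<Longrightarrow> f x = g x"
  shows "C_k_on k S f \<longleftrightarrow> C_k_on k S g"
  using assms(2)
proof (induction k arbitrary: f g)
  case 0
  then show ?case by (auto intro: continuous_on_cong)
next
  case (Suc k)
  have fd: "frechet_derivative f (at x) = frechet_derivative g (at x)" if "x \<in> S" for x
    by (rule frechet_derivative_cong_open[OF \<open>open S\<close> that Suc.prems])
  have "f differentiable (at x) \<longleftrightarrow> g differentiable (at x)" if "x \<in> S" for x
    using has_derivative_transform_within_open[of f _ x UNIV S g]
      has_derivative_transform_within_open[of g _ x UNIV S f] \<open>open S\<close> that Suc.prems
    unfolding differentiable_def by metis
  then show ?case
    using Suc.IH[of "\<lambda>x. frechet_derivative f (at x) h" "\<lambda>x. frechet_derivative g (at x) h" for h] fd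
    by (simp add: differentiable_on_eq_differentiable_at[OF \<open>open S\<close>])
qed

lemma C_k_on_SucD: "open S \<Longrightarrow> C_k_on (Suc k) S f \<Longrightarrow> C_k_on k S f"
  by (induction k arbitrary: f) (auto intro: differentiable_imp_continuous_on)

text \<open>This form of the recursion raises the regularity of a map whose derivative is known by a formula.\<close>

lemma C_k_on_SucI:
  assumes "open S" and der: "\<And>x. x \<in> S \<Longrightarrow> (f has_derivative f' x) (at x)"
    and "\<And>h. C_k_on k S (\<lambda>x. f' x h)"
  shows "C_k_on (Suc k) S f"
proof -
  have "frechet_derivative f (at x) = f' x" if "x \<in> S" for x
    using frechet_derivative_at[OF der[OF that]] by simp
  then show ?thesis
    using assms C_k_on_cong[OF \<open>open S\<close>, of "\<lambda>x. frechet_derivative f (at x) h" "\<lambda>x. f' x h" for h]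
    by (auto simp: differentiable_on_eq_differentiable_at[OF \<open>open S\<close>] intro: differentiableI)
qed

lemma C_k_on_SucE:
  assumes "open S" "C_k_on (Suc k) S f" "x \<in> S"
  shows "(f has_derivative frechet_derivative f (at x)) (at x)"
  using assms(2,3)
  by (auto simp: differentiable_on_eq_differentiable_at[OF \<open>open S\<close>] frechet_derivative_works[symmetric])

lemma C_k_on_const: "open S \<Longrightarrow> C_k_on k S (\<lambda>x. c)"
  by (induction k arbitrary: c) auto

lemma C_k_on_add:
  "open S \<Longrightarrow> C_k_on k S f \<Longrightarrow> C_k_on k S g \<Longrightarrow> C_k_on k S (\<lambda>x. f x + g x)"
proof (induction k arbitrary: f g)
  case 0
  then show ?case by (auto intro: continuous_intros)
next
  case (Suc k)
  show ?case
    by (rule C_k_on_SucI[OF \<open>open S\<close> has_derivative_add[OF C_k_on_SucE C_k_on_SucE]])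
      (use Suc in auto)
qed

lemma C_k_on_bilinear:
  assumes "bounded_bilinear bil" "open S"
  shows "C_k_on k S f \<Longrightarrow> C_k_on k S g \<Longrightarrow> C_k_on k S (\<lambda>x. bil (f x) (g x))"
proof (induction k arbitrary: f g)
  case 0
  then show ?case using bounded_bilinear.continuous_on[OF assms(1)] by auto
next
  case (Suc k)
  have "C_k_on k S f" "C_k_on k S g"
    using C_k_on_SucD[OF \<open>open S\<close>] Suc.prems by blast+
  then show ?case
    by (intro C_k_on_SucI[OF \<open>open S\<close> bounded_bilinear.FDERIV[OF assms(1) C_k_on_SucE C_k_on_SucE]]
        C_k_on_add Suc.IH) (use Suc.prems \<open>open S\<close> in auto)
qed

lemma C_k_on_inverse:
  fixes f :: "'a::real_normed_vector \<Rightarrow> real"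
  assumes "open S" "\<And>x. x \<in> S \<Longrightarrow> f x \<noteq> 0"
  shows "C_k_on k S f \<Longrightarrow> C_k_on k S (\<lambda>x. inverse (f x))"
proof (induction k)
  case 0
  then show ?case using assms by (auto intro: continuous_intros)
next
  case (Suc k)
  have inv: "C_k_on k S (\<lambda>x. inverse (f x))"
    using Suc C_k_on_SucD[OF \<open>open S\<close>] by blast
  show ?case
  proof (rule C_k_on_SucI[OF \<open>open S\<close>])
    show "((\<lambda>x. inverse (f x)) has_derivative
        (\<lambda>h. (inverse (f x) * (- 1 * inverse (f x))) * frechet_derivative f (at x) h)) (at x)"
      if "x \<in> S" for x
      using Deriv.has_derivative_inverse[OF assms(2)[OF that] C_k_on_SucE[OF \<open>open S\<close> Suc.prems that]]
      by (simp add: mult_ac)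
    show "C_k_on k S (\<lambda>x. (inverse (f x) * (- 1 * inverse (f x))) * frechet_derivative f (at x) h)" for h
      using Suc.prems
      by (intro C_k_on_bilinear[OF bounded_bilinear_mult \<open>open S\<close>] C_k_on_const[OF \<open>open S\<close>] inv) auto
  qed
qed

lemma smooth_on_cong:
  "open S \<Longrightarrow> (\<And>x. x \<in> S \<Longrightarrow> f x = g x) \<Longrightarrow> smooth_on S f \<longleftrightarrow> smooth_on S g"
  using C_k_on_cong[of S f g] by (auto simp: smooth_on_def)

lemma smooth_on_const: "open S \<Longrightarrow> smooth_on S (\<lambda>x. c)"
  by (simp add: smooth_on_def C_k_on_const)

lemma smooth_on_add: "open S \<Longrightarrow> smooth_on S f \<Longrightarrow> smooth_on S g \<Longrightarrow> smooth_on S (\<lambda>x. f x + g x)"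
  by (simp add: smooth_on_def C_k_on_add)

lemma smooth_on_bilinear:
  "bounded_bilinear bil \<Longrightarrow> open S \<Longrightarrow> smooth_on S f \<Longrightarrow> smooth_on S g \<Longrightarrow>
    smooth_on S (\<lambda>x. bil (f x) (g x))"
  by (simp add: smooth_on_def C_k_on_bilinear)

lemma smooth_on_linear:
  assumes "bounded_linear l" "open S" "smooth_on S f"
  shows "smooth_on S (\<lambda>x. l (f x))"
proof -
  have "bounded_bilinear (\<lambda>(r::real) y. r *\<^sub>R l y)"
    by (rule bounded_bilinear.comp[OF bounded_bilinear_scaleR bounded_linear_ident assms(1)])
  from smooth_on_bilinear[OF this assms(2) smooth_on_const[OF assms(2), of 1] assms(3)]
  show ?thesis by simp
qed

lemmas smooth_on_mult = smooth_on_bilinear[OF bounded_bilinear_mult]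
  and smooth_on_minus = smooth_on_linear[OF bounded_linear_minus[OF bounded_linear_ident]]

lemma smooth_on_divide:
  fixes f g :: "'a::real_normed_vector \<Rightarrow> real"
  assumes "open S" "smooth_on S f" "smooth_on S g" "\<And>x. x \<in> S \<Longrightarrow> g x \<noteq> 0"
  shows "smooth_on S (\<lambda>x. f x / g x)"
  unfolding divide_inverse
  by (rule smooth_on_mult) (use assms in \<open>auto simp: smooth_on_def intro: C_k_on_inverse\<close>)

lemma smooth_on_sum:
  "open S \<Longrightarrow> (\<And>i. i \<in> I \<Longrightarrow> smooth_on S (f i)) \<Longrightarrow> smooth_on S (\<lambda>x. \<Sum>i\<in>I. f i x)"
  by (induction I rule: infinite_finite_induct) (auto simp: smooth_on_const smooth_on_add)

lemma smooth_on_vec: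
  fixes f :: "'a::real_normed_vector \<Rightarrow> 'b::euclidean_space ^ 'n"
  assumes "open S" "\<And>i. smooth_on S (\<lambda>x. f x $ i)"
  shows "smooth_on S f"
proof -
  have lin: "bounded_linear (\<lambda>y::'b. axis i y :: 'b ^ 'n)" for i
    unfolding linear_conv_bounded_linear[symmetric]
    by (rule linearI) (auto simp: axis_def vec_eq_iff)
  have "f = (\<lambda>x. \<Sum>i\<in>UNIV. axis i (f x $ i))"
    by (auto simp: fun_eq_iff vec_eq_iff axis_def if_distrib cong: if_cong)
  moreover have "smooth_on S (\<lambda>x. \<Sum>i\<in>UNIV. axis i (f x $ i))"
    by (intro smooth_on_sum smooth_on_linear[OF lin] assms)
  ultimately show ?thesis by simp
qed

lemma smooth_on_has_derivative:
  "open S \<Longrightarrow> smooth_on S f \<Longrightarrow> x \<in> S \<Longrightarrow> (f has_derivative frechet_derivative f (at x)) (at x)"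
  unfolding smooth_on_def by (metis C_k_on_SucE)

lemma smooth_on_frechet_derivative:
  "smooth_on S f \<Longrightarrow> smooth_on S (\<lambda>x. frechet_derivative f (at x) h)"
  unfolding smooth_on_def by (metis C_k_on.simps(2))

lemma smooth_on_pd:
  "smooth_on S f \<Longrightarrow> smooth_on S (pd_u f)" "smooth_on S f \<Longrightarrow> smooth_on S (pd_v f)"
  unfolding pd_u_def[abs_def] pd_v_def[abs_def] by (simp_all add: smooth_on_frechet_derivative)

lemma smooth_on_imp_continuous_on: "smooth_on S f \<Longrightarrow> continuous_on S f"
  unfolding smooth_on_def by (metis C_k_on.simps(1))

lemma pd_has_derivative:
  assumes "(f has_derivative f') (at x)"
  shows "pd_u f x = f' e_u" "pd_v f x = f' e_v"
  using frechet_derivative_at[OF assms] by (simp_all add: pd_u_def pd_v_def)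

lemma linear_plane:
  assumes "linear l"
  shows "l h = fst h *\<^sub>R l e_u + snd h *\<^sub>R l e_v"
proof -
  have "h = fst h *\<^sub>R e_u + snd h *\<^sub>R e_v" by (cases h) auto
  then have "l h = l (fst h *\<^sub>R e_u + snd h *\<^sub>R e_v)" by simp
  then show ?thesis by (simp only: linear_add[OF assms] linear_scale[OF assms])
qed

lemma frechet_derivative_pd:
  assumes "open D" "smooth_on D f" "x \<in> D"
  shows "frechet_derivative f (at x) h = fst h *\<^sub>R pd_u f x + snd h *\<^sub>R pd_v f x"
  unfolding pd_u_def pd_v_def
  by (rule linear_plane[OF has_derivative_linear[OF smooth_on_has_derivative[OF assms]]])

lemma smooth_on_has_derivative_pd:
  assumes "open D" "smooth_on D f" "x \<in> D"
  shows "(f has_derivative (\<lambda>h. fst h *\<^sub>R pd_u f x + snd h *\<^sub>R pd_v f x)) (at x)"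
proof -
  have "frechet_derivative f (at x) = (\<lambda>h. fst h *\<^sub>R pd_u f x + snd h *\<^sub>R pd_v f x)"
    by (rule ext) (rule frechet_derivative_pd[OF assms])
  with smooth_on_has_derivative[OF assms] show ?thesis by simp
qed

lemma pd_bilinear:
  assumes "bounded_bilinear bil" "open D" "smooth_on D f" "smooth_on D g" "x \<in> D"
  shows "pd_u (\<lambda>x. bil (f x) (g x)) x = bil (f x) (pd_u g x) + bil (pd_u f x) (g x)"
    and "pd_v (\<lambda>x. bil (f x) (g x)) x = bil (f x) (pd_v g x) + bil (pd_v f x) (g x)"
  using pd_has_derivative[OF bounded_bilinear.FDERIV[OF assms(1)
    smooth_on_has_derivative[OF assms(2,3,5)] smooth_on_has_derivative[OF assms(2,4,5)]]]
  by (simp_all add: pd_u_def pd_v_def)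

lemma pd_linear:
  assumes "bounded_linear l" "open D" "smooth_on D f" "x \<in> D"
  shows "pd_u (\<lambda>x. l (f x)) x = l (pd_u f x)" "pd_v (\<lambda>x. l (f x)) x = l (pd_v f x)"
  using pd_has_derivative[OF bounded_linear.has_derivative[OF assms(1) smooth_on_has_derivative[OF assms(2-4)]]]
  by (simp_all add: pd_u_def pd_v_def)

lemma pd_cong:
  assumes "open D" "x \<in> D" "\<And>x. x \<in> D \<Longrightarrow> f x = g x"
  shows "pd_u f x = pd_u g x" "pd_v f x = pd_v g x"
  unfolding pd_u_def pd_v_def
  using frechet_derivative_cong_open[OF assms] by simp_all

lemma second_difference_mean_value:
  fixes F :: "real \<Rightarrow> real \<Rightarrow> real"
  assumes "h > 0"
    and Fu: "\<And>u v. u \<in> {a..a+h} \<Longrightarrow> v \<in> {b..b+h} \<Longrightarrow> ((\<lambda>u. F u v) has_real_derivative Fu u v) (at u)"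
    and Fuv: "\<And>u v. u \<in> {a..a+h} \<Longrightarrow> v \<in> {b..b+h} \<Longrightarrow> (Fu u has_real_derivative Fuv u v) (at v)"
  shows "\<exists>\<xi>\<in>{a..a+h}. \<exists>\<eta>\<in>{b..b+h}.
    F (a + h) (b + h) - F (a + h) b - F a (b + h) + F a b = h * h * Fuv \<xi> \<eta>"
proof -
  have "\<exists>\<xi>>a. \<xi> < a + h \<and> (F (a + h) (b + h) - F (a + h) b) - (F a (b + h) - F a b) =
      (a + h - a) * (Fu \<xi> (b + h) - Fu \<xi> b)"
    by (rule MVT2) (use \<open>h > 0\<close> in \<open>auto intro!: DERIV_diff Fu\<close>)
  then obtain \<xi> where \<xi>: "a < \<xi>" "\<xi> < a + h"
    "(F (a + h) (b + h) - F (a + h) b) - (F a (b + h) - F a b) = h * (Fu \<xi> (b + h) - Fu \<xi> b)"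
    by auto
  have "\<exists>\<eta>>b. \<eta> < b + h \<and> Fu \<xi> (b + h) - Fu \<xi> b = (b + h - b) * Fuv \<xi> \<eta>"
    by (rule MVT2) (use \<open>h > 0\<close> \<xi> in \<open>auto intro!: Fuv\<close>)
  then obtain \<eta> where \<eta>: "b < \<eta>" "\<eta> < b + h" "Fu \<xi> (b + h) - Fu \<xi> b = h * Fuv \<xi> \<eta>"
    by auto
  have "F (a + h) (b + h) - F (a + h) b - F a (b + h) + F a b = h * h * Fuv \<xi> \<eta>"
    using \<xi>(3) \<eta>(3) by (simp add: algebra_simps)
  with \<xi> \<eta> show ?thesis by (intro bexI[of _ \<xi>] bexI[of _ \<eta>]) auto
qed

lemma pd_has_real_derivative:
  fixes f :: "real \<times> real \<Rightarrow> real"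
  assumes "open D" "smooth_on D f" "(u, v) \<in> D"
  shows "((\<lambda>u. f (u, v)) has_real_derivative pd_u f (u, v)) (at u)"
    and "((\<lambda>v. f (u, v)) has_real_derivative pd_v f (u, v)) (at v)"
proof -
  have "((\<lambda>u. (u, v)) has_derivative (\<lambda>h. (h, 0))) (at u)"
    by (intro has_derivative_Pair) auto
  from has_derivative_compose[OF this smooth_on_has_derivative_pd[OF assms]]
  show "((\<lambda>u. f (u, v)) has_real_derivative pd_u f (u, v)) (at u)"
    by (simp add: has_field_derivative_def mult.commute[of _ "pd_u f (u, v)"])
  have "((\<lambda>v. (u, v)) has_derivative (\<lambda>h. (0, h))) (at v)"
    by (intro has_derivative_Pair) auto
  from has_derivative_compose[OF this smooth_on_has_derivative_pd[OF assms]]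
  show "((\<lambda>v. f (u, v)) has_real_derivative pd_v f (u, v)) (at v)"
    by (simp add: has_field_derivative_def mult.commute[of _ "pd_v f (u, v)"])
qed

text \<open>Both mixed derivatives are limits of the same second difference quotient, by two applications of the
mean value theorem in either order.\<close>

lemma pd_commute_real:
  fixes f :: "real \<times> real \<Rightarrow> real"
  assumes "open D" "smooth_on D f" "x \<in> D"
  shows "pd_v (pd_u f) x = pd_u (pd_v f) x"
proof (rule ccontr)
  assume neq: "pd_v (pd_u f) x \<noteq> pd_u (pd_v f) x"
  obtain a b where x: "x = (a, b)" by (cases x)
  define e where "e = \<bar>pd_v (pd_u f) x - pd_u (pd_v f) x\<bar> / 2"
  have "e > 0" using neq by (simp add: e_def)
  have sm: "smooth_on D (pd_u f)" "smooth_on D (pd_v f)"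
    "smooth_on D (pd_v (pd_u f))" "smooth_on D (pd_u (pd_v f))"
    using assms by (auto intro: smooth_on_pd)
  then have "continuous (at x) (pd_v (pd_u f))" "continuous (at x) (pd_u (pd_v f))"
    using smooth_on_imp_continuous_on assms continuous_on_eq_continuous_at by metis+
  then obtain d1 d2 where d: "d1 > 0" "d2 > 0"
    "\<And>y. dist y x < d1 \<Longrightarrow> dist (pd_v (pd_u f) y) (pd_v (pd_u f) x) < e"
    "\<And>y. dist y x < d2 \<Longrightarrow> dist (pd_u (pd_v f) y) (pd_u (pd_v f) x) < e"
    unfolding continuous_at_eps_delta using \<open>e > 0\<close> by metis
  obtain d3 where d3: "d3 > 0" "ball x d3 \<subseteq> D"
    using assms openE by blast
  define h where "h = min d1 (min d2 d3) / 3"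
  have h: "h > 0" "2 * h < d1" "2 * h < d2" "2 * h < d3"
    using d d3 by (auto simp: h_def)
  have near: "dist (u, v) x \<le> 2 * h" if "u \<in> {a..a+h}" "v \<in> {b..b+h}" for u v
  proof -
    have "dist (u, v) x \<le> \<bar>u - a\<bar> + \<bar>v - b\<bar>"
      unfolding x dist_Pair_Pair by (rule order_trans[OF sqrt_sum_squares_le_sum_abs]) (simp add: dist_real_def)
    then show ?thesis using that by auto
  qed
  then have inD: "(u, v) \<in> D" if "u \<in> {a..a+h}" "v \<in> {b..b+h}" for u v
    using near[OF that] h d3 by (auto simp: dist_commute subset_eq)
  obtain \<xi> \<eta> where 1: "\<xi> \<in> {a..a+h}" "\<eta> \<in> {b..b+h}"
    "f (a + h, b + h) - f (a + h, b) - f (a, b + h) + f (a, b) = h * h * pd_v (pd_u f) (\<xi>, \<eta>)"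
    using second_difference_mean_value[OF h(1), of a b "\<lambda>u v. f (u, v)" "\<lambda>u v. pd_u f (u, v)"
        "\<lambda>u v. pd_v (pd_u f) (u, v)"] inD assms sm pd_has_real_derivative
    by blast
  obtain \<eta>' \<xi>' where 2: "\<xi>' \<in> {a..a+h}" "\<eta>' \<in> {b..b+h}"
    "f (a + h, b + h) - f (a, b + h) - f (a + h, b) + f (a, b) = h * h * pd_u (pd_v f) (\<xi>', \<eta>')"
    using second_difference_mean_value[OF h(1), of b a "\<lambda>v u. f (u, v)" "\<lambda>v u. pd_v f (u, v)"
        "\<lambda>v u. pd_u (pd_v f) (u, v)"] inD assms sm pd_has_real_derivative
    by blast
  have "h * h * pd_v (pd_u f) (\<xi>, \<eta>) = h * h * pd_u (pd_v f) (\<xi>', \<eta>')"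
    using 1(3) 2(3) by linarith
  then have eq: "pd_v (pd_u f) (\<xi>, \<eta>) = pd_u (pd_v f) (\<xi>', \<eta>')" using h(1) by simp
  have "dist (pd_v (pd_u f) (\<xi>, \<eta>)) (pd_v (pd_u f) x) < e"
    using near[OF 1(1,2)] h by (intro d) auto
  moreover have "dist (pd_u (pd_v f) (\<xi>', \<eta>')) (pd_u (pd_v f) x) < e"
    using near[OF 2(1,2)] h by (intro d) auto
  ultimately show False
    using dist_triangle2[of "pd_v (pd_u f) x" "pd_u (pd_v f) x" "pd_u (pd_v f) (\<xi>', \<eta>')"]
    unfolding eq e_def dist_real_def by (simp add: abs_minus_commute)
qed

lemma pd_commute:
  fixes f :: "real \<times> real \<Rightarrow> 'b::euclidean_space"
  assumes "open D" "smooth_on D f" "x \<in> D"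
  shows "pd_v (pd_u f) x = pd_u (pd_v f) x"
proof (rule euclidean_eqI)
  fix i :: 'b
  have lin: "bounded_linear (\<lambda>y. y \<bullet> i)" by (rule bounded_linear_inner_left)
  have "smooth_on D (\<lambda>x. f x \<bullet> i)" by (rule smooth_on_linear[OF lin assms(1,2)])
  note pd_commute_real[OF assms(1) this assms(3)]
  moreover have "pd_v (pd_u (\<lambda>x. f x \<bullet> i)) x = pd_v (\<lambda>x. pd_u f x \<bullet> i) x"
    "pd_u (pd_v (\<lambda>x. f x \<bullet> i)) x = pd_u (\<lambda>x. pd_v f x \<bullet> i) x"
    using pd_linear[OF lin assms(1,2)] by (auto intro!: pd_cong[OF assms(1,3)])
  ultimately show "pd_v (pd_u f) x \<bullet> i = pd_u (pd_v f) x \<bullet> i"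
    using pd_linear[OF lin assms(1) _ assms(3)] smooth_on_pd[OF assms(2)] by metis
qed

text \<open>The zero set of \<open>d\<close> is closed. It is also open: around a zero take a ball of radius \<open>r\<close> with
\<open>K r \<le> 1/2\<close>. By the mean value inequality the maximum of the norm of \<open>d\<close> on this ball is at most half of
itself.\<close>

lemma linear_differential_inequality_zero:
  fixes d :: "'a::euclidean_space \<Rightarrow> 'b::real_normed_vector"
  assumes "open D" "connected D" "x0 \<in> D" "d x0 = 0"
    and der: "\<And>x. x \<in> D \<Longrightarrow> (d has_derivative d' x) (at x)"
    and bound: "\<And>x h. x \<in> D \<Longrightarrow> norm (d' x h) \<le> K x * norm (d x) * norm h"
    and contK: "continuous_on D K"
    and "x \<in> D"
  shows "d x = 0"
proof -
  have contd: "continuous_on D d"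
    using der by (meson continuous_at_imp_continuous_on has_derivative_continuous)
  define N where "N = {x \<in> D. d x = 0}"
  have "closedin (top_of_set D) N"
    unfolding N_def using contd continuous_closedin_preimage_constant by blast
  moreover have "openin (top_of_set D) N"
  proof -
    have "\<exists>r>0. ball a r \<subseteq> N" if "a \<in> N" for a
    proof -
      from that have a: "a \<in> D" "d a = 0" by (auto simp: N_def)
      obtain r0 where r0: "r0 > 0" "cball a r0 \<subseteq> D"
        using \<open>open D\<close> a open_contains_cball by blast
      obtain M where M: "M \<ge> 0" "\<And>x. x \<in> cball a r0 \<Longrightarrow> norm (K x) \<le> M"
        using continuous_on_compact_bounded[OF continuous_on_subset[OF contK r0(2)] compact_cball] by metis
      define r where "r = min r0 (1 / (2 * M + 2))"
      have r: "r > 0" "r \<le> r0" "M * r \<le> 1 / 2"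
      proof -
        show "r > 0" "r \<le> r0" using r0 M by (auto simp: r_def)
        have "M * r \<le> M * (1 / (2 * M + 2))" using M by (intro mult_left_mono) (auto simp: r_def)
        also have "\<dots> \<le> 1 / 2" using M by (simp add: field_simps)
        finally show "M * r \<le> 1 / 2" .
      qed
      have sub: "cball a r \<subseteq> cball a r0" "cball a r \<subseteq> D" using r r0 by auto
      have "\<exists>q\<in>cball a r. \<forall>y\<in>cball a r. norm (d y) \<le> norm (d q)"
        using r by (intro continuous_attains_sup continuous_on_norm continuous_on_subset[OF contd sub(2)]) auto
      then obtain q where q: "q \<in> cball a r" "\<And>y. y \<in> cball a r \<Longrightarrow> norm (d y) \<le> norm (d q)" by blast
      have "norm (d q - d a) \<le> (M * norm (d q)) * norm (q - a)"
      proof (rule differentiable_bound[where S = "cball a r" and f' = d'])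
        show "(d has_derivative d' y) (at y within cball a r)" if "y \<in> cball a r" for y
          using der that sub by (blast intro: has_derivative_at_withinI)
        show "onorm (d' y) \<le> M * norm (d q)" if "y \<in> cball a r" for y
        proof (rule onorm_bound)
          show "0 \<le> M * norm (d q)" using M by simp
          fix h
          have "norm (d' y h) \<le> K y * norm (d y) * norm h" using bound that sub by blast
          also have "\<dots> \<le> M * norm (d q) * norm h"
            using M q that M(2)[OF subsetD[OF sub(1) that]]
            by (intro mult_right_mono mult_mono) auto
          finally show "norm (d' y h) \<le> M * norm (d q) * norm h" .
        qed
      qed (use q r in auto)
      also have "\<dots> \<le> (M * norm (d q)) * r"
        using q M by (intro mult_left_mono) (auto simp: dist_norm norm_minus_commute)
      also have "\<dots> = (M * r) * norm (d q)" by simp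
      also have "\<dots> \<le> 1 / 2 * norm (d q)" using r by (intro mult_right_mono) auto
      finally have "norm (d q) = 0" using a by simp
      then have "d y = 0" if "y \<in> cball a r" for y using q(2)[OF that] by simp
      then have "ball a r \<subseteq> N" using sub by (auto simp: N_def)
      with r show ?thesis by blast
    qed
    then have "open N" by (simp add: open_contains_ball)
    then show ?thesis by (simp add: N_def openin_open_eq[OF \<open>open D\<close>])
  qed
  moreover have "x0 \<in> N" using assms by (simp add: N_def)
  ultimately have "N = D" using \<open>connected D\<close> unfolding connected_clopen by blast
  with \<open>x \<in> D\<close> show ?thesis by (auto simp: N_def)
qed

lemma bounded_bilinear_matrix_mult:
  "bounded_bilinear ((**) :: real^'n^'m \<Rightarrow> real^'p^'n \<Rightarrow> real^'p^'m)"
  unfolding bilinear_conv_bounded_bilinear[symmetric] bilinear_def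
  by (auto intro!: linearI simp: matrix_matrix_mult_def vec_eq_iff sum.distrib algebra_simps sum_distrib_left)

section \<open>Linear systems of partial differential equations\<close>

text \<open>A general bilinear product covers matrix systems as well as the Poincare lemma below. The flatness
condition is the equality of the mixed derivatives \<open>F\<^sub>u\<^sub>v\<close> and \<open>F\<^sub>v\<^sub>u\<close>.\<close>

lemma flat_bilinear_system_exists:
  fixes P Q :: "real \<times> real \<Rightarrow> 'p::euclidean_space" and bil :: "'p \<Rightarrow> 'b::euclidean_space \<Rightarrow> 'b"
  assumes bil: "bounded_bilinear bil"
    and D: "open D" "simply_connected D" "x0 \<in> D"
    and sm: "smooth_on D P" "smooth_on D Q"
    and flat: "\<And>x y. x \<in> D \<Longrightarrow>
      bil (pd_v P x) y + bil (P x) (bil (Q x) y) = bil (pd_u Q x) y + bil (Q x) (bil (P x) y)"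
  shows "\<exists>F. F x0 = y0 \<and>
    (\<forall>x\<in>D. (F has_derivative (\<lambda>h. bil (fst h *\<^sub>R P x + snd h *\<^sub>R Q x) (F x))) (at x))"
proof -
  interpret bounded_bilinear bil by (rule bil)
  define mop :: "'p \<Rightarrow> 'b \<Rightarrow>\<^sub>L 'b" where "mop A = Blinfun (bil A)" for A
  have mop: "mop A y = bil A y" for A y
    unfolding mop_def by (simp add: bounded_linear_Blinfun_apply bounded_linear_right)
  define op2 :: "'p \<times> 'p \<Rightarrow> (real \<times> real) \<Rightarrow>\<^sub>L 'b \<Rightarrow>\<^sub>L 'b"
    where "op2 M = Blinfun (\<lambda>h. mop (fst h *\<^sub>R fst M + snd h *\<^sub>R snd M))" for M
  have "linear mop"
    by (rule linearI) (auto intro!: blinfun_eqI simp: mop add_left scaleR_left blinfun.bilinear_simps)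
  then have lin_mop: "bounded_linear mop" by (simp add: linear_conv_bounded_linear)
  have "bounded_linear (\<lambda>h. mop (fst h *\<^sub>R fst M + snd h *\<^sub>R snd M))" for M
    by (intro bounded_linear_compose[OF lin_mop] bounded_linear_intros)
  then have op2: "op2 M h = mop (fst h *\<^sub>R fst M + snd h *\<^sub>R snd M)" for M h
    unfolding op2_def by (simp add: bounded_linear_Blinfun_apply)
  have "linear op2"
    by (rule linearI) (auto intro!: blinfun_eqI
        simp: op2 mop add_left scaleR_left blinfun.bilinear_simps algebra_simps)
  then have lin_op2: "bounded_linear op2" by (simp add: linear_conv_bounded_linear)
  define B where "B x = op2 (P x, Q x)" for x
  define dB where "dB x k = op2 (fst k *\<^sub>R pd_u P x + snd k *\<^sub>R pd_v P x, fst k *\<^sub>R pd_u Q x + snd k *\<^sub>R pd_v Q x)" for x k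
  have lin_dB: "bounded_linear (dB x)" for x
    unfolding dB_def by (intro bounded_linear_compose[OF lin_op2] bounded_linear_intros)
  have dB_apply: "blinfun_apply (Blinfun (dB x)) = dB x" for x
    by (rule bounded_linear_Blinfun_apply[OF lin_dB])
  have "\<exists>F. F x0 = y0 \<and> (\<forall>x\<in>D. (F has_derivative (\<lambda>h. B x h (F x))) (at x))"
  proof (rule flat_section_exists[OF D, where DB = "\<lambda>x. Blinfun (dB x)"])
    show "(B has_derivative Blinfun (dB x)) (at x)" if "x \<in> D" for x
      unfolding dB_apply dB_def B_def
      using that D sm
      by (intro bounded_linear.has_derivative[OF lin_op2] has_derivative_Pair smooth_on_has_derivative_pd)
    show "continuous_on D (\<lambda>x. Blinfun (dB x))"
    proof (rule continuous_on_blinfun_componentwise)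
      show "continuous_on D (\<lambda>x. Blinfun (dB x) i)" for i
        unfolding dB_apply dB_def
        by (intro bounded_linear.continuous_on[OF lin_op2] continuous_intros
            smooth_on_imp_continuous_on smooth_on_pd sm)
    qed
    show "Blinfun (dB x) k h y + B x h (B x k y) = Blinfun (dB x) h k y + B x k (B x h y)"
      if "x \<in> D" for x h k y
    proof -
      have "(Blinfun (dB x) k h y + B x h (B x k y)) - (Blinfun (dB x) h k y + B x k (B x h y)) =
          (fst h * snd k - snd h * fst k) *\<^sub>R
            ((bil (pd_v P x) y + bil (P x) (bil (Q x) y)) - (bil (pd_u Q x) y + bil (Q x) (bil (P x) y)))"
        by (simp add: dB_apply dB_def B_def op2 mop add_left scaleR_left add_right
            scaleR_right algebra_simps)
      then show ?thesis by (simp add: flat[OF that])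
    qed
  qed
  then show ?thesis by (simp add: B_def op2 mop)
qed

text \<open>Bootstrapping: the equation expresses the derivative of \<open>F\<close> through \<open>F\<close> itself.\<close>

lemma smooth_on_solution:
  fixes P Q :: "real \<times> real \<Rightarrow> real^'n^'n" and F :: "real \<times> real \<Rightarrow> real^'m^'n"
  assumes "open D" and sm: "smooth_on D P" "smooth_on D Q"
    and der: "\<And>x. x \<in> D \<Longrightarrow> (F has_derivative (\<lambda>h. (fst h *\<^sub>R P x + snd h *\<^sub>R Q x) ** F x)) (at x)"
  shows "smooth_on D F"
  unfolding smooth_on_def
proof
  fix k show "C_k_on k D F"
  proof (induction k)
    case 0
    show ?case
      using der by (simp, meson continuous_at_imp_continuous_on has_derivative_continuous)
  next
    case (Suc k)
    show ?case
    proof (rule C_k_on_SucI[OF \<open>open D\<close> der])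
      fix h :: "real \<times> real"
      have "smooth_on D (\<lambda>x. fst h *\<^sub>R P x + snd h *\<^sub>R Q x)"
        by (intro smooth_on_add smooth_on_linear[OF bounded_linear_scaleR_right] sm \<open>open D\<close>)
      then show "C_k_on k D (\<lambda>x. (fst h *\<^sub>R P x + snd h *\<^sub>R Q x) ** F x)"
        by (intro C_k_on_bilinear[OF bounded_bilinear_matrix_mult \<open>open D\<close>] Suc) (simp add: smooth_on_def)
    qed
  qed
qed

text \<open>The coefficients on the right are there for the equation \<open>\<Delta>' = W \<Delta> + \<Delta> W\<^sup>T\<close> of Gram matrices.\<close>

lemma matrix_system_zero:
  fixes P Q :: "real \<times> real \<Rightarrow> real^'n^'n" and R T :: "real \<times> real \<Rightarrow> real^'m^'m"
    and F :: "real \<times> real \<Rightarrow> real^'m^'n"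
  assumes D: "open D" "connected D" "x0 \<in> D" "F x0 = 0"
    and cont: "continuous_on D P" "continuous_on D Q" "continuous_on D R" "continuous_on D T"
    and der: "\<And>x. x \<in> D \<Longrightarrow> (F has_derivative
      (\<lambda>h. (fst h *\<^sub>R P x + snd h *\<^sub>R Q x) ** F x + F x ** (fst h *\<^sub>R R x + snd h *\<^sub>R T x))) (at x)"
    and "x \<in> D"
  shows "F x = 0"
proof -
  obtain a where a: "a \<ge> 0" "\<And>(A :: real^'n^'n) (B :: real^'m^'n). norm (A ** B) \<le> norm A * norm B * a"
    using bounded_bilinear.nonneg_bounded[OF bounded_bilinear_matrix_mult] by blast
  obtain b where b: "b \<ge> 0" "\<And>(A :: real^'m^'n) (B :: real^'m^'m). norm (A ** B) \<le> norm A * norm B * b"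
    using bounded_bilinear.nonneg_bounded[OF bounded_bilinear_matrix_mult] by blast
  have comb: "norm (fst h *\<^sub>R A + snd h *\<^sub>R B) \<le> norm h * (norm A + norm B)"
    for h :: "real \<times> real" and A B :: "'z::real_normed_vector"
  proof -
    have "norm (fst h *\<^sub>R A + snd h *\<^sub>R B) \<le> norm (fst h) * norm A + norm (snd h) * norm B"
      by (rule norm_triangle_le) simp
    also have "\<dots> \<le> norm h * norm A + norm h * norm B"
      using norm_fst_le[of "fst h" "snd h"] norm_snd_le[of "snd h" "fst h"]
      by (intro add_mono mult_right_mono) auto
    finally show ?thesis by (simp add: algebra_simps)
  qed
  show ?thesis
  proof (rule linear_differential_inequality_zero[where K =
        "\<lambda>x. (norm (P x) + norm (Q x)) * a + (norm (R x) + norm (T x)) * b", OF D der _ _ \<open>x \<in> D\<close>])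
    show "continuous_on D (\<lambda>x. (norm (P x) + norm (Q x)) * a + (norm (R x) + norm (T x)) * b)"
      by (intro continuous_intros cont)
    fix x h
    have "norm ((fst h *\<^sub>R P x + snd h *\<^sub>R Q x) ** F x) \<le> norm h * (norm (P x) + norm (Q x)) * norm (F x) * a"
      by (rule order_trans[OF a(2)]) (intro mult_right_mono comb a norm_ge_zero)
    moreover have "norm (F x ** (fst h *\<^sub>R R x + snd h *\<^sub>R T x)) \<le> norm (F x) * (norm h * (norm (R x) + norm (T x))) * b"
      by (rule order_trans[OF b(2)]) (intro mult_right_mono mult_left_mono comb b norm_ge_zero)
    ultimately show "norm ((fst h *\<^sub>R P x + snd h *\<^sub>R Q x) ** F x + F x ** (fst h *\<^sub>R R x + snd h *\<^sub>R T x))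
        \<le> ((norm (P x) + norm (Q x)) * a + (norm (R x) + norm (T x)) * b) * norm (F x) * norm h"
      by (intro norm_triangle_le) (simp add: algebra_simps)
  qed auto
qed

text \<open>The inhomogeneous equation \<open>df = a du + b dv\<close> becomes the homogeneous linear system
\<open>df = s (a du + b dv)\<close>, \<open>ds = 0\<close> for the pair \<open>(f, s)\<close>; the solution starting with \<open>s = 1\<close> keeps this
value.\<close>

lemma poincare_lemma:
  fixes a b :: "real \<times> real \<Rightarrow> 'b::euclidean_space"
  assumes D: "open D" "simply_connected D"
    and sm: "smooth_on D a" "smooth_on D b"
    and closed: "\<And>x. x \<in> D \<Longrightarrow> pd_v a x = pd_u b x"
  shows "\<exists>f. \<forall>x\<in>D. (f has_derivative (\<lambda>h. fst h *\<^sub>R a x + snd h *\<^sub>R b x)) (at x)"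
proof (cases "D = {}")
  case True
  then show ?thesis by simp
next
  case False
  then obtain x0 where "x0 \<in> D" by blast
  (* the pair (f, s) with df = s (a du + b dv) and ds = 0 *)
  define bil :: "'b \<Rightarrow> 'b \<times> real \<Rightarrow> 'b \<times> real" where "bil A y = (snd y *\<^sub>R A, 0)" for A y
  have "bounded_bilinear bil"
    unfolding bilinear_conv_bounded_bilinear[symmetric] bilinear_def
    by (auto intro!: linearI simp: bil_def algebra_simps)
  from flat_bilinear_system_exists[OF this D \<open>x0 \<in> D\<close> sm, of "(0, 1)"]
  obtain F where F: "F x0 = (0, 1)"
    "\<And>x. x \<in> D \<Longrightarrow> (F has_derivative (\<lambda>h. bil (fst h *\<^sub>R a x + snd h *\<^sub>R b x) (F x))) (at x)"
    using closed by (auto simp: bil_def)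
  have "snd (F x) = 1" if "x \<in> D" for x
  proof -
    have "((\<lambda>x. snd (F x)) has_derivative (\<lambda>h. 0)) (at x)" if "x \<in> D" for x
      using has_derivative_snd[OF F(2)[OF that]] by (simp add: bil_def)
    then have "snd (F x) = snd (F x0)"
      by (rule has_derivative_zero_unique_connected[OF \<open>open D\<close>
          simply_connected_imp_connected[OF D(2)] _ that \<open>x0 \<in> D\<close>])
    then show ?thesis using F(1) by simp
  qed
  then have "((\<lambda>x. fst (F x)) has_derivative (\<lambda>h. fst h *\<^sub>R a x + snd h *\<^sub>R b x)) (at x)" if "x \<in> D" for x
    using has_derivative_fst[OF F(2)[OF that]] that by (simp add: bil_def)
  then show ?thesis by blast
qed

section \<open>L-coordinates\<close>

lemma coeff_form_simps [simp]:
  "coeff_form a b c e_u e_u = a" "coeff_form a b c e_u e_v = b" "coeff_form a b c e_v e_u = b"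
  "coeff_form a b c e_v e_v = c"
  by (simp_all add: coeff_form_def)

lemma degenerate_diagonal: "a * c = 0 \<Longrightarrow> degenerate (coeff_form a 0 c)"
  unfolding degenerate_def
  by (rule exI[of _ "if a = 0 then e_u else e_v"]) (auto simp: coeff_form_def zero_prod_def)

lemma pos_def_diagonal: "a > 0 \<Longrightarrow> c > 0 \<Longrightarrow> pos_def (coeff_form a 0 c)"
  unfolding pos_def_def
proof (intro allI impI)
  fix s :: "real \<times> real" assume "a > 0" "c > 0" "s \<noteq> 0"
  then have "fst s \<noteq> 0 \<or> snd s \<noteq> 0" by (cases s) (auto simp: zero_prod_def)
  then have "a * (fst s)\<^sup>2 + c * (snd s)\<^sup>2 > 0"
  proof
    assume "fst s \<noteq> 0"
    with \<open>a > 0\<close> \<open>c > 0\<close> show ?thesis by (intro add_pos_nonneg) auto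
  next
    assume "snd s \<noteq> 0"
    with \<open>a > 0\<close> \<open>c > 0\<close> show ?thesis by (intro add_nonneg_pos) auto
  qed
  then show "coeff_form a 0 c s s > 0" by (simp add: coeff_form_def power2_eq_square mult.assoc)
qed

lemma neg_def_diagonal:
  assumes "a < 0" "c < 0"
  shows "neg_def (coeff_form a 0 c)"
proof -
  have "coeff_form (- a) 0 (- c) s s = - coeff_form a 0 c s s" for s
    by (simp add: coeff_form_def)
  then show ?thesis
    using pos_def_diagonal[of "- a" "- c"] assms by (simp add: pos_def_def neg_def_def del: split_paired_All)
qed

lemma indefinite_diagonal:
  assumes "a > 0" "c < 0"
  shows "indefinite (coeff_form a 0 c)"
proof -
  have "\<not> degenerate (coeff_form a 0 c)"
  proof
    assume "degenerate (coeff_form a 0 c)"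
    then obtain s where s: "s \<noteq> 0" "\<And>t. coeff_form a 0 c s t = 0"
      unfolding degenerate_def by blast
    have "fst s = 0" "snd s = 0"
      using s(2)[of e_u] s(2)[of e_v] assms by (auto simp: coeff_form_def)
    with s(1) show False by (simp add: prod_eq_iff)
  qed
  moreover have "coeff_form a 0 c e_u e_u > 0" "coeff_form a 0 c e_v e_v < 0" using assms by auto
  ultimately show ?thesis unfolding indefinite_def by blast
qed

lemma chart_open_image:
  assumes "is_chart M c" "openin M U"
  shows "open (snd c ` (fst c \<inter> U))"
proof -
  from assms have c: "openin M (fst c)" "open (chart_image c)"
    "homeomorphic_map (subtopology M (fst c)) (top_of_set (chart_image c)) (snd c)"
    by (auto simp: is_chart_def)
  have "openin (subtopology M (fst c)) (fst c \<inter> U)"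
    using openin_Int[OF c(1) assms(2)] openin_subtopology_Int2 assms(2) by blast
  then have "openin (top_of_set (chart_image c)) (snd c ` (fst c \<inter> U))"
    using homeomorphic_imp_open_map[OF c(3)] by (simp add: open_map_def)
  then show ?thesis using c(2) by (simp add: openin_open_eq)
qed

lemma chart_openin_preimage:
  assumes "is_chart M c" "open V"
  shows "openin M {r \<in> fst c. snd c r \<in> V}"
proof -
  from assms have c: "openin M (fst c)"
    "homeomorphic_map (subtopology M (fst c)) (top_of_set (chart_image c)) (snd c)"
    by (auto simp: is_chart_def)
  have top: "topspace (subtopology M (fst c)) = fst c"
    using openin_subset[OF c(1)] by auto
  have "continuous_map (subtopology M (fst c)) euclidean (snd c)"
    using homeomorphic_imp_continuous_map[OF c(2)] continuous_map_in_subtopology by blast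
  then have "openin (subtopology M (fst c)) {r \<in> fst c. snd c r \<in> V}"
    using openin_continuous_map_preimage[of _ _ "snd c" V] \<open>open V\<close> top by (metis open_openin)
  then show ?thesis using c(1) by (simp add: openin_open_subtopology)
qed

lemma chart_inj_on: "is_chart M c \<Longrightarrow> inj_on (snd c) (fst c)"
  unfolding is_chart_def
  by (metis homeomorphic_imp_injective_map openin_subset topspace_subtopology_subset)

text \<open>The factor is the square of the determinant of the vectors \<open>L e_u\<close> and \<open>L e_v\<close>, so changing the chart
cannot reverse the sign of the discriminant.\<close>

lemma disc_pullback:
  "form_disc (\<lambda>s t. coeff_form a 0 c (L s) (L t)) =
    a * c * (fst (L e_u) * snd (L e_v) - snd (L e_u) * fst (L e_v))\<^sup>2"
  by (simp add: form_disc_def coeff_form_def power2_eq_square algebra_simps)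

lemma metric_tensor_smooth:
  "metric_tensor M A g \<Longrightarrow> coord_nbhd M A c \<Longrightarrow> smooth_on (chart_image c) (\<lambda>x. g c x s t)"
  unfolding metric_tensor_def by blast

lemma metric_tensor_transformation:
  "metric_tensor M A g \<Longrightarrow> coord_nbhd M A c \<Longrightarrow> coord_nbhd M A c' \<Longrightarrow> x \<in> transition_dom c c' \<Longrightarrow>
    g c x s t = g c' (transition c c' x) (frechet_derivative (transition c c') (at x) s)
      (frechet_derivative (transition c c') (at x) t)"
  unfolding metric_tensor_def by blast

locale diagonal_chart =
  fixes M :: "'a topology" and A :: "'a chart set" and g :: "'a chart \<Rightarrow> real \<times> real \<Rightarrow> form"
    and c :: "'a chart" and D :: "(real \<times> real) set" and E G :: "real \<times> real \<Rightarrow> real"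
  assumes tensor: "metric_tensor M A g"
    and chart: "coord_nbhd M A c"
    and D_eq: "D = chart_image c"
    and diagonal: "\<And>x. x \<in> D \<Longrightarrow> g c x = coeff_form (E x) 0 (G x)"
begin

lemma open_D: "open D"
  using chart by (simp add: D_eq coord_nbhd_def is_chart_def)

lemma smooth_EG: "smooth_on D E" "smooth_on D G"
proof -
  have "smooth_on D (\<lambda>x. g c x s t)" for s t
    using metric_tensor_smooth[OF tensor chart] by (simp add: D_eq)
  from this[of e_u e_u] this[of e_v e_v] show "smooth_on D E" "smooth_on D G"
    by (simp_all add: diagonal cong: smooth_on_cong[OF open_D])
qed

lemma pullback_of_diagonal_form:
  assumes "coord_nbhd M A c'" "r \<in> fst c" "r \<in> fst c'"
  obtains L where "g c' (snd c' r) = (\<lambda>s t. coeff_form (E (snd c r)) 0 (G (snd c r)) (L s) (L t))"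
proof -
  have "is_chart M c'" using assms by (simp add: coord_nbhd_def)
  then have tr: "transition c' c (snd c' r) = snd c r"
    using inv_into_f_f[OF chart_inj_on assms(3)] by (simp add: transition_def)
  have "snd c' r \<in> transition_dom c' c" using assms by (simp add: transition_dom_def)
  then have "g c' (snd c' r) s t = g c (snd c r)
      (frechet_derivative (transition c' c) (at (snd c' r)) s)
      (frechet_derivative (transition c' c) (at (snd c' r)) t)" for s t
    using metric_tensor_transformation[OF tensor assms(1) chart] by (simp add: tr)
  moreover have "snd c r \<in> D" using assms by (simp add: D_eq chart_image_def)
  ultimately show ?thesis
    by (intro that[of "frechet_derivative (transition c' c) (at (snd c' r))"] ext) (simp only: diagonal)
qed

text \<open>The discriminant is quadratic in the coefficients of the metric. If all of them vanish at a point, so does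
its differential there; hence the metric is nonzero at an admissible point.\<close>

lemma admissible_chart:
  assumes "admissible_point M A g q"
  obtains c' d' where "coord_nbhd M A c'" "q \<in> fst c'"
    "((\<lambda>x. form_disc (g c' x)) has_derivative d') (at (snd c' q))" "d' \<noteq> (\<lambda>s. 0)"
    "\<forall>s t. g c' (snd c' q) s t = 0 \<Longrightarrow> False"
proof -
  obtain c' where c': "coord_nbhd M A c'" "q \<in> fst c'"
    "frechet_derivative (\<lambda>x. form_disc (g c' x)) (at (snd c' q)) \<noteq> (\<lambda>s. 0)"
    using assms by (auto simp: admissible_point_def)
  define x where "x = snd c' q"
  have "open (chart_image c')" using c' by (simp add: coord_nbhd_def is_chart_def)
  moreover have "x \<in> chart_image c'" using c' by (simp add: x_def chart_image_def)
  moreover have "smooth_on (chart_image c') (\<lambda>x. g c' x s t)" for s t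
    by (rule metric_tensor_smooth[OF tensor c'(1)])
  ultimately have d: "((\<lambda>x. g c' x s t) has_derivative frechet_derivative (\<lambda>x. g c' x s t) (at x)) (at x)" for s t
    by (intro smooth_on_has_derivative)
  define d' where "d' h = g c' x e_u e_u * frechet_derivative (\<lambda>x. g c' x e_v e_v) (at x) h +
      frechet_derivative (\<lambda>x. g c' x e_u e_u) (at x) h * g c' x e_v e_v -
      (g c' x e_u e_v * frechet_derivative (\<lambda>x. g c' x e_u e_v) (at x) h +
      frechet_derivative (\<lambda>x. g c' x e_u e_v) (at x) h * g c' x e_u e_v)" for h
  have der: "((\<lambda>x. form_disc (g c' x)) has_derivative d') (at x)"
    unfolding form_disc_def power2_eq_square d'_def[abs_def]
    by (intro has_derivative_diff has_derivative_mult d)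
  then have "d' \<noteq> (\<lambda>s. 0)" using frechet_derivative_at[OF der] c'(3) by (simp add: x_def)
  moreover have "False" if "\<forall>s t. g c' x s t = 0"
    using that \<open>d' \<noteq> (\<lambda>s. 0)\<close> by (simp add: d'_def[abs_def])
  ultimately show ?thesis using c' der that unfolding x_def by blast
qed

text \<open>Otherwise the discriminant in a chart which witnesses admissibility, being that of \<open>c\<close> times a square,
would have a local extremum with value \<open>0\<close> at \<open>q\<close>, and its differential would vanish. The sign \<open>\<sigma>\<close>
treats maxima and minima at once.\<close>

lemma disc_changes_sign:
  assumes q: "q \<in> fst c" "admissible_point M A g q" "E (snd c q) * G (snd c q) = 0"
    and V: "open V" "snd c q \<in> V" and \<sigma>: "\<sigma> = 1 \<or> \<sigma> = -1"
  shows "\<exists>y\<in>V \<inter> D. \<sigma> * (E y * G y) > 0"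
proof (rule ccontr)
  assume "\<not> ?thesis"
  then have le: "\<sigma> * (E y * G y) \<le> 0" if "y \<in> V" "y \<in> D" for y
    using that by force
  obtain c' d' where c': "coord_nbhd M A c'" "q \<in> fst c'"
    "((\<lambda>x. form_disc (g c' x)) has_derivative d') (at (snd c' q))" "d' \<noteq> (\<lambda>s. 0)"
    using admissible_chart[OF q(2)] by metis
  define W where "W = snd c' ` (fst c' \<inter> {r \<in> fst c. snd c r \<in> V})"
  have "open W"
    unfolding W_def using chart c'(1) V
    by (intro chart_open_image chart_openin_preimage) (auto simp: coord_nbhd_def)
  have xW: "snd c' q \<in> W" using q c' V by (auto simp: W_def)
  have zero: "form_disc (g c' (snd c' q)) = 0"
  proof -
    obtain L where "g c' (snd c' q) = (\<lambda>s t. coeff_form (E (snd c q)) 0 (G (snd c q)) (L s) (L t))"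
      using pullback_of_diagonal_form[OF c'(1) q(1) c'(2)] .
    then show ?thesis using q(3) by (simp add: disc_pullback)
  qed
  have "\<sigma> * form_disc (g c' y) \<le> 0" if yW: "y \<in> W" for y
  proof -
    obtain r where r: "r \<in> fst c'" "r \<in> fst c" "snd c r \<in> V" "y = snd c' r"
      using yW by (auto simp: W_def)
    obtain L where "g c' (snd c' r) = (\<lambda>s t. coeff_form (E (snd c r)) 0 (G (snd c r)) (L s) (L t))"
      using pullback_of_diagonal_form[OF c'(1) r(2,1)] .
    then have "\<sigma> * form_disc (g c' y) = (\<sigma> * (E (snd c r) * G (snd c r))) *
        (fst (L e_u) * snd (L e_v) - snd (L e_u) * fst (L e_v))\<^sup>2"
      by (simp add: disc_pullback r)
    also have "\<dots> \<le> 0"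
      by (rule mult_nonpos_nonneg) (use le[of "snd c r"] r in \<open>auto simp: D_eq chart_image_def\<close>)
    finally show ?thesis .
  qed
  then have "(\<forall>y\<in>W. form_disc (g c' y) \<le> form_disc (g c' (snd c' q))) \<or>
      (\<forall>y\<in>W. form_disc (g c' (snd c' q)) \<le> form_disc (g c' y))"
    using \<sigma> by (auto simp: zero)
  then have "d' = (\<lambda>s. 0)"
    using differential_zero_maxmin[OF xW \<open>open W\<close> c'(3)] by blast
  with c'(4) show False by simp
qed

end

locale L_coordinates = diagonal_chart +
  fixes p :: 'a
  assumes admissible: "admissible_metric M A g"
    and semi_p: "semidefinite_point M A g p"
    and L_chart: "L_coord_nbhd M A g p c"
    and conn: "connected D"
begin

lemma origin: "(0, 0) \<in> D" "G (0, 0) = 0"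
proof -
  have p: "p \<in> fst c" "snd c p = (0, 0)" "g c (snd c p) e_v e_v = 0"
    using L_chart semi_p by (auto simp: L_coord_nbhd_def)
  then show "(0, 0) \<in> D" by (force simp: D_eq chart_image_def)
  with diagonal p show "G (0, 0) = 0" by simp
qed

lemma degenerate_imp_admissible:
  assumes "x \<in> D" "E x * G x = 0"
  obtains q where "q \<in> fst c" "x = snd c q" "admissible_point M A g q" "G x = 0"
proof -
  obtain q where q: "q \<in> fst c" "x = snd c q"
    using assms by (auto simp: D_eq chart_image_def)
  have "semidefinite_point M A g q"
    unfolding semidefinite_point_def at_point_def
    using chart q assms degenerate_diagonal diagonal by metis
  moreover then have "G x = 0"
    using L_chart q diagonal[OF assms(1)] unfolding L_coord_nbhd_def by (metis coeff_form_simps(4))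
  ultimately show ?thesis
    using that q admissible by (simp add: admissible_metric_def)
qed

text \<open>At a zero of \<open>E\<close> the point is semidefinite, so \<open>G\<close> vanishes there as well and the metric is zero,
which admissibility excludes.\<close>

lemma E_nonzero: "E x \<noteq> 0" if "x \<in> D" for x
proof
  assume "E x = 0"
  with that obtain q where q: "q \<in> fst c" "x = snd c q" "admissible_point M A g q" "G x = 0"
    by (rule_tac degenerate_imp_admissible[of x]) auto
  obtain c' where c': "coord_nbhd M A c'" "q \<in> fst c'" "\<not> (\<forall>s t. g c' (snd c' q) s t = 0)"
    using admissible_chart[OF q(3)] by metis
  obtain L where "g c' (snd c' q) = (\<lambda>s t. coeff_form (E (snd c q)) 0 (G (snd c q)) (L s) (L t))"
    using pullback_of_diagonal_form[OF c'(1) q(1) c'(2)] .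
  with c'(3) q(2,4) \<open>E x = 0\<close> show False by (simp add: coeff_form_def)
qed

lemma E_G_sign:
  assumes "x \<in> D" "G x = 0" "open V" "x \<in> V" "\<sigma> = 1 \<or> \<sigma> = -1"
  shows "\<exists>y\<in>V \<inter> D. \<sigma> * (E y * G y) > 0"
proof -
  obtain q where q: "q \<in> fst c" "x = snd c q" "admissible_point M A g q" "G x = 0"
    using degenerate_imp_admissible[of x] assms by auto
  show ?thesis
    using disc_changes_sign[OF q(1,3) _ assms(3) _ assms(5)] assms q by simp
qed

text \<open>Near the origin \<open>E G\<close> takes positive values; where it does, a negative \<open>E\<close> would make the metric
negative definite. As \<open>E\<close> has no zeros, its sign is the same on the connected set \<open>D\<close>.\<close>

lemma E_pos: "E x > 0" if "x \<in> D" for x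
proof (rule ccontr)
  assume "\<not> E x > 0"
  obtain y where y: "y \<in> D" "E y * G y > 0"
    using E_G_sign[OF origin, of UNIV 1] by auto
  have "connected (E ` D)"
    using conn smooth_on_imp_continuous_on[OF smooth_EG(1)] by (rule connected_continuous_image[rotated])
  have "E y < 0"
  proof (rule ccontr)
    assume "\<not> E y < 0"
    then have "0 \<in> E ` D"
      using connectedD_interval[OF \<open>connected (E ` D)\<close>, of "E x" "E y" 0] that y \<open>\<not> E x > 0\<close> by auto
    then show False using E_nonzero by auto
  qed
  with y have "G y < 0" by (simp add: zero_less_mult_iff)
  obtain r where "r \<in> fst c" "y = snd c r"
    using y by (auto simp: D_eq chart_image_def)
  then have "at_point M A g neg_def r"
    unfolding at_point_def using chart y diagonal neg_def_diagonal[OF \<open>E y < 0\<close> \<open>G y < 0\<close>] by metis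
  then show False using admissible by (simp add: admissible_metric_def)
qed

lemma G_changes_sign:
  assumes "x \<in> D" "G x = 0" "open V" "x \<in> V"
  shows "\<exists>y\<in>V \<inter> D. G y > 0" "\<exists>y\<in>V \<inter> D. G y < 0"
  using E_G_sign[OF assms, of 1] E_G_sign[OF assms, of "-1"] E_pos
  by (force simp: zero_less_mult_iff mult_less_0_iff)+

end

section \<open>Gauss-Weingarten system\<close>

lemma bounded_bilinear_lor: "bounded_bilinear lor"
  unfolding bilinear_conv_bounded_bilinear[symmetric] bilinear_def
  by (auto intro!: linearI simp: lor_def algebra_simps)

interpretation lor: bounded_bilinear lor by (rule bounded_bilinear_lor)

lemma lor_commute: "lor x y = lor y x" by (simp add: lor_def mult.commute)

lemma gram_matrix_nth:
  fixes F H :: "real^3^3"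
  shows "(F ** S_mat ** transpose H) $ i $ j = lor (F $ i) (H $ j)"
  by (simp add: matrix_matrix_mult_def transpose_def S_mat_def lor_def sum_3)

definition mat3 :: "real \<Rightarrow> real \<Rightarrow> real \<Rightarrow> real \<Rightarrow> real \<Rightarrow> real \<Rightarrow> real \<Rightarrow> real \<Rightarrow> real \<Rightarrow> real^3^3" where
  "mat3 a b c d e f g h i = vector [vector [a, b, c], vector [d, e, f], vector [g, h, i]]"

lemma mat3_nth [simp]:
  "mat3 a b c d e f g h i $ 1 $ 1 = a" "mat3 a b c d e f g h i $ 1 $ 2 = b" "mat3 a b c d e f g h i $ 1 $ 3 = c"
  "mat3 a b c d e f g h i $ 2 $ 1 = d" "mat3 a b c d e f g h i $ 2 $ 2 = e" "mat3 a b c d e f g h i $ 2 $ 3 = f"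
  "mat3 a b c d e f g h i $ 3 $ 1 = g" "mat3 a b c d e f g h i $ 3 $ 2 = h" "mat3 a b c d e f g h i $ 3 $ 3 = i"
  by (simp_all add: mat3_def)

lemma matrix_eq_entries: "A = B \<longleftrightarrow> (\<forall>i j. A $ i $ j = B $ i $ j)" for A B :: "real^3^3"
  by (simp add: vec_eq_iff)

lemma smooth_on_mat3:
  assumes "open D" "smooth_on D a" "smooth_on D b" "smooth_on D c" "smooth_on D d" "smooth_on D e"
    "smooth_on D f" "smooth_on D g" "smooth_on D h" "smooth_on D i"
  shows "smooth_on D (\<lambda>x. mat3 (a x) (b x) (c x) (d x) (e x) (f x) (g x) (h x) (i x))"
proof (intro smooth_on_vec \<open>open D\<close>)
  fix k l :: 3
  show "smooth_on D (\<lambda>x. mat3 (a x) (b x) (c x) (d x) (e x) (f x) (g x) (h x) (i x) $ k $ l)"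
    using exhaust_3[of k] exhaust_3[of l] assms by auto
qed

lemma pd_matrix_nth:
  fixes N :: "real \<times> real \<Rightarrow> real^'m^'n"
  assumes "open D" "smooth_on D N" "x \<in> D"
  shows "pd_u N x $ i $ j = pd_u (\<lambda>x. N x $ i $ j) x" "pd_v N x $ i $ j = pd_v (\<lambda>x. N x $ i $ j) x"
  using pd_linear[OF bounded_linear_compose[OF bounded_linear_vec_nth bounded_linear_vec_nth] assms]
  by simp_all

lemma bounded_linear_transpose: "bounded_linear (transpose :: real^'n^'m \<Rightarrow> real^'m^'n)"
  unfolding linear_conv_bounded_linear[symmetric]
  by (rule linearI) (auto simp: transpose_def vec_eq_iff)

lemma pd_const: "pd_u (\<lambda>x. k) y = 0" "pd_v (\<lambda>x. k) y = 0"
  using pd_has_derivative[OF has_derivative_const[of k "at y"]] by simp_all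

locale fundamental_data =
  fixes D :: "(real \<times> real) set" and E G X Y Z :: "real \<times> real \<Rightarrow> real"
  assumes open_D: "open D"
    and smooth: "smooth_on D E" "smooth_on D G" "smooth_on D X" "smooth_on D Y" "smooth_on D Z"
    and E_pos: "\<And>x. x \<in> D \<Longrightarrow> E x > 0"
begin

text \<open>The Lorentzian products of the rows \<open>f\<^sub>u\<close>, \<open>f\<^sub>v\<close>, \<open>\<psi>\<close> of the frame of a surface.\<close>

definition metric_matrix :: "real \<times> real \<Rightarrow> real^3^3" where
  "metric_matrix x = mat3 (E x) 0 0 0 (G x) 1 0 1 0"

definition metric_inverse :: "real \<times> real \<Rightarrow> real^3^3" where
  "metric_inverse x = mat3 (1 / E x) 0 0 0 0 1 0 1 (- G x)"

text \<open>The entry \<open>(i, j)\<close> of \<open>N_u\<close> is the product of the \<open>u\<close>-derivative of the \<open>i\<close>-th row of the frame with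
its \<open>j\<close>-th row, and likewise for \<open>N_v\<close>. The last column holds the coefficients of the second fundamental form; the
remaining entries follow from it and from the derivatives of \<open>metric_matrix\<close>.\<close>

definition N_u :: "real \<times> real \<Rightarrow> real^3^3" where
  "N_u x = mat3 (pd_u E x / 2) (- pd_v E x / 2) (X x)
    (pd_v E x / 2) (pd_u G x / 2) (Y x) (- X x) (- Y x) 0"

definition N_v :: "real \<times> real \<Rightarrow> real^3^3" where
  "N_v x = mat3 (pd_v E x / 2) (pd_u G x / 2) (Y x)
    (- pd_u G x / 2) (pd_v G x / 2) (Z x) (- Y x) (- Z x) 0"

definition P :: "real \<times> real \<Rightarrow> real^3^3" where "P x = N_u x ** metric_inverse x"
definition Q :: "real \<times> real \<Rightarrow> real^3^3" where "Q x = N_v x ** metric_inverse x"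

lemma metric_inverse: "x \<in> D \<Longrightarrow> metric_matrix x ** metric_inverse x = mat 1"
    "x \<in> D \<Longrightarrow> metric_inverse x ** metric_matrix x = mat 1"
  using E_pos[of x]
  by (auto simp: metric_matrix_def metric_inverse_def mat_def matrix_eq_entries forall_3
      matrix_matrix_mult_def sum_3)

lemma P_metric: "x \<in> D \<Longrightarrow> P x ** metric_matrix x = N_u x"
  and Q_metric: "x \<in> D \<Longrightarrow> Q x ** metric_matrix x = N_v x"
  by (simp_all add: P_def Q_def matrix_mul_assoc[symmetric] metric_inverse)

lemma smooth_entries:
  "smooth_on D (\<lambda>x. pd_u E x / 2)" "smooth_on D (\<lambda>x. pd_v E x / 2)" "smooth_on D (\<lambda>x. - pd_v E x / 2)"
  "smooth_on D (\<lambda>x. pd_u G x / 2)" "smooth_on D (\<lambda>x. pd_v G x / 2)" "smooth_on D (\<lambda>x. - pd_u G x / 2)"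
  "smooth_on D (\<lambda>x. - X x)" "smooth_on D (\<lambda>x. - Y x)" "smooth_on D (\<lambda>x. - Z x)"
  "smooth_on D (\<lambda>x. - G x)" "smooth_on D (\<lambda>x. 1 / E x)"
  by (intro smooth_on_divide smooth_on_minus smooth_on_pd smooth smooth_on_const open_D; use E_pos in force)+

lemma smooth_matrices:
  "smooth_on D metric_matrix" "smooth_on D metric_inverse" "smooth_on D N_u" "smooth_on D N_v"
  unfolding metric_matrix_def[abs_def] metric_inverse_def[abs_def] N_u_def[abs_def] N_v_def[abs_def]
  by (intro smooth_on_mat3 open_D smooth smooth_on_const smooth_entries)+

lemma smooth_PQ: "smooth_on D P" "smooth_on D Q"
  unfolding P_def[abs_def] Q_def[abs_def]
  by (intro smooth_on_bilinear[OF bounded_bilinear_matrix_mult] open_D smooth_matrices)+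

lemma pd_metric_matrix:
  assumes "x \<in> D"
  shows "pd_u metric_matrix x = N_u x + transpose (N_u x)" "pd_v metric_matrix x = N_v x + transpose (N_v x)"
  unfolding matrix_eq_entries forall_3
  by (simp_all add: pd_matrix_nth[OF open_D smooth_matrices(1) assms] metric_matrix_def N_u_def N_v_def
      transpose_def pd_const)

lemma transpose_metric_matrix: "transpose (metric_matrix x) = metric_matrix x"
  by (simp add: matrix_eq_entries forall_3 transpose_def metric_matrix_def)

lemma pd_scaled:
  fixes f :: "real \<times> real \<Rightarrow> real"
  assumes "smooth_on D f" "x \<in> D"
  shows "pd_u (\<lambda>x. f x / 2) x = pd_u f x / 2" "pd_v (\<lambda>x. f x / 2) x = pd_v f x / 2"
    "pd_u (\<lambda>x. - (f x / 2)) x = - (pd_u f x / 2)" "pd_v (\<lambda>x. - (f x / 2)) x = - (pd_v f x / 2)"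
    "pd_u (\<lambda>x. - f x) x = - pd_u f x" "pd_v (\<lambda>x. - f x) x = - pd_v f x"
  using pd_linear[OF bounded_linear_divide[of 2] open_D assms]
    pd_linear[OF bounded_linear_minus[OF bounded_linear_divide[of 2]] open_D assms]
    pd_linear[OF bounded_linear_minus[OF bounded_linear_ident] open_D assms]
  by simp_all

end

locale integrable_data = fundamental_data +
  assumes Codazzi1: "\<And>x. x \<in> D \<Longrightarrow> pd_v X x - pd_u Y x =
          1 / (2 * E x) * (pd_v E x * X x - pd_u E x * Y x) + (Y x)\<^sup>2 - X x * Z x"
    and Codazzi2: "\<And>x. x \<in> D \<Longrightarrow> pd_v Y x - pd_u Z x =
          - (1 / (2 * E x)) * (pd_u G x * X x + pd_v E x * Y x)"
    and Gauss: "\<And>x. x \<in> D \<Longrightarrow> pd_v (pd_v E) x + pd_u (pd_u G) x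
          - (pd_u E x * pd_u G x + (pd_v E x)\<^sup>2) / (2 * E x) =
          2 * G x * (X x * Z x - (Y x)\<^sup>2)
          - pd_v G x * X x + 2 * pd_u G x * Y x + pd_v E x * Z x"
begin

text \<open>The difference of both sides is an antisymmetric matrix. Its entry \<open>(1, 2)\<close> is the Gauss equation, \<open>(1, 3)\<close> and \<open>(2, 3)\<close> are the Codazzi equations.\<close>

lemma integrability:
  assumes "x \<in> D"
  shows "pd_v N_u x - P x ** transpose (N_v x) = pd_u N_v x - Q x ** transpose (N_u x)"
proof -
  note pdc = pd_commute_real[OF open_D smooth(1) assms] pd_commute_real[OF open_D smooth(2) assms]
  (* the hypotheses, solved for a highest derivative so that they serve as rewrite rules *)
  have c1: "pd_v X x = pd_u Y x + (pd_v E x * X x - pd_u E x * Y x) / (2 * E x) + (Y x)\<^sup>2 - X x * Z x"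
    using Codazzi1[OF assms] by simp
  have c2: "pd_v Y x = pd_u Z x - (pd_u G x * X x + pd_v E x * Y x) / (2 * E x)"
    using Codazzi2[OF assms] by simp
  have c3: "pd_v (pd_v E) x = (pd_u E x * pd_u G x + (pd_v E x)\<^sup>2) / (2 * E x) - pd_u (pd_u G) x
      + 2 * G x * (X x * Z x - (Y x)\<^sup>2) - pd_v G x * X x + 2 * pd_u G x * Y x + pd_v E x * Z x"
    using Gauss[OF assms] by simp
  have "E x \<noteq> 0" using E_pos[OF assms] by simp
  then show ?thesis
    unfolding matrix_eq_entries forall_3 P_def Q_def
    by (simp_all add: pd_matrix_nth[OF open_D smooth_matrices(3) assms]
        pd_matrix_nth[OF open_D smooth_matrices(4) assms])
      (simp_all add: N_u_def N_v_def metric_inverse_def transpose_def matrix_matrix_mult_def sum_3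
        pd_scaled smooth smooth_on_pd assms pd_const pdc c1 c2 c3, simp_all add: field_simps power2_eq_square)
qed

text \<open>Multiplication by \<open>\<Gamma> = metric_matrix\<close> from the right avoids differentiating its inverse: from
\<open>P \<Gamma> = N_u\<close>, \<open>Q \<Gamma> = N_v\<close> and \<open>\<Gamma>\<^sub>v = N_v + N_v\<^sup>T\<close> one obtains
\<open>(P\<^sub>v + P Q) \<Gamma> = (N_u)\<^sub>v - P \<Gamma>\<^sub>v + P N_v = (N_u)\<^sub>v - P N_v\<^sup>T\<close>.\<close>

lemma frame_system_flat:
  assumes "x \<in> D"
  shows "pd_v P x + P x ** Q x = pd_u Q x + Q x ** P x"
proof -
  note bbm = bounded_bilinear_matrix_mult
  note mm = bounded_bilinear.add_left[OF bbm] bounded_bilinear.add_right[OF bbm]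
  have P: "pd_v N_u x = P x ** pd_v metric_matrix x + pd_v P x ** metric_matrix x"
    using pd_bilinear(2)[OF bbm open_D smooth_PQ(1) smooth_matrices(1) assms]
      pd_cong(2)[OF open_D assms P_metric] by simp
  have Q: "pd_u N_v x = Q x ** pd_u metric_matrix x + pd_u Q x ** metric_matrix x"
    using pd_bilinear(1)[OF bbm open_D smooth_PQ(2) smooth_matrices(1) assms]
      pd_cong(1)[OF open_D assms Q_metric] by simp
  have "(pd_v P x + P x ** Q x) ** metric_matrix x = pd_v N_u x - P x ** transpose (N_v x)"
    by (simp add: mm P pd_metric_matrix[OF assms] matrix_mul_assoc[symmetric] Q_metric[OF assms])
  also have "\<dots> = pd_u N_v x - Q x ** transpose (N_u x)"
    by (rule integrability[OF assms])
  also have "\<dots> = (pd_u Q x + Q x ** P x) ** metric_matrix x"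
    by (simp add: mm Q pd_metric_matrix[OF assms] matrix_mul_assoc[symmetric] P_metric[OF assms])
  finally have "(pd_v P x + P x ** Q x) ** metric_matrix x ** metric_inverse x =
      (pd_u Q x + Q x ** P x) ** metric_matrix x ** metric_inverse x" by simp
  then show ?thesis
    by (simp add: matrix_mul_assoc[symmetric] metric_inverse[OF assms])
qed

end

section \<open>Frames with a null vector\<close>

lemma frame_nondegenerate:
  assumes "det F \<noteq> 0" "\<And>i. lor (F $ i) r = 0"
  shows "r = 0"
proof -
  have "det S_mat = -1" by (simp add: det_3 S_mat_def)
  then have "invertible (F ** S_mat)" using assms(1) by (simp add: invertible_det_nz det_mul)
  moreover have "(F ** S_mat) *v r = 0"
    using assms(2) by (simp add: vec_eq_iff forall_3 matrix_vector_mult_def matrix_matrix_mult_def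
        sum_3 S_mat_def lor_def)
  ultimately show ?thesis
    using matrix_left_invertible_ker[of "F ** S_mat"] by (auto simp: invertible_def)
qed

lemma lor_lor_cross: "lor (lor_cross a b) w = cross3 a b \<bullet> w"
  by (simp add: lor_cross_def lor_def S_mat_def matrix_vector_mult_def sum_3 inner_vec_def)

lemma null_frame_det:
  assumes gram: "F ** S_mat ** transpose F = mat3 e 0 0 0 g 1 0 1 0"
  shows "(det F)\<^sup>2 = e"
proof -
  have "det S_mat = -1" by (simp add: det_3 S_mat_def)
  then have "det (F ** S_mat ** transpose F) = - (det F)\<^sup>2"
    by (simp add: det_mul det_transpose power2_eq_square)
  moreover have "det (mat3 e 0 0 0 g 1 0 1 0) = - e" by (simp add: det_3)
  ultimately show ?thesis using gram by simp
qed

text \<open>Both sides have the same products with the three rows: they are orthogonal to the first two, and the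
product with the third is the determinant.\<close>

lemma null_frame_cross:
  assumes gram: "F ** S_mat ** transpose F = mat3 e 0 0 0 g 1 0 1 0" and "e > 0"
  shows "lor_cross (F $ 1) (F $ 2) = det F *\<^sub>R (F $ 2 - g *\<^sub>R F $ 3)"
proof -
  have l: "lor (F $ i) (F $ j) = mat3 e 0 0 0 g 1 0 1 0 $ i $ j" for i j
    using gram_matrix_nth[of F F i j] gram by simp
  have "det F \<noteq> 0" using null_frame_det[OF gram] \<open>e > 0\<close> by auto
  moreover have "lor (F $ i) (lor_cross (F $ 1) (F $ 2) - det F *\<^sub>R (F $ 2 - g *\<^sub>R F $ 3)) = 0" for i
  proof -
    have "lor (F $ 3) (lor_cross (F $ 1) (F $ 2)) = det F"
      unfolding lor_commute[of "F $ 3"] lor_lor_cross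
      by (simp add: cross3_simps det_3 inner_vec_def sum_3)
    moreover have "lor (F $ 1) (lor_cross (F $ 1) (F $ 2)) = 0" "lor (F $ 2) (lor_cross (F $ 1) (F $ 2)) = 0"
      unfolding lor_commute[of _ "lor_cross _ _"] lor_lor_cross by (simp_all add: dot_cross_self)
    ultimately show ?thesis
      using exhaust_3[of i] by (auto simp: lor.diff_right lor.scaleR_right l)
  qed
  ultimately have "lor_cross (F $ 1) (F $ 2) - det F *\<^sub>R (F $ 2 - g *\<^sub>R F $ 3) = 0"
    by (rule frame_nondegenerate)
  then show ?thesis by simp
qed

context fundamental_data
begin

text \<open>With \<open>W = h\<^sub>1 P + h\<^sub>2 Q\<close>, both \<open>A = F S F\<^sup>T\<close> and \<open>A = \<Gamma> = metric_matrix\<close> have the derivative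
\<open>W A + A W\<^sup>T\<close>, for \<open>\<Gamma>\<close> because \<open>W \<Gamma> = h\<^sub>1 N_u + h\<^sub>2 N_v\<close>. So their difference solves a homogeneous
linear system.\<close>

lemma gram_of_solution:
  assumes "connected D" "x0 \<in> D"
    and der: "\<And>x. x \<in> D \<Longrightarrow> (F has_derivative (\<lambda>h. (fst h *\<^sub>R P x + snd h *\<^sub>R Q x) ** F x)) (at x)"
    and init: "F x0 ** S_mat ** transpose (F x0) = metric_matrix x0"
    and "x \<in> D"
  shows "F x ** S_mat ** transpose (F x) = metric_matrix x"
proof -
  note bbm = bounded_bilinear_matrix_mult
  note mm = bounded_bilinear.add_left[OF bbm] bounded_bilinear.add_right[OF bbm]
    bounded_bilinear.diff_left[OF bbm] bounded_bilinear.diff_right[OF bbm]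
    bounded_bilinear.scaleR_left[OF bbm] bounded_bilinear.scaleR_right[OF bbm]
  interpret tr: bounded_linear "transpose :: real^3^3 \<Rightarrow> real^3^3" by (rule bounded_linear_transpose)
  define \<Delta> where "\<Delta> x = F x ** S_mat ** transpose (F x) - metric_matrix x" for x
  have "\<Delta> x = 0"
  proof (rule matrix_system_zero[OF open_D assms(1,2)])
    show "\<Delta> x0 = 0" using init by (simp add: \<Delta>_def)
    show "continuous_on D P" "continuous_on D Q"
      using smooth_PQ by (auto intro: smooth_on_imp_continuous_on)
    then show "continuous_on D (\<lambda>x. transpose (P x))" "continuous_on D (\<lambda>x. transpose (Q x))"
      by (auto intro: bounded_linear.continuous_on[OF bounded_linear_transpose])
    show "x \<in> D" by fact
    fix x assume x: "x \<in> D"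
    have FS: "((\<lambda>x. F x ** S_mat) has_derivative (\<lambda>h. (fst h *\<^sub>R P x + snd h *\<^sub>R Q x) ** F x ** S_mat)) (at x)"
      by (rule bounded_linear.has_derivative[OF bounded_bilinear.bounded_linear_left[OF bbm] der[OF x]])
    have Ft: "((\<lambda>x. transpose (F x)) has_derivative (\<lambda>h. transpose ((fst h *\<^sub>R P x + snd h *\<^sub>R Q x) ** F x))) (at x)"
      by (rule tr.has_derivative[OF der[OF x]])
    have PG: "P x ** metric_matrix x = N_u x" "metric_matrix x ** transpose (P x) = transpose (N_u x)"
      and QG: "Q x ** metric_matrix x = N_v x" "metric_matrix x ** transpose (Q x) = transpose (N_v x)"
      using P_metric[OF x] Q_metric[OF x] matrix_transpose_mul[of "P x" "metric_matrix x"]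
        matrix_transpose_mul[of "Q x" "metric_matrix x"] by (simp_all add: transpose_metric_matrix)
    have "(\<Delta> has_derivative (\<lambda>h. F x ** S_mat ** transpose ((fst h *\<^sub>R P x + snd h *\<^sub>R Q x) ** F x) +
        (fst h *\<^sub>R P x + snd h *\<^sub>R Q x) ** F x ** S_mat ** transpose (F x) -
        (fst h *\<^sub>R pd_u metric_matrix x + snd h *\<^sub>R pd_v metric_matrix x))) (at x)"
      unfolding \<Delta>_def[abs_def]
      by (intro has_derivative_diff bounded_bilinear.FDERIV[OF bbm FS Ft]
          smooth_on_has_derivative_pd[OF open_D smooth_matrices(1) x])
    then show "(\<Delta> has_derivative (\<lambda>h. (fst h *\<^sub>R P x + snd h *\<^sub>R Q x) ** \<Delta> x +
        \<Delta> x ** (fst h *\<^sub>R transpose (P x) + snd h *\<^sub>R transpose (Q x)))) (at x)"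
      by (rule has_derivative_eq_rhs)
        (simp add: fun_eq_iff \<Delta>_def mm pd_metric_matrix[OF x] matrix_transpose_mul tr.add tr.scaleR
          PG QG matrix_mul_assoc algebra_simps)
  qed
  then show ?thesis by (simp add: \<Delta>_def)
qed

end

section \<open>Existence\<close>

text \<open>On the compact closed ball an injective continuous map is an embedding.\<close>

lemma continuous_injective_embedding_ball:
  fixes f :: "'a::heine_borel \<Rightarrow> 'b::real_normed_vector"
  assumes "continuous_on (cball x r) f" "inj_on f (cball x r)"
  shows "embedding_map (top_of_set (ball x r)) euclidean f"
proof -
  have "embedding_map (top_of_set (cball x r)) euclidean f"
    by (rule continuous_imp_embedding_map) (use assms in \<open>auto simp: compact_space_subtopology\<close>)
  moreover have "subtopology (top_of_set (cball x r)) (ball x r) = top_of_set (ball x r)"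
    by (auto simp: subtopology_subtopology Int_absorb1 inf.absorb2 ball_subset_cball)
  then have "embedding_map (top_of_set (ball x r)) (top_of_set (cball x r)) id"
    by (simp add: embedding_map_def homeomorphic_map_id)
  ultimately have "embedding_map (top_of_set (ball x r)) euclidean (f \<circ> id)"
    by (intro embedding_map_compose)
  then show ?thesis by simp
qed

text \<open>The radius is halved to pass from local injectivity to a compact ball inside the region of injectivity.\<close>

lemma immersion_locally_embedding:
  assumes imm: "immersed_surface D f" and "x \<in> D"
  obtains r where "r > 0" "ball x r \<subseteq> D" "embedded_surface (ball x r) f"
proof -
  have D: "open D" "smooth_on D f" and inj: "\<And>y. y \<in> D \<Longrightarrow> inj (frechet_derivative f (at y))"
    using imm by (auto simp: immersed_surface_def)
  note der = smooth_on_has_derivative[OF D]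
  have lin: "linear (frechet_derivative f (at x))"
    by (rule has_derivative_linear[OF der[OF \<open>x \<in> D\<close>]])
  obtain g' where g': "linear g'" "g' \<circ> frechet_derivative f (at x) = id"
    using linear_injective_left_inverse[OF lin inj[OF \<open>x \<in> D\<close>]] by blast
  have close: "\<exists>d>0. \<forall>y. dist x y < d \<longrightarrow>
      onorm (\<lambda>v. frechet_derivative f (at y) v - frechet_derivative f (at x) v) < e" if "e > 0" for e
  proof -
    have "continuous (at x) (pd_u f)" "continuous (at x) (pd_v f)"
      using smooth_on_imp_continuous_on[OF smooth_on_pd(1)[OF D(2)]]
        smooth_on_imp_continuous_on[OF smooth_on_pd(2)[OF D(2)]] D(1) \<open>x \<in> D\<close>
      by (simp_all add: continuous_on_eq_continuous_at)
    then obtain d1 d2 where d: "d1 > 0" "d2 > 0"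
      "\<And>y. dist y x < d1 \<Longrightarrow> dist (pd_u f y) (pd_u f x) < e / 3"
      "\<And>y. dist y x < d2 \<Longrightarrow> dist (pd_v f y) (pd_v f x) < e / 3"
      unfolding continuous_at_eps_delta using \<open>e > 0\<close> by (metis zero_less_divide_iff zero_less_numeral)
    obtain d3 where d3: "d3 > 0" "ball x d3 \<subseteq> D" using D(1) \<open>x \<in> D\<close> openE by blast
    have "onorm (\<lambda>v. frechet_derivative f (at y) v - frechet_derivative f (at x) v) < e"
      if y: "dist x y < min d1 (min d2 d3)" for y
    proof -
      have "y \<in> D" using y d3 by auto
      have "onorm (\<lambda>v. frechet_derivative f (at y) v - frechet_derivative f (at x) v) \<le> e / 3 + e / 3"
      proof (rule onorm_bound)
        fix v :: "real \<times> real"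
        have "frechet_derivative f (at y) v - frechet_derivative f (at x) v =
            fst v *\<^sub>R (pd_u f y - pd_u f x) + snd v *\<^sub>R (pd_v f y - pd_v f x)"
          by (simp add: frechet_derivative_pd[OF D \<open>y \<in> D\<close>] frechet_derivative_pd[OF D \<open>x \<in> D\<close>] algebra_simps)
        also have "norm \<dots> \<le> norm (fst v) * norm (pd_u f y - pd_u f x) + norm (snd v) * norm (pd_v f y - pd_v f x)"
          by (rule norm_triangle_le) simp
        also have "\<dots> \<le> norm v * (e / 3) + norm v * (e / 3)"
          using norm_fst_le[of "fst v" "snd v"] norm_snd_le[of "snd v" "fst v"] d(3,4)[of y] y
          by (intro add_mono mult_mono) (auto simp: dist_norm norm_minus_commute less_imp_le)
        finally show "norm (frechet_derivative f (at y) v - frechet_derivative f (at x) v) \<le> (e / 3 + e / 3) * norm v"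
          by (simp add: algebra_simps)
      qed (use \<open>e > 0\<close> in simp)
      then show ?thesis using \<open>e > 0\<close> by simp
    qed
    then show ?thesis using d d3 by (intro exI[of _ "min d1 (min d2 d3)"]) auto
  qed
  obtain r where r: "r > 0" "ball x r \<subseteq> D" "inj_on f (ball x r)"
    using has_derivative_locally_injective[OF \<open>x \<in> D\<close> D(1) _ g'(2) der close] g'(1)
    by (metis linear_conv_bounded_linear)
  have sub: "cball x (r / 2) \<subseteq> ball x r" "ball x (r / 2) \<subseteq> D" using r by auto
  have "embedding_map (top_of_set (ball x (r / 2))) euclidean f"
  proof (rule continuous_injective_embedding_ball)
    show "continuous_on (cball x (r / 2)) f"
      using smooth_on_imp_continuous_on[OF D(2)] sub(1) r(2) by (meson continuous_on_subset subset_trans)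
    show "inj_on f (cball x (r / 2))"
      by (rule inj_on_subset[OF r(3) sub(1)])
  qed
  moreover have "smooth_on (ball x (r / 2)) f"
  proof -
    have "C_k_on k S f" if "C_k_on k D f" "S \<subseteq> D" "open S" for k S and f :: "real \<times> real \<Rightarrow> real^3"
      using that
      by (induction k arbitrary: f) (auto intro: continuous_on_subset differentiable_on_subset)
    then show ?thesis using D(2) sub(2) unfolding smooth_on_def by blast
  qed
  ultimately have "embedded_surface (ball x (r / 2)) f"
    using inj sub(2) by (auto simp: embedded_surface_def immersed_surface_def)
  then show ?thesis using that[of "r / 2"] r(1) sub(2) by auto
qed

context fundamental_data
begin

definition solves_frame_system :: "(real \<times> real \<Rightarrow> real^3^3) \<Rightarrow> bool" where
  "solves_frame_system F \<longleftrightarrow>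
    (\<forall>x\<in>D. (F has_derivative (\<lambda>h. (fst h *\<^sub>R P x + snd h *\<^sub>R Q x) ** F x)) (at x)) \<and>
    (\<forall>x\<in>D. F x ** S_mat ** transpose (F x) = metric_matrix x)"

lemma frame_lor:
  fixes F :: "real^3^3"
  assumes "F ** S_mat ** transpose F = metric_matrix x"
  shows "lor (F $ i) (F $ j) = metric_matrix x $ i $ j"
  using gram_matrix_nth[of F F i j] assms by simp

lemma frame_combination:
  fixes F A :: "real^3^3"
  assumes "F ** S_mat ** transpose F = metric_matrix x"
  shows "lor ((A ** F) $ i) (F $ j) = (A ** metric_matrix x) $ i $ j"
  using gram_matrix_nth[of "A ** F" F i j] assms by (simp add: matrix_mul_assoc[symmetric])

text \<open>The determinant is continuous with square \<open>E > 0\<close>, so its sign is constant on the connected set \<open>D\<close>;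
it is the sign in the definition of an L-Gauss map.\<close>

lemma frame_det_sign:
  assumes "connected D" and F: "solves_frame_system F"
  obtains \<epsilon> where "\<epsilon> \<in> {1, -1}" "\<And>x. x \<in> D \<Longrightarrow> det (F x) = \<epsilon> * sqrt (E x)"
proof -
  have sq: "(det (F x))\<^sup>2 = E x" if "x \<in> D" for x
    using null_frame_det F that by (simp add: solves_frame_system_def metric_matrix_def)
  have contF: "continuous_on D F"
    using F unfolding solves_frame_system_def
    by (meson continuous_at_imp_continuous_on has_derivative_continuous)
  have "continuous_on D (\<lambda>x. det (F x))"
    unfolding det_3 by (intro continuous_intros contF)
  then have conn: "connected ((\<lambda>x. det (F x)) ` D)"
    using assms(1) by (rule connected_continuous_image)
  have nz: "det (F x) \<noteq> 0" if "x \<in> D" for x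
    using sq[OF that] E_pos[OF that] by auto
  have same: "det (F y) > 0" if "x \<in> D" "y \<in> D" "det (F x) > 0" for x y
  proof (rule ccontr)
    assume "\<not> det (F y) > 0"
    then have "0 \<in> (\<lambda>x. det (F x)) ` D"
      using connectedD_interval[OF conn, of "det (F y)" "det (F x)" 0] that by auto
    then show False using nz by auto
  qed
  have root: "\<bar>det (F x)\<bar> = sqrt (E x)" if "x \<in> D" for x
    using sq[OF that] by (metis real_sqrt_abs)
  show ?thesis
  proof (cases "\<exists>x\<in>D. det (F x) > 0")
    case True
    then have "det (F x) > 0" if "x \<in> D" for x using same that by blast
    then show ?thesis using that[of 1] root by force
  next
    case False
    then show ?thesis using that[of "-1"] root by force
  qed
qed

text \<open>All geometric properties are statements about products of rows of the frame: linear independence of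
\<open>f\<^sub>u\<close> and \<open>f\<^sub>v\<close> is tested against \<open>\<psi>\<close> and \<open>f\<^sub>u\<close>, and the second fundamental form is the last column of
\<open>P \<Gamma> = N_u\<close> and \<open>Q \<Gamma> = N_v\<close>.\<close>

lemma surface_of_frame:
  assumes "connected D" and F: "solves_frame_system F"
    and f: "\<And>x. x \<in> D \<Longrightarrow> (f has_derivative (\<lambda>h. fst h *\<^sub>R F x $ 1 + snd h *\<^sub>R F x $ 2)) (at x)"
  shows "immersed_surface D f" "L_Gauss_map D f (\<lambda>x. F x $ 3)"
    "\<And>x. x \<in> D \<Longrightarrow> first_ff f x = coeff_form (E x) 0 (G x)"
    "\<And>x. x \<in> D \<Longrightarrow> second_ff f (\<lambda>x. F x $ 3) x = coeff_form (X x) (Y x) (Z x)"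
proof -
  have derF: "(F has_derivative (\<lambda>h. (fst h *\<^sub>R P x + snd h *\<^sub>R Q x) ** F x)) (at x)"
    and gram: "F x ** S_mat ** transpose (F x) = metric_matrix x" if "x \<in> D" for x
    using F that by (auto simp: solves_frame_system_def)
  have smF: "smooth_on D F" by (rule smooth_on_solution[OF open_D smooth_PQ derF])
  then have smFi: "smooth_on D (\<lambda>x. F x $ i)" for i
    by (rule smooth_on_linear[OF bounded_linear_vec_nth open_D])
  have l: "lor (F x $ i) (F x $ j) = metric_matrix x $ i $ j" if "x \<in> D" for x i j
    by (rule frame_lor[OF gram[OF that]])
  have fd: "frechet_derivative f (at x) = (\<lambda>h. fst h *\<^sub>R F x $ 1 + snd h *\<^sub>R F x $ 2)" if "x \<in> D" for x
    using frechet_derivative_at[OF f[OF that]] by simp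
  have "C_k_on (Suc k) D f" for k
  proof (rule C_k_on_SucI[OF open_D f])
    fix h :: "real \<times> real"
    have "smooth_on D (\<lambda>x. fst h *\<^sub>R F x $ 1 + snd h *\<^sub>R F x $ 2)"
      by (intro smooth_on_add smooth_on_linear[OF bounded_linear_scaleR_right] smFi open_D)
    then show "C_k_on k D (\<lambda>x. fst h *\<^sub>R F x $ 1 + snd h *\<^sub>R F x $ 2)" by (simp add: smooth_on_def)
  qed
  then have smf: "smooth_on D f"
    unfolding smooth_on_def using C_k_on_SucD[OF open_D] by blast
  have pdf: "pd_u f x = F x $ 1" "pd_v f x = F x $ 2" if "x \<in> D" for x
    using fd[OF that] by (simp_all add: pd_u_def pd_v_def)
  have "inj (frechet_derivative f (at x))" if x: "x \<in> D" for x
  proof -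
    have "h = 0" if "frechet_derivative f (at x) h = 0" for h
    proof -
      have 0: "fst h *\<^sub>R F x $ 1 + snd h *\<^sub>R F x $ 2 = 0" using that fd[OF x] by simp
      have "lor (fst h *\<^sub>R F x $ 1 + snd h *\<^sub>R F x $ 2) (F x $ 3) = snd h"
        "lor (fst h *\<^sub>R F x $ 1 + snd h *\<^sub>R F x $ 2) (F x $ 1) = fst h * E x"
        by (simp_all add: lor.add_left lor.scaleR_left l[OF x] metric_matrix_def)
      then have "snd h = 0" "fst h = 0" unfolding 0 using E_pos[OF x] by (auto simp: lor.zero_left)
      then show ?thesis by (simp add: prod_eq_iff)
    qed
    then show ?thesis
      using linear_injective_0[OF has_derivative_linear[OF smooth_on_has_derivative[OF open_D smf x]]] by blast
  qed
  then show "immersed_surface D f"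
    using assms(1) open_D smf by (simp add: immersed_surface_def)
  show ff: "first_ff f x = coeff_form (E x) 0 (G x)" if "x \<in> D" for x
    using fd[OF that] l[OF that]
    by (simp add: fun_eq_iff first_ff_def coeff_form_def lor.add_left lor.add_right
        lor.scaleR_left lor.scaleR_right metric_matrix_def algebra_simps)
  show "L_Gauss_map D f (\<lambda>x. F x $ 3)"
  proof -
    obtain \<epsilon> where \<epsilon>: "\<epsilon> \<in> {1, -1}" "\<And>x. x \<in> D \<Longrightarrow> det (F x) = \<epsilon> * sqrt (E x)"
      using frame_det_sign[OF assms(1) F] by metis
    have "F x $ 3 \<in> lightcone" if "x \<in> D" for x
      using l[OF that, of 3 3] l[OF that, of 2 3]
      by (auto simp: lightcone_def metric_matrix_def lor.zero_right)
    moreover have "lor_cross (pd_u f x) (pd_v f x) =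
        (\<epsilon> * sqrt (first_ff f x e_u e_u)) *\<^sub>R (pd_v f x - first_ff f x e_v e_v *\<^sub>R F x $ 3)" if "x \<in> D" for x
      using null_frame_cross[OF gram[OF that, unfolded metric_matrix_def] E_pos[OF that]] \<epsilon>(2)[OF that]
      by (simp add: ff[OF that] pdf[OF that])
    ultimately show ?thesis using \<epsilon>(1) smFi by (auto simp: L_Gauss_map_def)
  qed
  show "second_ff f (\<lambda>x. F x $ 3) x = coeff_form (X x) (Y x) (Z x)" if x: "x \<in> D" for x
  proof -
    have pdF: "pd_u F x = P x ** F x" "pd_v F x = Q x ** F x"
      using pd_has_derivative[OF derF[OF x]] by simp_all
    have nth: "pd_u (\<lambda>x. F x $ i) x = (P x ** F x) $ i" "pd_v (\<lambda>x. F x $ i) x = (Q x ** F x) $ i" for i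
      using pd_linear[OF bounded_linear_vec_nth open_D smF x] pdF by simp_all
    have "pd_u (pd_u f) x = (P x ** F x) $ 1" "pd_v (pd_u f) x = (Q x ** F x) $ 1"
      "pd_v (pd_v f) x = (Q x ** F x) $ 2"
      using pd_cong[OF open_D x pdf(1)] pd_cong[OF open_D x pdf(2)] nth by simp_all
    then show ?thesis
      unfolding second_ff_def
      by (simp add: frame_combination[OF gram[OF x]] P_metric[OF x] Q_metric[OF x] N_u_def N_v_def)
  qed
qed

end

context integrable_data
begin

lemma frame_exists:
  assumes "simply_connected D" "x0 \<in> D"
  obtains F where "solves_frame_system F"
proof -
  have conn: "connected D" using assms(1) by (rule simply_connected_imp_connected)
  (* rows: a multiple of the first unit vector, n + (G/2) psi, and psi, for the null vectors
     n = (0, 1, 1) and psi = (0, 1/2, -1/2), whose product is 1 *)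
  define F0 :: "real^3^3" where
    "F0 = mat3 (sqrt (E x0)) 0 0 0 (1 + G x0 / 4) (1 - G x0 / 4) 0 (1 / 2) (- 1 / 2)"
  have gram0: "F0 ** S_mat ** transpose F0 = metric_matrix x0"
    unfolding matrix_eq_entries forall_3 gram_matrix_nth
    using E_pos[OF assms(2)] by (simp add: F0_def metric_matrix_def lor_def field_simps)
  have flat': "pd_v P x ** y + P x ** (Q x ** y) = pd_u Q x ** y + Q x ** (P x ** y)"
    if "x \<in> D" for x and y :: "real^3^3"
    using arg_cong[OF frame_system_flat[OF that], of "\<lambda>A. A ** y"]
    by (simp add: bounded_bilinear.add_left[OF bounded_bilinear_matrix_mult] matrix_mul_assoc)
  obtain F where F: "F x0 = F0"
    "\<And>x. x \<in> D \<Longrightarrow> (F has_derivative (\<lambda>h. (fst h *\<^sub>R P x + snd h *\<^sub>R Q x) ** F x)) (at x)"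
    using flat_bilinear_system_exists[OF bounded_bilinear_matrix_mult open_D assms smooth_PQ flat', of F0]
    by blast
  have "F x ** S_mat ** transpose (F x) = metric_matrix x" if "x \<in> D" for x
    by (rule gram_of_solution[OF conn assms(2) F(2) _ that]) (simp_all add: F(1) gram0)
  with F(2) have "solves_frame_system F" unfolding solves_frame_system_def by blast
  then show ?thesis by (rule that)
qed

text \<open>The first row of \<open>N_v\<close> equals the second row of \<open>N_u\<close>, so \<open>(f\<^sub>u)\<^sub>v = (f\<^sub>v)\<^sub>u\<close> and the first two rows of
the frame have a common primitive.\<close>

lemma surface_exists:
  assumes "simply_connected D" "x0 \<in> D"
  obtains f \<psi> where "immersed_surface D f" "L_Gauss_map D f \<psi>"
    "\<forall>x\<in>D. first_ff f x = coeff_form (E x) 0 (G x)"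
    "\<forall>x\<in>D. second_ff f \<psi> x = coeff_form (X x) (Y x) (Z x)"
proof -
  obtain F where F: "solves_frame_system F" using frame_exists[OF assms] .
  then have derF: "(F has_derivative (\<lambda>h. (fst h *\<^sub>R P x + snd h *\<^sub>R Q x) ** F x)) (at x)" if "x \<in> D" for x
    using that by (auto simp: solves_frame_system_def)
  have smF: "smooth_on D F" by (rule smooth_on_solution[OF open_D smooth_PQ derF])
  have closed: "pd_v (\<lambda>x. F x $ 1) x = pd_u (\<lambda>x. F x $ 2) x" if x: "x \<in> D" for x
  proof -
    have "pd_v (\<lambda>x. F x $ 1) x = (Q x ** F x) $ 1" "pd_u (\<lambda>x. F x $ 2) x = (P x ** F x) $ 2"
      using pd_linear[OF bounded_linear_vec_nth open_D smF x] pd_has_derivative[OF derF[OF x]] by simp_all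
    moreover have "Q x $ 1 = P x $ 2"
      by (simp add: vec_eq_iff P_def Q_def N_u_def N_v_def matrix_matrix_mult_def sum_3)
    ultimately show ?thesis by (simp add: vec_eq_iff matrix_matrix_mult_def)
  qed
  obtain f where f: "\<And>x. x \<in> D \<Longrightarrow> (f has_derivative (\<lambda>h. fst h *\<^sub>R F x $ 1 + snd h *\<^sub>R F x $ 2)) (at x)"
    using poincare_lemma[OF open_D assms(1) smooth_on_linear[OF bounded_linear_vec_nth open_D smF]
        smooth_on_linear[OF bounded_linear_vec_nth open_D smF] closed] by blast
  note surface_of_frame[OF simply_connected_imp_connected[OF assms(1)] F f]
  then show ?thesis by (intro that ballI)
qed

end

section \<open>Uniqueness\<close>

context fundamental_data
begin

text \<open>The system acts on the frame from the left, so right multiplication by a constant matrix \<open>C\<close> preserves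
solutions. Choosing \<open>C\<close> to match the frames at one point makes them equal everywhere; on the rows \<open>C\<close>
acts as its transpose.\<close>

lemma solves_frame_system_unique:
  assumes "connected D" "x0 \<in> D" and F: "solves_frame_system F" and F': "solves_frame_system F'"
  obtains A where "lor_orthogonal A" "\<And>x i. x \<in> D \<Longrightarrow> F' x $ i = A *v (F x $ i)"
proof -
  note bbm = bounded_bilinear_matrix_mult
  have derF: "(F has_derivative (\<lambda>h. (fst h *\<^sub>R P x + snd h *\<^sub>R Q x) ** F x)) (at x)"
    and derF': "(F' has_derivative (\<lambda>h. (fst h *\<^sub>R P x + snd h *\<^sub>R Q x) ** F' x)) (at x)"
    and gram: "F x ** S_mat ** transpose (F x) = metric_matrix x"
    and gram': "F' x ** S_mat ** transpose (F' x) = metric_matrix x" if "x \<in> D" for x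
    using F F' that by (auto simp: solves_frame_system_def)
  have "det (F x0) \<noteq> 0"
    using null_frame_det[OF gram[OF assms(2), unfolded metric_matrix_def]] E_pos[OF assms(2)] by auto
  then obtain B where B: "F x0 ** B = mat 1" "B ** F x0 = mat 1"
    by (auto simp: invertible_det_nz[symmetric] invertible_def)
  define C where "C = B ** F' x0"
  have init: "F x0 ** C = F' x0" using B by (simp add: C_def matrix_mul_assoc)
  have eq: "F' x = F x ** C" if "x \<in> D" for x
  proof -
    have "F' x - F x ** C = 0"
    proof (rule matrix_system_zero[where F = "\<lambda>x. F' x - F x ** C", OF open_D assms(1,2) _ _ _
          continuous_on_const[of _ 0] continuous_on_const[of _ 0] _ that])
      show "F' x0 - F x0 ** C = 0" using init by simp
      show "continuous_on D P" "continuous_on D Q"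
        using smooth_PQ by (auto intro: smooth_on_imp_continuous_on)
      show "((\<lambda>x. F' x - F x ** C) has_derivative (\<lambda>h. (fst h *\<^sub>R P x + snd h *\<^sub>R Q x) ** (F' x - F x ** C) +
          (F' x - F x ** C) ** (fst h *\<^sub>R 0 + snd h *\<^sub>R 0))) (at x)" if "x \<in> D" for x
        by (rule has_derivative_eq_rhs[OF has_derivative_diff[OF derF'[OF that]
              bounded_linear.has_derivative[OF bounded_bilinear.bounded_linear_left[OF bbm] derF[OF that]]]])
          (simp add: fun_eq_iff bounded_bilinear.diff_right[OF bbm] matrix_mul_assoc
            bounded_bilinear.zero_right[OF bbm])
    qed
    then show ?thesis by simp
  qed
  have "C ** S_mat ** transpose C = S_mat"
  proof -
    have "F x0 ** (C ** S_mat ** transpose C) ** transpose (F x0) = F x0 ** S_mat ** transpose (F x0)"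
      using gram[OF assms(2)] gram'[OF assms(2)]
      by (simp add: init[symmetric] matrix_transpose_mul matrix_mul_assoc)
    then have "B ** (F x0 ** (C ** S_mat ** transpose C) ** transpose (F x0)) ** transpose B =
        B ** (F x0 ** S_mat ** transpose (F x0)) ** transpose B" by simp
    moreover have "transpose (F x0) ** transpose B = mat 1"
      using B by (simp add: matrix_transpose_mul[symmetric])
    ultimately show ?thesis
      by (simp add: matrix_mul_assoc B) (simp add: matrix_mul_assoc[symmetric])
  qed
  then have "lor_orthogonal (transpose C)" by (simp add: lor_orthogonal_def)
  moreover have "F' x $ i = transpose C *v (F x $ i)" if "x \<in> D" for x i
    unfolding eq[OF that]
    by (simp add: vec_eq_iff matrix_matrix_mult_def matrix_vector_mult_def transpose_def mult.commute)
  ultimately show ?thesis by (rule that)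
qed

lemma zero_on_dense:
  fixes \<phi> :: "real \<times> real \<Rightarrow> real"
  assumes dense: "D \<subseteq> closure {y \<in> D. G y \<noteq> 0}"
    and cont: "continuous_on D \<phi>" and zero: "\<forall>x\<in>D. G x \<noteq> 0 \<longrightarrow> \<phi> x = 0" and "x \<in> D"
  shows "\<phi> x = 0"
proof (rule ccontr)
  assume "\<phi> x \<noteq> 0"
  have "open (D \<inter> \<phi> -` (- {0}))"
    using cont open_D by (intro continuous_open_preimage) auto
  moreover have "x \<in> D \<inter> \<phi> -` (- {0})" "x \<in> closure {y \<in> D. G y \<noteq> 0}"
    using dense \<open>x \<in> D\<close> \<open>\<phi> x \<noteq> 0\<close> by auto
  ultimately have "(D \<inter> \<phi> -` (- {0})) \<inter> {y \<in> D. G y \<noteq> 0} \<noteq> {}"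
    using open_Int_closure_eq_empty by blast
  with zero show False by blast
qed

text \<open>The vector product is orthogonal to \<open>f\<^sub>u\<close> and \<open>f\<^sub>v\<close>. Pairing the defining equation of \<open>\<psi>\<close> with these
vectors gives both claims multiplied by \<open>G\<close>. The zeros of \<open>G\<close> are limits of points where one
can divide.\<close>

lemma null_transversal:
  assumes dense: "D \<subseteq> closure {y \<in> D. G y \<noteq> 0}"
    and smf: "smooth_on D f" and L: "L_Gauss_map D f \<psi>"
    and ff_D: "\<forall>x\<in>D. first_ff f x = coeff_form (E x) 0 (G x)"
    and x: "x \<in> D"
  shows "lor (\<psi> x) (pd_u f x) = 0" "lor (\<psi> x) (pd_v f x) = 1"
proof -
  note ff = ff_D[rule_format]
  obtain \<epsilon> where \<epsilon>: "\<epsilon> \<in> {1, -1::real}" and cross: "\<And>x. x \<in> D \<Longrightarrow> lor_cross (pd_u f x) (pd_v f x) =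
      (\<epsilon> * sqrt (first_ff f x e_u e_u)) *\<^sub>R (pd_v f x - first_ff f x e_v e_v *\<^sub>R \<psi> x)"
    using L unfolding L_Gauss_map_def by blast
  have fl: "lor (pd_v f x) (pd_u f x) = 0" "lor (pd_v f x) (pd_v f x) = G x" if "x \<in> D" for x
    using ff[OF that] by (simp_all add: first_ff_def[abs_def] pd_u_def pd_v_def fun_eq_iff)
  have eq: "G x * lor (\<psi> x) (pd_u f x) = 0" "G x * (lor (\<psi> x) (pd_v f x) - 1) = 0" if "x \<in> D" for x
  proof -
    define k where "k = \<epsilon> * sqrt (E x)"
    have "k \<noteq> 0" using \<epsilon> E_pos[OF that] by (auto simp: k_def)
    have c: "lor_cross (pd_u f x) (pd_v f x) = k *\<^sub>R (pd_v f x - G x *\<^sub>R \<psi> x)"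
      using cross[OF that] ff[OF that] by (simp add: k_def)
    have "lor (lor_cross (pd_u f x) (pd_v f x)) (pd_u f x) = 0"
      "lor (lor_cross (pd_u f x) (pd_v f x)) (pd_v f x) = 0"
      unfolding lor_lor_cross by (simp_all add: dot_cross_self)
    then show "G x * lor (\<psi> x) (pd_u f x) = 0" "G x * (lor (\<psi> x) (pd_v f x) - 1) = 0"
      unfolding c using \<open>k \<noteq> 0\<close>
      by (simp_all add: lor.scaleR_left lor.diff_left fl[OF that] algebra_simps)
  qed
  have "continuous_on D \<psi>" "continuous_on D (pd_u f)" "continuous_on D (pd_v f)"
    using L smooth_on_pd[OF smf] by (auto simp: L_Gauss_map_def intro: smooth_on_imp_continuous_on)
  then have c: "continuous_on D (\<lambda>x. lor (\<psi> x) (pd_u f x))" "continuous_on D (\<lambda>x. lor (\<psi> x) (pd_v f x) - 1)"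
    by (auto intro!: lor.continuous_on continuous_intros)
  have "lor (\<psi> x) (pd_u f x) = 0"
    by (rule zero_on_dense[OF dense c(1) _ x]) (use eq in auto)
  moreover have "lor (\<psi> x) (pd_v f x) - 1 = 0"
    by (rule zero_on_dense[OF dense c(2) _ x]) (use eq in auto)
  ultimately show "lor (\<psi> x) (pd_u f x) = 0" "lor (\<psi> x) (pd_v f x) = 1" by simp_all
qed

text \<open>Differentiating the products of the rows determines the symmetric parts of the matrices \<open>a\<close> and \<open>b\<close> of
products of the differentiated rows with the rows. The second fundamental form gives their last columns,
and \<open>f\<^sub>u\<^sub>v = f\<^sub>v\<^sub>u\<close> identifies the second row of \<open>a\<close> with the first row of \<open>b\<close>. These linear equations have
\<open>N_u\<close> and \<open>N_v\<close> as their only solution.\<close>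

lemma frame_of_surface:
  assumes dense: "D \<subseteq> closure {y \<in> D. G y \<noteq> 0}"
    and smf: "smooth_on D f" and L: "L_Gauss_map D f \<psi>"
    and ff_D: "\<forall>x\<in>D. first_ff f x = coeff_form (E x) 0 (G x)"
    and sf_D: "\<forall>x\<in>D. second_ff f \<psi> x = coeff_form (X x) (Y x) (Z x)"
  shows "solves_frame_system (\<lambda>x. vector [pd_u f x, pd_v f x, \<psi> x])"
proof -
  note ff = ff_D[rule_format] and sf = sf_D[rule_format]
  define F :: "real \<times> real \<Rightarrow> real^3^3" where "F x = vector [pd_u f x, pd_v f x, \<psi> x]" for x
  have Fi: "F x $ 1 = pd_u f x" "F x $ 2 = pd_v f x" "F x $ 3 = \<psi> x" for x
    by (simp_all add: F_def)
  have sm\<psi>: "smooth_on D \<psi>" using L by (simp add: L_Gauss_map_def)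
  have smF: "smooth_on D F"
  proof (rule smooth_on_vec[OF open_D])
    fix i :: 3
    show "smooth_on D (\<lambda>x. F x $ i)"
      using exhaust_3[of i] sm\<psi> smooth_on_pd[OF smf] by (auto simp: Fi)
  qed
  have gram: "F x ** S_mat ** transpose (F x) = metric_matrix x" if x: "x \<in> D" for x
  proof -
    have "lor (pd_u f x) (pd_u f x) = E x" "lor (pd_u f x) (pd_v f x) = 0" "lor (pd_v f x) (pd_v f x) = G x"
      using fun_cong[OF fun_cong[OF ff[OF x], of e_u], of e_u] fun_cong[OF fun_cong[OF ff[OF x], of e_u], of e_v]
        fun_cong[OF fun_cong[OF ff[OF x], of e_v], of e_v]
      by (simp_all add: first_ff_def pd_u_def pd_v_def)
    moreover have "lor (\<psi> x) (\<psi> x) = 0" using L x by (auto simp: L_Gauss_map_def lightcone_def)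
    moreover note null_transversal[OF dense smf L ff_D x]
    ultimately show ?thesis
      unfolding matrix_eq_entries forall_3 gram_matrix_nth Fi
      by (simp add: metric_matrix_def lor_commute)
  qed
  have system: "pd_u F x = P x ** F x \<and> pd_v F x = Q x ** F x" if x: "x \<in> D" for x
  proof -
    have smlor: "pd_u (\<lambda>x. lor (F x $ i) (F x $ j)) x = lor (F x $ i) (pd_u F x $ j) + lor (pd_u F x $ i) (F x $ j)"
      "pd_v (\<lambda>x. lor (F x $ i) (F x $ j)) x = lor (F x $ i) (pd_v F x $ j) + lor (pd_v F x $ i) (F x $ j)" for i j
      using pd_bilinear[OF bounded_bilinear_lor open_D smooth_on_linear[OF bounded_linear_vec_nth open_D smF]
          smooth_on_linear[OF bounded_linear_vec_nth open_D smF] x]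
        pd_linear[OF bounded_linear_vec_nth open_D smF x] by simp_all
    define a where "a i j = lor (pd_u F x $ i) (F x $ j)" for i j
    define b where "b i j = lor (pd_v F x $ i) (F x $ j)" for i j
    have "(pd_u metric_matrix x) $ i $ j = a i j + a j i" "(pd_v metric_matrix x) $ i $ j = b i j + b j i" for i j
      unfolding pd_matrix_nth[OF open_D smooth_matrices(1) x] a_def b_def
      using smlor[of i j] pd_cong[OF open_D x, of "\<lambda>x. lor (F x $ i) (F x $ j)" "\<lambda>x. metric_matrix x $ i $ j"]
      by (simp_all add: lor_commute frame_lor[OF gram])
    then have sym: "a i j + a j i = N_u x $ i $ j + N_u x $ j $ i" "b i j + b j i = N_v x $ i $ j + N_v x $ j $ i" for i j
      by (simp_all add: pd_metric_matrix[OF x] transpose_def)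
    have rows: "pd_u F x $ 1 = pd_u (pd_u f) x" "pd_u F x $ 2 = pd_u (pd_v f) x"
      "pd_v F x $ 1 = pd_v (pd_u f) x" "pd_v F x $ 2 = pd_v (pd_v f) x"
      using pd_linear[OF bounded_linear_vec_nth open_D smF x, of 1] pd_linear[OF bounded_linear_vec_nth open_D smF x, of 2]
      by (simp_all add: Fi)
    have comm: "a 2 j = b 1 j" for j
      unfolding a_def b_def rows pd_commute[OF open_D smf x] ..
    have h: "a 1 3 = X x" "b 1 3 = Y x" "b 2 3 = Z x"
      using fun_cong[OF fun_cong[OF sf[OF x], of e_u], of e_u] fun_cong[OF fun_cong[OF sf[OF x], of e_u], of e_v]
        fun_cong[OF fun_cong[OF sf[OF x], of e_v], of e_v]
      by (simp_all add: second_ff_def a_def b_def rows Fi)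
    have entries: "a i j = N_u x $ i $ j" "b i j = N_v x $ i $ j" for i j
    proof -
      have "\<forall>i j. a i j = N_u x $ i $ j \<and> b i j = N_v x $ i $ j"
        unfolding forall_3
        using sym(1)[of 1 1] sym(1)[of 1 2] sym(1)[of 1 3] sym(1)[of 2 2] sym(1)[of 2 3] sym(1)[of 3 3]
          sym(2)[of 1 1] sym(2)[of 1 2] sym(2)[of 1 3] sym(2)[of 2 2] sym(2)[of 2 3] sym(2)[of 3 3]
          comm[of 1] comm[of 2] comm[of 3] h
        by (simp add: N_u_def N_v_def)
      then show "a i j = N_u x $ i $ j" "b i j = N_v x $ i $ j" by blast+
    qed
    have det: "det (F x) \<noteq> 0"
      using null_frame_det[OF gram[OF x, unfolded metric_matrix_def]] E_pos[OF x] by auto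
    have "lor (F x $ j) (pd_u F x $ i - (P x ** F x) $ i) = 0"
      "lor (F x $ j) (pd_v F x $ i - (Q x ** F x) $ i) = 0" for i j
      using entries[of i j]
      by (simp_all add: lor.diff_right lor_commute[of "F x $ j"]
          frame_combination[OF gram[OF x]] P_metric[OF x] Q_metric[OF x] a_def b_def)
    then have "pd_u F x $ i - (P x ** F x) $ i = 0" "pd_v F x $ i - (Q x ** F x) $ i = 0" for i
      by (blast intro: frame_nondegenerate[OF det])+
    then show ?thesis by (simp add: vec_eq_iff)
  qed
  have "(F has_derivative (\<lambda>h. (fst h *\<^sub>R P x + snd h *\<^sub>R Q x) ** F x)) (at x)" if x: "x \<in> D" for x
    using smooth_on_has_derivative_pd[OF open_D smF x] system[OF x]
    by (simp add: bounded_bilinear.add_left[OF bounded_bilinear_matrix_mult]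
        bounded_bilinear.scaleR_left[OF bounded_bilinear_matrix_mult])
  then have "solves_frame_system F" using gram by (auto simp: solves_frame_system_def)
  then show ?thesis by (simp add: F_def[abs_def])
qed

lemma surface_unique:
  assumes conn: "connected D"
    and dense: "D \<subseteq> closure {y \<in> D. G y \<noteq> 0}"
    and f: "smooth_on D f" "L_Gauss_map D f \<psi>"
      "\<forall>x\<in>D. first_ff f x = coeff_form (E x) 0 (G x)"
      "\<forall>x\<in>D. second_ff f \<psi> x = coeff_form (X x) (Y x) (Z x)"
    and f': "smooth_on D f'" "L_Gauss_map D f' \<psi>'"
      "\<forall>x\<in>D. first_ff f' x = coeff_form (E x) 0 (G x)"
      "\<forall>x\<in>D. second_ff f' \<psi>' x = coeff_form (X x) (Y x) (Z x)"
    and "x0 \<in> D"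
  shows "congruent_pairs D f \<psi> f' \<psi>'"
proof -
  obtain A where A: "lor_orthogonal A" "\<And>x i. x \<in> D \<Longrightarrow>
      (vector [pd_u f' x, pd_v f' x, \<psi>' x] :: real^3^3) $ i = A *v ((vector [pd_u f x, pd_v f x, \<psi> x] :: real^3^3) $ i)"
    using solves_frame_system_unique[OF conn \<open>x0 \<in> D\<close> frame_of_surface[OF dense f] frame_of_surface[OF dense f']]
    by blast
  have rows: "pd_u f' x = A *v pd_u f x" "pd_v f' x = A *v pd_v f x" "\<psi>' x = A *v \<psi> x" if "x \<in> D" for x
    using A(2)[OF that, of 1] A(2)[OF that, of 2] A(2)[OF that, of 3] by simp_all
  have der: "((\<lambda>x. f' x - A *v f x) has_derivative (\<lambda>h. 0)) (at x)" if "x \<in> D" for x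
    by (rule has_derivative_eq_rhs[OF has_derivative_diff[OF smooth_on_has_derivative_pd[OF open_D f'(1) that]
          bounded_linear.has_derivative[OF matrix_vector_mul_bounded_linear[of A] smooth_on_has_derivative_pd[OF open_D f(1) that]]]])
      (simp add: fun_eq_iff rows[OF that] matrix_vector_right_distrib scaleR_matrix_vector_assoc
        vector_scaleR_matrix_ac matrix_vector_mult_scaleR)
  define b where "b = f' x0 - A *v f x0"
  have "f' x - A *v f x = b" if "x \<in> D" for x
    unfolding b_def by (rule has_derivative_zero_unique_connected[OF open_D conn der that \<open>x0 \<in> D\<close>])
  then have "f' x = A *v f x + b \<and> \<psi>' x = A *v \<psi> x" if "x \<in> D" for x
    using that rows(3) by (metis diff_eq_eq add.commute)
  with A(1) show ?thesis unfolding congruent_pairs_def by blast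
qed

end

section \<open>Fundamental theorem of mixed type surfaces\<close>

theorem theorem4p7:
  fixes M :: "'a topology" and A :: "'a chart set"
    and g :: "'a chart \<Rightarrow> real \<times> real \<Rightarrow> form"
    and p :: 'a and c :: "'a chart" and D :: "(real \<times> real) set"
    and E G X Y Z :: "real \<times> real \<Rightarrow> real"
  assumes "smooth_2_manifold M A"
    and "admissible_metric M A g"
    and "semidefinite_point M A g p"
    and "L_coord_nbhd M A g p c"
    and "D = chart_image c"
    and "simply_connected D"
    and "\<forall>x\<in>D. g c x = coeff_form (E x) 0 (G x)"
    and "smooth_on D X" and "smooth_on D Y" and "smooth_on D Z"
    and Codazzi1: "\<forall>x\<in>D. pd_v X x - pd_u Y x =
          1 / (2 * E x) * (pd_v E x * X x - pd_u E x * Y x) + (Y x)\<^sup>2 - X x * Z x"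
    and Codazzi2: "\<forall>x\<in>D. pd_v Y x - pd_u Z x =
          - (1 / (2 * E x)) * (pd_u G x * X x + pd_v E x * Y x)"
    and Gauss: "\<forall>x\<in>D. pd_v (pd_v E) x + pd_u (pd_u G) x
          - (pd_u E x * pd_u G x + (pd_v E x)\<^sup>2) / (2 * E x) =
          2 * G x * (X x * Z x - (Y x)\<^sup>2)
          - pd_v G x * X x + 2 * pd_u G x * Y x + pd_v E x * Z x"
  defines "h \<equiv> \<lambda>x. coeff_form (X x) (Y x) (Z x)"
  shows "(\<exists>f \<psi>. realizes D (g c) h f \<psi> \<and>
            (\<exists>V. open V \<and> simply_connected V \<and> (0, 0) \<in> V \<and> V \<subseteq> D \<and>
                 embedded_surface V f \<and> mixed_type V f)) \<and>
         (\<forall>f \<psi> f' \<psi>'. realizes D (g c) h f \<psi> \<and> realizes D (g c) h f' \<psi>' \<longrightarrow>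
            congruent_pairs D f \<psi> f' \<psi>')"
proof -
  have conn: "connected D" using assms(6) by (rule simply_connected_imp_connected)
  interpret L: L_coordinates M A g c D E G p
  proof
    show "metric_tensor M A g" using assms(2) by (simp add: admissible_metric_def mixed_type_metric_def)
    show "coord_nbhd M A c" using assms(4) by (simp add: L_coord_nbhd_def)
  qed (use assms conn in auto)
  interpret integrable_data D E G X Y Z
  proof
    show "open D" "smooth_on D E" "smooth_on D G" by (rule L.open_D L.smooth_EG)+
    show "E x > 0" if "x \<in> D" for x using that by (rule L.E_pos)
  qed (use assms in auto)
  have dense: "D \<subseteq> closure {y \<in> D. G y \<noteq> 0}"
  proof
    fix x assume x: "x \<in> D"
    show "x \<in> closure {y \<in> D. G y \<noteq> 0}"
    proof (cases "G x = 0")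
      case True
      have "{y \<in> D. G y \<noteq> 0} \<inter> V \<noteq> {}" if "x \<in> V" "open V" for V
        using L.G_changes_sign(1)[OF x True that(2,1)] by force
      then show ?thesis by (simp add: closure_iff_nhds_not_empty) blast
    qed (use x closure_subset[of "{y \<in> D. G y \<noteq> 0}"] in auto)
  qed
  have mixed: "mixed_type V f" if ff: "\<forall>x\<in>D. first_ff f x = coeff_form (E x) 0 (G x)"
    and V: "open V" "(0, 0) \<in> V" "V \<subseteq> D" for V f
  proof -
    obtain y z where "y \<in> V" "G y > 0" "z \<in> V" "G z < 0"
      using L.G_changes_sign[OF L.origin V(1,2)] by blast
    moreover from this V have "y \<in> D" "z \<in> D" by auto
    ultimately have "pos_def (first_ff f y)" "indefinite (first_ff f z)" "degenerate (first_ff f (0, 0))"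
      by (simp_all add: ff E_pos L.origin pos_def_diagonal indefinite_diagonal degenerate_diagonal)
    then show ?thesis using V \<open>y \<in> V\<close> \<open>z \<in> V\<close> unfolding mixed_type_def by blast
  qed
  have "\<exists>f \<psi>. realizes D (g c) h f \<psi> \<and> (\<exists>V. open V \<and> simply_connected V \<and> (0, 0) \<in> V \<and> V \<subseteq> D \<and>
      embedded_surface V f \<and> mixed_type V f)"
  proof -
    obtain f \<psi> where f: "immersed_surface D f" "L_Gauss_map D f \<psi>"
      "\<forall>x\<in>D. first_ff f x = coeff_form (E x) 0 (G x)"
      "\<forall>x\<in>D. second_ff f \<psi> x = coeff_form (X x) (Y x) (Z x)"
      using surface_exists[OF assms(6) L.origin(1)] .
    have "realizes D (g c) h f \<psi>"
      using f mixed[OF f(3) L.open_D L.origin(1) order_refl]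
      by (simp add: realizes_def h_def L.diagonal)
    moreover obtain r where r: "r > 0" "ball (0, 0) r \<subseteq> D" "embedded_surface (ball (0, 0) r) f"
      using immersion_locally_embedding[OF f(1) L.origin(1)] .
    moreover have "mixed_type (ball (0, 0) r) f"
      using r by (intro mixed f(3)) auto
    moreover have "simply_connected (ball (0 :: real, 0 :: real) r)"
      by (intro convex_imp_simply_connected convex_ball)
    ultimately show ?thesis
      by (intro exI[of _ f] exI[of _ \<psi>] conjI exI[of _ "ball (0, 0) r"]) auto
  qed
  moreover have "congruent_pairs D f \<psi> f' \<psi>'"
    if "realizes D (g c) h f \<psi>" "realizes D (g c) h f' \<psi>'" for f \<psi> f' \<psi>'
    using that L.origin(1)
    by (intro surface_unique[OF conn dense])
      (simp_all add: realizes_def h_def immersed_surface_def L.diagonal)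
  ultimately show ?thesis by blast
qed

end
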